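(* Let $U$ be a real analytic function, $\sigma$ a real analytic one-form and $g=(g_{ij})$ a real analytic Riemannian metric on a neighbourhood of the origin $p=0$ in $\mathbb{R}^n$, with $U(0)=0$, $d_0U=0$, $g_{ij}(0)=\delta_{ij}$, and $U$ not a homogeneous polynomial. Write the first and second non-zero homogeneous terms of the Maclaurin series $$U=U_{l_1}+U_{l_2}+\cdots,\qquad g_{ij}=\delta_{ij}+g^{(m)}_{ij}+\cdots,$$ and let $\kappa=\min\{l_2-l_1,\,m\}$. Assume that the degree $d$ of the first non-zero jet of the magnetic potential $\sigma$ at $p$ verifies $d-l_1/2>\kappa$. Let $f=U_{l_1}|_{S^{n-1}}$ and define the criterion function $$\mathcal{C}(q)=-\delta_\kappa^{\,l_2-l_1}(l_2-l_1)\,U_{l_2}(q)+\delta_\kappa^{\,m}\,m\,U_{l_1}(q)\sum_{i,j=1}^n g^{(m)}_{ij}(q)\,q^iq^j,\qquad q\in S^{n-1}.$$ If $\mathcal{C}(q)>0$ at every critical point $q$ of $f$ such that $f(q)\le 0$, then the point $p$ is totally unstable for the Lagrangian system $L(x,v)=\tfrac12 g_x(v,v)+\sigma_x(v)-U(x)$.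
   Context: Here $l_1<l_2$ are the degrees of the first and second non-zero homogeneous terms of $U$ (so $l_1\ge2$), and $m\ge1$ is the smallest positive degree in which some coefficient $g_{ij}$ has a non-zero homogeneous term; $g^{(m)}_{ij}$ is the degree-$m$ homogeneous part of $g_{ij}$. If the metric is Euclidean, formally $m=\infty$ (so $\kappa=l_2-l_1$ and the second term of $\mathcal{C}$ is absent). $\delta_a^b$ is the Kronecker delta. $d$ is the smallest degree of a non-zero homogeneous Taylor term of the coefficients of $\sigma$; if the germ of $\sigma$ is zero, the condition on $d$ is considered satisfied. $S^{n-1}$ is the Euclidean unit sphere. The Euler–Lagrange flow is given by $\dot x=v$, $\nabla_{\dot x}v=-\mathrm{grad}_gU(x)-\mathcal{R}_x(\iota_v d\sigma(x))$, where $\nabla$ is the Levi-Civita connection and $\mathcal{R}_x$ is Riesz duality from covectors to vectors. The energy $H(x,v)=\tfrac12g_x(v,v)+U(x)$ is constant along orbits. $p$ is totally unstable if there is a neighbourhood $B$ of $p$ such that for every $z\in TB$ with $H(z)<0$, the positive orbit of $z$ is not contained in $TB$. *)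

theory Defs
  imports "HOL-Analysis.Analysis"
begin

section \<open>Real analytic functions and homogeneous Maclaurin terms\<close>

definition monom_at :: "('n::finite \<Rightarrow> nat) \<Rightarrow> real ^ 'n \<Rightarrow> real" where
  "monom_at \<alpha> x = (\<Prod>i\<in>UNIV. (x $ i) ^ \<alpha> i)"

(* Summation over multi-indices is unordered (has_sum), i.e. absolute. *)
definition power_series_at ::
    "(real ^ 'n \<Rightarrow> real) \<Rightarrow> real ^ 'n \<Rightarrow> (('n::finite \<Rightarrow> nat) \<Rightarrow> real) \<Rightarrow> bool" where
  "power_series_at f a c \<longleftrightarrow>
     (\<exists>r>0. \<forall>x\<in>ball a r. ((\<lambda>\<alpha>. c \<alpha> * monom_at \<alpha> (x - a)) has_sum f x) UNIV)"

definition real_analytic_on :: "(real ^ 'n::finite \<Rightarrow> real) \<Rightarrow> (real ^ 'n) set \<Rightarrow> bool" where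
  "real_analytic_on f S \<longleftrightarrow> (\<forall>a\<in>S. \<exists>c. power_series_at f a c)"

definition hom_part :: "(('n::finite \<Rightarrow> nat) \<Rightarrow> real) \<Rightarrow> nat \<Rightarrow> real ^ 'n \<Rightarrow> real" where
  "hom_part c k x = (\<Sum>\<alpha> | sum \<alpha> UNIV = k. c \<alpha> * monom_at \<alpha> x)"

definition homogeneous_polynomial :: "(real ^ 'n::finite \<Rightarrow> real) \<Rightarrow> bool" where
  "homogeneous_polynomial P \<longleftrightarrow> (\<exists>k c. P = hom_part c k)"

(* Degree-k homogeneous term of the Maclaurin series of f, for f analytic at 0. It does not
   depend on the selected coefficient family: see hom_term_eq below. *)
definition hom_term :: "(real ^ 'n::finite \<Rightarrow> real) \<Rightarrow> nat \<Rightarrow> real ^ 'n \<Rightarrow> real" where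
  "hom_term f = hom_part (SOME c. power_series_at f 0 c)"

lemma finite_multi_index: "finite {\<alpha> :: 'n::finite \<Rightarrow> nat. sum \<alpha> UNIV = k}"
proof (rule finite_subset)
  show "{\<alpha> :: 'n \<Rightarrow> nat. sum \<alpha> UNIV = k} \<subseteq> PiE UNIV (\<lambda>_. {..k})"
    by (auto intro!: member_le_sum)
  show "finite (PiE (UNIV :: 'n set) (\<lambda>_. {..k}))"
    by (intro finite_PiE) auto
qed

lemma hom_part_scale: "hom_part c k (t *\<^sub>R x) = hom_part c k x * t ^ k"
  unfolding hom_part_def sum_distrib_right
  by (intro sum.cong)
     (auto simp: monom_at_def power_mult_distrib prod.distrib power_sum mult_ac)

lemma hom_part_sums:
  assumes "((\<lambda>\<alpha>. c \<alpha> * monom_at \<alpha> x) has_sum s) UNIV"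
  shows "(\<lambda>k. hom_part c k x) sums s"
proof -
  let ?A = "\<lambda>k. {\<alpha> :: 'a \<Rightarrow> nat. sum \<alpha> UNIV = k}"
  have "((\<lambda>(k, \<alpha>). c \<alpha> * monom_at \<alpha> x) has_sum s) (Sigma UNIV ?A) \<longleftrightarrow>
        ((\<lambda>\<alpha>. c \<alpha> * monom_at \<alpha> x) has_sum s) UNIV"
    by (rule has_sum_reindex_bij_witness[where i = "\<lambda>\<alpha>. (sum \<alpha> UNIV, \<alpha>)" and j = snd]) auto
  with assms have "((\<lambda>(k, \<alpha>). c \<alpha> * monom_at \<alpha> x) has_sum s) (Sigma UNIV ?A)"
    by simp
  then have "((\<lambda>k. hom_part c k x) has_sum s) UNIV"
    by (rule has_sum_SigmaD)
       (auto simp: hom_part_def finite_multi_index intro!: has_sum_finite)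
  then show ?thesis
    by (rule has_sum_imp_sums)
qed

lemma powser_zero_coeffs:
  fixes a :: "nat \<Rightarrow> real"
  assumes s: "0 < s" and sm: "\<And>t. \<bar>t\<bar> < s \<Longrightarrow> (\<lambda>n. a n * t ^ n) sums 0"
  shows "a n = 0"
proof (induction n rule: less_induct)
  case (less n)
  have "(\<lambda>k. a (k + n) * t ^ k) sums (0 :: real)" if "t \<noteq> 0" "norm t < s" for t
  proof -
    have "(\<lambda>k. a (k + n) * t ^ (k + n)) sums (0 - (\<Sum>i<n. a i * t ^ i))"
      using sm[of t] that by (intro sums_split_initial_segment) auto
    also have "(\<Sum>i<n. a i * t ^ i) = 0"
      using less by (intro sum.neutral) auto
    finally have "(\<lambda>k. a (k + n) * t ^ (k + n) / t ^ n) sums (0 / t ^ n)"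
      by (intro sums_divide) auto
    then show ?thesis
      using that by (simp add: power_add)
  qed
  then have "((\<lambda>_. 0) \<longlongrightarrow> a (0 + n)) (at (0 :: real))"
    by (rule powser_limit_0_strong[OF s])
  then show ?case
    using tendsto_unique[OF at_neq_bot tendsto_const] by fastforce
qed

lemma hom_part_unique:
  assumes "power_series_at f 0 c" "power_series_at f 0 c'"
  shows "hom_part c = hom_part c'"
proof (intro ext)
  fix k and x :: "real ^ 'a"
  obtain r1 where r1: "r1 > 0"
    "\<And>y. norm y < r1 \<Longrightarrow> ((\<lambda>\<alpha>. c \<alpha> * monom_at \<alpha> y) has_sum f y) UNIV"
    using assms(1) by (auto simp: power_series_at_def)
  obtain r2 where r2: "r2 > 0"
    "\<And>y. norm y < r2 \<Longrightarrow> ((\<lambda>\<alpha>. c' \<alpha> * monom_at \<alpha> y) has_sum f y) UNIV"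
    using assms(2) by (auto simp: power_series_at_def)
  define s where "s = min r1 r2 / (norm x + 1)"
  have pos: "norm x + 1 > 0"
    by (smt (verit) norm_ge_zero)
  have s: "s > 0"
    using r1(1) r2(1) pos by (simp add: s_def)
  have "(\<lambda>k. (hom_part c k x - hom_part c' k x) * t ^ k) sums 0" if "\<bar>t\<bar> < s" for t
  proof -
    have "norm (t *\<^sub>R x) \<le> \<bar>t\<bar> * (norm x + 1)"
      by (simp add: mult_left_mono)
    also have "\<dots> < min r1 r2"
      using that pos by (simp add: s_def pos_less_divide_eq)
    finally have "norm (t *\<^sub>R x) < r1" "norm (t *\<^sub>R x) < r2"
      by auto
    then have "(\<lambda>k. hom_part c k (t *\<^sub>R x) - hom_part c' k (t *\<^sub>R x)) sums
                 (f (t *\<^sub>R x) - f (t *\<^sub>R x))"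
      by (intro sums_diff hom_part_sums r1 r2)
    then show ?thesis
      by (simp add: hom_part_scale left_diff_distrib)
  qed
  from powser_zero_coeffs[OF s this] show "hom_part c k x = hom_part c' k x"
    by simp
qed

lemma hom_term_eq: "power_series_at f 0 c \<Longrightarrow> hom_term f = hom_part c"
  unfolding hom_term_def by (metis hom_part_unique someI)

definition nonzero_term :: "(real ^ 'n::finite \<Rightarrow> real) \<Rightarrow> nat \<Rightarrow> bool" where
  "nonzero_term f k \<longleftrightarrow> (\<exists>x. hom_term f k x \<noteq> 0)"

definition first_degree :: "(real ^ 'n::finite \<Rightarrow> real) \<Rightarrow> nat" where
  "first_degree f = (LEAST k. nonzero_term f k)"

definition second_degree :: "(real ^ 'n::finite \<Rightarrow> real) \<Rightarrow> nat" where
  "second_degree f = (LEAST k. first_degree f < k \<and> nonzero_term f k)"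


section \<open>Metric, magnetic potential and Euler--Lagrange flow\<close>

definition partial :: "'n \<Rightarrow> (real ^ 'n::finite \<Rightarrow> real) \<Rightarrow> real ^ 'n \<Rightarrow> real" where
  "partial i f x = frechet_derivative f (at x) (axis i 1)"

definition analytic_metric_on ::
    "(real ^ 'n::finite \<Rightarrow> real ^ 'n ^ 'n) \<Rightarrow> (real ^ 'n) set \<Rightarrow> bool" where
  "analytic_metric_on g W \<longleftrightarrow>
     (\<forall>i j. real_analytic_on (\<lambda>x. g x $ i $ j) W) \<and>
     (\<forall>x\<in>W. transpose (g x) = g x \<and> (\<forall>v. v \<noteq> 0 \<longrightarrow> v \<bullet> (g x *v v) > 0))"

(* One-forms are given by their components: \<sigma> x $ i is the coefficient of dx^i. *)
definition analytic_one_form_on ::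
    "(real ^ 'n::finite \<Rightarrow> real ^ 'n) \<Rightarrow> (real ^ 'n) set \<Rightarrow> bool" where
  "analytic_one_form_on \<sigma> W \<longleftrightarrow> (\<forall>i. real_analytic_on (\<lambda>x. \<sigma> x $ i) W)"

(* Infinity if the metric is Euclidean near 0 (Inf of the empty set in enat). *)
definition metric_degree :: "(real ^ 'n::finite \<Rightarrow> real ^ 'n ^ 'n) \<Rightarrow> enat" where
  "metric_degree g = Inf (enat ` {k. k \<ge> 1 \<and> (\<exists>i j. nonzero_term (\<lambda>x. g x $ i $ j) k)})"

(* Infinity if the germ of \<sigma> at 0 is zero. *)
definition magnetic_degree :: "(real ^ 'n::finite \<Rightarrow> real ^ 'n) \<Rightarrow> enat" where
  "magnetic_degree \<sigma> = Inf (enat ` {k. \<exists>i. nonzero_term (\<lambda>x. \<sigma> x $ i) k})"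

definition riesz :: "real ^ 'n ^ 'n \<Rightarrow> real ^ 'n::finite \<Rightarrow> real ^ 'n" where
  "riesz G \<beta> = matrix_inv G *v \<beta>"

definition grad ::
    "(real ^ 'n \<Rightarrow> real ^ 'n ^ 'n) \<Rightarrow> (real ^ 'n \<Rightarrow> real) \<Rightarrow> real ^ 'n::finite \<Rightarrow> real ^ 'n" where
  "grad g U x = riesz (g x) (\<chi> i. partial i U x)"

(* Gamma^k_ij a^i b^j for the Levi-Civita connection of g. *)
definition christoffel ::
    "(real ^ 'n \<Rightarrow> real ^ 'n ^ 'n) \<Rightarrow> real ^ 'n::finite \<Rightarrow> real ^ 'n \<Rightarrow> real ^ 'n \<Rightarrow> real ^ 'n" where
  "christoffel g x a b = riesz (g x) (\<chi> l. \<Sum>i\<in>UNIV. \<Sum>j\<in>UNIV. 1 / 2 *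
      (partial i (\<lambda>y. g y $ j $ l) x + partial j (\<lambda>y. g y $ i $ l) x
       - partial l (\<lambda>y. g y $ i $ j) x) * a $ i * b $ j)"

(* The covector \<iota>_v d\<sigma>(x), where (d\<sigma>)_ij = \<partial>_i \<sigma>_j - \<partial>_j \<sigma>_i. *)
definition contract_d ::
    "(real ^ 'n \<Rightarrow> real ^ 'n) \<Rightarrow> real ^ 'n::finite \<Rightarrow> real ^ 'n \<Rightarrow> real ^ 'n" where
  "contract_d \<sigma> x v = (\<chi> j. \<Sum>i\<in>UNIV. v $ i *
      (partial i (\<lambda>y. \<sigma> y $ j) x - partial j (\<lambda>y. \<sigma> y $ i) x))"

(* Euler--Lagrange flow of L(x,v) = g_x(v,v)/2 + \<sigma>_x(v) - U(x) on TW, on the time interval [0,T]: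
   x' = v and nabla_{x'} v = - grad_g U - R(\<iota>_v d\<sigma>), where nabla_{x'} v = v' + Gamma(v,v). *)
definition EL_solution ::
    "(real ^ 'n) set \<Rightarrow> (real ^ 'n \<Rightarrow> real ^ 'n ^ 'n) \<Rightarrow> (real ^ 'n \<Rightarrow> real ^ 'n) \<Rightarrow>
     (real ^ 'n::finite \<Rightarrow> real) \<Rightarrow> real \<Rightarrow> (real \<Rightarrow> real ^ 'n) \<Rightarrow> (real \<Rightarrow> real ^ 'n) \<Rightarrow> bool" where
  "EL_solution W g \<sigma> U T x v \<longleftrightarrow> (\<forall>t\<in>{0..T}. x t \<in> W \<and>
     (x has_vector_derivative v t) (at t within {0..T}) \<and>
     (v has_vector_derivative
        (- christoffel g (x t) (v t) (v t) - grad g U (x t) - riesz (g (x t)) (contract_d \<sigma> (x t) (v t))))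
       (at t within {0..T}))"

(* Every phase point reached from z in some time T \<ge> 0; since solutions are unique, this is the
   trace of the maximal forward solution, including the case of finite escape time. *)
definition positive_orbit ::
    "(real ^ 'n) set \<Rightarrow> (real ^ 'n \<Rightarrow> real ^ 'n ^ 'n) \<Rightarrow> (real ^ 'n \<Rightarrow> real ^ 'n) \<Rightarrow>
     (real ^ 'n::finite \<Rightarrow> real) \<Rightarrow> (real ^ 'n) \<times> (real ^ 'n) \<Rightarrow> ((real ^ 'n) \<times> (real ^ 'n)) set" where
  "positive_orbit W g \<sigma> U z =
     {(x T, v T) | x v T. T \<ge> 0 \<and> EL_solution W g \<sigma> U T x v \<and> (x 0, v 0) = z}"

definition energy ::
    "(real ^ 'n \<Rightarrow> real ^ 'n ^ 'n) \<Rightarrow> (real ^ 'n::finite \<Rightarrow> real) \<Rightarrow> (real ^ 'n) \<times> (real ^ 'n) \<Rightarrow> real" where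
  "energy g U = (\<lambda>(x, v). 1 / 2 * (v \<bullet> (g x *v v)) + U x)"

(* TB = B \<times> UNIV in the coordinates of real ^ 'n. *)
definition totally_unstable ::
    "(real ^ 'n) set \<Rightarrow> (real ^ 'n \<Rightarrow> real ^ 'n ^ 'n) \<Rightarrow> (real ^ 'n \<Rightarrow> real ^ 'n) \<Rightarrow>
     (real ^ 'n::finite \<Rightarrow> real) \<Rightarrow> real ^ 'n \<Rightarrow> bool" where
  "totally_unstable W g \<sigma> U p \<longleftrightarrow> (\<exists>B. open B \<and> p \<in> B \<and> B \<subseteq> W \<and>
     (\<forall>z \<in> B \<times> UNIV. energy g U z < 0 \<longrightarrow> \<not> positive_orbit W g \<sigma> U z \<subseteq> B \<times> UNIV))"


section \<open>The criterion function\<close>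

(* q is a critical point of the restriction of F to the unit sphere: dF vanishes on the
   tangent space of the sphere at q, which is the orthogonal complement of q. *)
definition sphere_critical_point :: "(real ^ 'n::finite \<Rightarrow> real) \<Rightarrow> real ^ 'n \<Rightarrow> bool" where
  "sphere_critical_point F q \<longleftrightarrow> q \<in> sphere 0 1 \<and>
     (\<exists>D. (F has_derivative D) (at q) \<and> (\<forall>w. w \<bullet> q = 0 \<longrightarrow> D w = 0))"

definition kronecker :: "enat \<Rightarrow> enat \<Rightarrow> real" where
  "kronecker a b = (if a = b then 1 else 0)"

(* If m = \<infinity>, then \<kappa> = l2 - l1 is finite, so the factor kronecker \<kappa> m removes the second term
   and the junk value of the_enat plays no role. *)
definition criterion ::
    "nat \<Rightarrow> nat \<Rightarrow> enat \<Rightarrow> enat \<Rightarrow> (real ^ 'n::finite \<Rightarrow> real) \<Rightarrow>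
     (real ^ 'n \<Rightarrow> real ^ 'n ^ 'n) \<Rightarrow> real ^ 'n \<Rightarrow> real" where
  "criterion l1 l2 m \<kappa> U g q =
     - kronecker \<kappa> (enat (l2 - l1)) * real (l2 - l1) * hom_term U l2 q
     + kronecker \<kappa> m * real (the_enat m) * hom_term U l1 q *
       (\<Sum>i\<in>UNIV. \<Sum>j\<in>UNIV. hom_term (\<lambda>x. g x $ i $ j) (the_enat m) q * q $ i * q $ j)"

end

theory Submission
  imports Defs
begin

text \<open>Let \<open>h < 0\<close> be the energy of an orbit staying in a small ball, let \<open>P\<close> be the first homogeneous term of \<open>U\<close>,
  of degree \<open>l1\<close>, and consider the Lyapunov function
  \<open>V = (x - A |x|^(\<kappa> - l1 + 2) grad P(x)) \<bullet> g(x) v\<close>.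
  By Euler's identity the virial part of \<open>V'\<close> is \<open>v \<bullet> g v - l1 U - (l2 - l1) U_l2 + ...\<close>, and the correction
  contributes \<open>A |x|^(l1 + \<kappa>) |grad P(x/|x|)|\<^sup>2\<close>. Where \<open>grad P\<close> vanishes on the sphere, \<open>P\<close> is critical with
  value 0; there the metric part of the criterion drops out and the criterion forces \<open>\<kappa> = l2 - l1\<close> and \<open>U_l2 < 0\<close>.
  By compactness the two terms of order \<open>l1 + \<kappa>\<close> have a positive sum when \<open>A\<close> is large, and
  they absorb all errors of higher order, in particular the magnetic force because \<open>2 d > l1 + 2 \<kappa>\<close>;
  errors of order \<open>|x| |v|\<^sup>2\<close> are absorbed by \<open>v \<bullet> g v\<close>. What remains is
  \<open>V' \<ge> - l1 U \<ge> - h > 0\<close>, which contradicts the boundedness of \<open>V\<close> in finite time.\<close>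

section \<open>Power series at the origin\<close>

text \<open>The notion of total instability shapes the second half of the proof.
  \<open>positive_orbit\<close> contains only points that are actually reached, so confinement to
  the ball is refuted only once a solution has been constructed on an interval long enough for
  \<open>V\<close> to outgrow its bound. Confinement itself supplies what the continuation needs:
  the position stays in the ball, and the conserved negative energy bounds the speed. Negative
  energy also keeps the orbit away from the origin, where the weight in \<open>V\<close> may be
  singular. The metric is never expanded to order \<open>m\<close>. Pairing with the momentum
  \<open>g v\<close> instead of \<open>v\<close> removes the inverse metric from \<open>V'\<close>,
  and all remaining metric terms are quadratic in \<open>v\<close> with a factor |x|. The derivative
  of the correction has the same size, because \<kappa> \<ge> 1; half of
  \<open>v \<bullet> g v\<close> pays for both. The magnetic term is linear in \<open>v\<close> and
  does not fit this pattern. It is split into a multiple of |x| |v|^2 and a pure power |x|^(2 d -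
  1), and the hypothesis on \<open>d\<close> makes this exponent at least l1 + \<kappa> + 1.\<close>

definition dcoeff :: "'n \<Rightarrow> (('n::finite \<Rightarrow> nat) \<Rightarrow> real) \<Rightarrow> ('n \<Rightarrow> nat) \<Rightarrow> real" where
  "dcoeff i c \<alpha> = real (\<alpha> i + 1) * c (\<alpha>(i := \<alpha> i + 1))"

lemma sum_fun_upd_Suc:
  fixes \<alpha> :: "'n::finite \<Rightarrow> nat"
  shows "sum (\<alpha>(i := \<alpha> i + 1)) UNIV = Suc (sum \<alpha> UNIV)"
proof -
  have "sum (\<alpha>(i := \<alpha> i + 1)) (UNIV - {i}) = sum \<alpha> (UNIV - {i})"
    by (intro sum.cong) auto
  then show ?thesis
    by (simp add: sum.remove[of UNIV i])
qed

lemma abs_monom_at_le: "\<bar>monom_at \<alpha> x\<bar> \<le> norm x ^ sum \<alpha> UNIV"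
  unfolding monom_at_def abs_prod power_sum
  by (intro prod_mono) (auto simp: power_abs intro!: power_mono component_le_norm_cart)

text \<open>The truncated exponent \<open>\<alpha> i - 1\<close> is harmless for
  \<open>\<alpha> i = 0\<close>, since the factor \<open>real (\<alpha> i)\<close> is then
  0.\<close>

lemma monom_at_has_derivative:
  "(monom_at \<alpha> has_derivative (\<lambda>h. \<Sum>i\<in>UNIV. h $ i * (real (\<alpha> i) * monom_at (\<alpha>(i := \<alpha> i - 1)) x))) (at x)"
proof -
  have "((\<lambda>x. \<Prod>i\<in>UNIV. (x $ i) ^ \<alpha> i) has_derivative
    (\<lambda>h. \<Sum>i\<in>UNIV. (of_nat (\<alpha> i) * h $ i * (x $ i) ^ (\<alpha> i - 1)) * (\<Prod>j\<in>UNIV - {i}. (x $ j) ^ \<alpha> j))) (at x)"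
    by (intro has_derivative_prod has_derivative_power bounded_linear_imp_has_derivative
          bounded_linear_vec_nth)
  moreover have "monom_at (\<alpha>(i := \<alpha> i - 1)) x = x $ i ^ (\<alpha> i - 1) * (\<Prod>j\<in>UNIV - {i}. (x $ j) ^ \<alpha> j)" for i
  proof -
    have "(\<Prod>j\<in>UNIV - {i}. (x $ j) ^ (\<alpha>(i := \<alpha> i - 1)) j) = (\<Prod>j\<in>UNIV - {i}. (x $ j) ^ \<alpha> j)"
      by (intro prod.cong) auto
    then show ?thesis
      unfolding monom_at_def by (subst prod.remove[of UNIV i]) auto
  qed
  ultimately show ?thesis
    unfolding monom_at_def[abs_def] by (simp add: mult_ac)
qed

text \<open>Differentiation in direction \<open>i\<close> kills the multi-indices with
  \<open>\<alpha> i = 0\<close>, and lowering the \<open>i\<close>-th entry maps the others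
  bijectively onto the multi-indices of degree \<open>k\<close>. The family
  \<open>dcoeff i c\<close> is the termwise derivative after this change of index.\<close>

lemma hom_part_has_derivative:
  "(hom_part c (Suc k) has_derivative (\<lambda>h. \<Sum>i\<in>UNIV. h $ i * hom_part (dcoeff i c) k x)) (at x)"
proof -
  have eq: "(\<Sum>\<alpha> | sum \<alpha> UNIV = Suc k. c \<alpha> * (real (\<alpha> i) * monom_at (\<alpha>(i := \<alpha> i - 1)) x))
      = hom_part (dcoeff i c) k x" for i :: 'a
  proof -
    have "(\<Sum>\<alpha> | sum \<alpha> UNIV = Suc k. c \<alpha> * (real (\<alpha> i) * monom_at (\<alpha>(i := \<alpha> i - 1)) x))
      = (\<Sum>\<alpha> | sum \<alpha> UNIV = Suc k \<and> \<alpha> i > 0. c \<alpha> * (real (\<alpha> i) * monom_at (\<alpha>(i := \<alpha> i - 1)) x))"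
      by (rule sum.mono_neutral_right) (auto simp: finite_multi_index)
    also have "\<dots> = hom_part (dcoeff i c) k x"
      unfolding hom_part_def dcoeff_def
    proof (rule sum.reindex_bij_witness[where i = "\<lambda>\<beta>. \<beta>(i := \<beta> i + 1)" and j = "\<lambda>\<alpha>. \<alpha>(i := \<alpha> i - 1)"])
      fix \<alpha> :: "'a \<Rightarrow> nat"
      assume a: "\<alpha> \<in> {\<alpha>. sum \<alpha> UNIV = Suc k \<and> \<alpha> i > 0}"
      define \<beta> where "\<beta> = \<alpha>(i := \<alpha> i - 1)"
      have "\<alpha> = \<beta>(i := \<beta> i + 1)"
        using a by (auto simp: \<beta>_def)
      then show "\<alpha>(i := \<alpha> i - 1) \<in> {\<alpha>. sum \<alpha> UNIV = k}"
        using a sum_fun_upd_Suc[of \<beta> i] by (auto simp: \<beta>_def)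
    qed (auto simp: sum_fun_upd_Suc[simplified])
    finally show ?thesis .
  qed
  have "(hom_part c (Suc k) has_derivative (\<lambda>h. \<Sum>\<alpha> | sum \<alpha> UNIV = Suc k. c \<alpha> *
      (\<Sum>i\<in>UNIV. h $ i * (real (\<alpha> i) * monom_at (\<alpha>(i := \<alpha> i - 1)) x)))) (at x)"
    unfolding hom_part_def[abs_def]
    by (intro has_derivative_sum has_derivative_mult_right monom_at_has_derivative)
  also have "(\<lambda>h. \<Sum>\<alpha> | sum \<alpha> UNIV = Suc k. c \<alpha> *
      (\<Sum>i\<in>UNIV. h $ i * (real (\<alpha> i) * monom_at (\<alpha>(i := \<alpha> i - 1)) x))) =
     (\<lambda>h. \<Sum>i\<in>UNIV. h $ i * hom_part (dcoeff i c) k x)"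
    unfolding eq[symmetric] sum_distrib_left
    by (subst sum.swap) (simp add: mult_ac)
  finally show ?thesis .
qed

lemma hom_part_0: "hom_part c 0 = (\<lambda>x. c (\<lambda>_. 0))"
proof -
  have "{\<alpha> :: 'a \<Rightarrow> nat. sum \<alpha> UNIV = 0} = {\<lambda>_. 0}"
    by auto
  then show ?thesis
    by (simp add: hom_part_def[abs_def] monom_at_def)
qed

text \<open>Both sides are the derivative at \<open>t = 1\<close> of
  \<open>hom_part c (Suc k) (t *\<^sub>R x)\<close>, computed once by the chain rule and once from
  the scaling law.\<close>

lemma hom_part_euler:
  "(\<Sum>i\<in>UNIV. x $ i * hom_part (dcoeff i c) k x) = real (Suc k) * hom_part c (Suc k) x"
proof -
  have "((\<lambda>t::real. hom_part c (Suc k) (t *\<^sub>R x)) has_derivative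
      (\<lambda>s. \<Sum>i\<in>UNIV. (s *\<^sub>R x) $ i * hom_part (dcoeff i c) k (1 *\<^sub>R x))) (at 1)"
    by (rule has_derivative_compose[of "\<lambda>t. t *\<^sub>R x" "\<lambda>s. s *\<^sub>R x", OF _ hom_part_has_derivative])
       (auto intro!: derivative_eq_intros)
  moreover have "((\<lambda>t::real. hom_part c (Suc k) (t *\<^sub>R x)) has_derivative
      (\<lambda>s. s * (real (Suc k) * hom_part c (Suc k) x))) (at 1)"
    using has_derivative_mult_right[OF DERIV_pow[of "Suc k" 1, unfolded has_field_derivative_def],
        of "hom_part c (Suc k) x"]
    by (simp add: hom_part_scale mult_ac)
  ultimately have "(\<lambda>s. \<Sum>i\<in>UNIV. (s *\<^sub>R x) $ i * hom_part (dcoeff i c) k (1 *\<^sub>R x)) =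
      (\<lambda>s. s * (real (Suc k) * hom_part c (Suc k) x))"
    by (rule has_derivative_unique)
  from fun_cong[OF this, of 1] show ?thesis
    by simp
qed

lemma abs_hom_part_le:
  "\<bar>hom_part c k x\<bar> \<le> (\<Sum>\<alpha> | sum \<alpha> UNIV = k. \<bar>c \<alpha>\<bar>) * norm x ^ k"
proof -
  have "\<bar>hom_part c k x\<bar> \<le> (\<Sum>\<alpha> | sum \<alpha> UNIV = k. \<bar>c \<alpha> * monom_at \<alpha> x\<bar>)"
    unfolding hom_part_def by (rule sum_abs)
  also have "\<dots> \<le> (\<Sum>\<alpha> | sum \<alpha> UNIV = k. \<bar>c \<alpha>\<bar> * norm x ^ k)"
    by (rule sum_mono) (use abs_monom_at_le[of _ x] in \<open>auto simp: abs_mult intro!: mult_left_mono\<close>)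
  finally show ?thesis
    by (simp add: sum_distrib_right)
qed

lemma continuous_on_hom_part: "continuous_on S (hom_part c k)"
proof (cases k)
  case 0
  then show ?thesis
    by (simp add: hom_part_0)
next
  case (Suc j)
  then show ?thesis
    using hom_part_has_derivative[of c j]
    by (auto intro!: continuous_at_imp_continuous_on has_derivative_continuous)
qed

section \<open>Absolutely summable coefficient families\<close>

text \<open>Absolute convergence at the point with all coordinates \<open>s\<close>. The condition
  refers to the coefficients alone, so it can be transferred to \<open>dcoeff i c\<close> before any
  function with that expansion is known.\<close>

definition summable_coeffs :: "(('n::finite \<Rightarrow> nat) \<Rightarrow> real) \<Rightarrow> real \<Rightarrow> bool" where
  "summable_coeffs c s \<longleftrightarrow> (\<lambda>\<alpha>. \<bar>c \<alpha>\<bar> * s ^ sum \<alpha> UNIV) summable_on UNIV"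

text \<open>For real terms unordered summability is absolute, so it suffices to evaluate at the
  point with all coordinates \<open>s\<close>, where each monomial equals
  \<open>s ^ sum \<alpha> UNIV\<close>. The norm of that point is at most
  \<open>CARD('n) * s\<close>, whence the divisor \<open>CARD('n) + 1\<close>.\<close>

lemma power_series_imp_summable_coeffs:
  assumes "power_series_at f 0 (c :: ('n::finite \<Rightarrow> nat) \<Rightarrow> real)"
  obtains s where "s > 0" "summable_coeffs c s"
    "\<And>x. norm x \<le> s \<Longrightarrow> ((\<lambda>\<alpha>. c \<alpha> * monom_at \<alpha> x) has_sum f x) UNIV"
proof -
  obtain r where r: "r > 0" "\<And>x. norm x < r \<Longrightarrow> ((\<lambda>\<alpha>. c \<alpha> * monom_at \<alpha> x) has_sum f x) UNIV"
    using assms by (auto simp: power_series_at_def)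
  define s where "s = r / (real CARD('n) + 1)"
  have s: "0 < s" "real CARD('n) * s < r" "s < r"
    using r(1) by (auto simp: s_def field_simps)
  have "norm (\<chi> i::'n. s) \<le> real CARD('n) * s"
    using norm_le_l1_cart[of "\<chi> i::'n. s"] s by simp
  with s have "(\<lambda>\<alpha>. c \<alpha> * monom_at \<alpha> (\<chi> i. s)) summable_on UNIV"
    by (intro has_sum_imp_summable[OF r(2)]) auto
  then have "(\<lambda>\<alpha>. \<bar>c \<alpha> * monom_at \<alpha> (\<chi> i. s)\<bar>) summable_on UNIV"
    using summable_on_iff_abs_summable_on_real[THEN iffD1] by fastforce
  moreover have "\<bar>c \<alpha> * monom_at \<alpha> (\<chi> i. s)\<bar> = \<bar>c \<alpha>\<bar> * s ^ sum \<alpha> UNIV" for \<alpha>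
    using s by (simp add: abs_mult monom_at_def power_sum abs_prod power_abs)
  ultimately have "summable_coeffs c s"
    by (simp add: summable_coeffs_def)
  with s r show thesis
    by (intro that[of s]) auto
qed

lemma summable_coeffs_imp_summable:
  assumes "summable_coeffs c s" "norm x \<le> s"
  shows "(\<lambda>\<alpha>. c \<alpha> * monom_at \<alpha> x) summable_on UNIV"
proof (rule Infinite_Sum.abs_summable_summable, rule Infinite_Sum.abs_summable_on_comparison_test')
  show "(\<lambda>\<alpha>. \<bar>c \<alpha>\<bar> * s ^ sum \<alpha> UNIV) summable_on UNIV"
    using assms by (simp add: summable_coeffs_def)
  fix \<alpha> :: "'a \<Rightarrow> nat"
  have "\<bar>monom_at \<alpha> x\<bar> \<le> s ^ sum \<alpha> UNIV"
    using abs_monom_at_le[of \<alpha> x] power_mono[OF assms(2), of "sum \<alpha> UNIV"] by auto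
  then show "norm (c \<alpha> * monom_at \<alpha> x) \<le> \<bar>c \<alpha>\<bar> * s ^ sum \<alpha> UNIV"
    by (auto simp: abs_mult intro!: mult_left_mono)
qed

text \<open>Halving the radius pays for the factor created by differentiation, because
  \<open>\<alpha> i + 1 \<le> 2 ^ sum \<alpha> UNIV\<close>. The shift of the multi-index is
  injective, so the shifted coefficients form a subfamily of the original ones.\<close>

lemma summable_coeffs_dcoeff:
  assumes s: "s > 0" and c: "summable_coeffs c s"
  shows "summable_coeffs (dcoeff i c) (s / 2)"
proof -
  have inj: "inj (\<lambda>\<alpha>::'a \<Rightarrow> nat. \<alpha>(i := \<alpha> i + 1))"
  proof (rule injI)
    fix \<alpha> \<beta> :: "'a \<Rightarrow> nat"
    assume eq: "\<alpha>(i := \<alpha> i + 1) = \<beta>(i := \<beta> i + 1)"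
    show "\<alpha> = \<beta>"
    proof
      fix j
      show "\<alpha> j = \<beta> j"
        using fun_cong[OF eq, of j] by (cases "j = i") auto
    qed
  qed
  have "(\<lambda>\<alpha>. \<bar>c \<alpha>\<bar> * s ^ sum \<alpha> UNIV) summable_on range (\<lambda>\<alpha>. \<alpha>(i := \<alpha> i + 1))"
    using c unfolding summable_coeffs_def by (rule summable_on_subset_banach) auto
  then have "((\<lambda>\<alpha>. \<bar>c \<alpha>\<bar> * s ^ sum \<alpha> UNIV) \<circ> (\<lambda>\<alpha>. \<alpha>(i := \<alpha> i + 1))) summable_on UNIV"
    by (rule summable_on_reindex[OF inj, THEN iffD1])
  then have "(\<lambda>\<alpha>. \<bar>c (\<alpha>(i := \<alpha> i + 1))\<bar> * s ^ Suc (sum \<alpha> UNIV)) summable_on UNIV"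
    unfolding o_def sum_fun_upd_Suc .
  then have sm: "(\<lambda>\<alpha>. (1 / s) * (\<bar>c (\<alpha>(i := \<alpha> i + 1))\<bar> * s ^ Suc (sum \<alpha> UNIV))) summable_on UNIV"
    by (rule summable_on_cmult_right)
  have "(\<lambda>\<alpha>. norm (\<bar>dcoeff i c \<alpha>\<bar> * (s / 2) ^ sum \<alpha> UNIV)) summable_on UNIV"
  proof (rule Infinite_Sum.abs_summable_on_comparison_test'[OF sm])
    fix \<alpha> :: "'a \<Rightarrow> nat"
    have "\<alpha> i + 1 \<le> sum \<alpha> UNIV + 1"
      by (simp add: member_le_sum)
    also have "\<dots> \<le> 2 ^ sum \<alpha> UNIV"
      by (simp add: Suc_leI)
    finally have "real (\<alpha> i + 1) \<le> 2 ^ sum \<alpha> UNIV"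
      by (metis of_nat_le_iff of_nat_numeral of_nat_power)
    then have "real (\<alpha> i + 1) / 2 ^ sum \<alpha> UNIV * (\<bar>c (\<alpha>(i := \<alpha> i + 1))\<bar> * s ^ sum \<alpha> UNIV)
       \<le> 1 * (\<bar>c (\<alpha>(i := \<alpha> i + 1))\<bar> * s ^ sum \<alpha> UNIV)"
      using s by (intro mult_right_mono) auto
    then show "norm (\<bar>dcoeff i c \<alpha>\<bar> * (s / 2) ^ sum \<alpha> UNIV)
       \<le> (1 / s) * (\<bar>c (\<alpha>(i := \<alpha> i + 1))\<bar> * s ^ Suc (sum \<alpha> UNIV))"
      using s by (simp add: dcoeff_def abs_mult power_divide mult_ac)
  qed
  then show ?thesis
    unfolding summable_coeffs_def by (rule Infinite_Sum.abs_summable_summable)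
qed

text \<open>This is an instance of \<open>hom_part_sums\<close>: the powers of \<open>s\<close> are
  moved into the coefficients and the monomials are evaluated at the point with all coordinates
  1.\<close>

lemma summable_coeffs_by_degree:
  assumes "summable_coeffs c s"
  shows "summable (\<lambda>k. (\<Sum>\<alpha> | sum \<alpha> UNIV = k. \<bar>c \<alpha>\<bar>) * s ^ k)"
proof -
  have "((\<lambda>\<alpha>. (\<bar>c \<alpha>\<bar> * s ^ sum \<alpha> UNIV) * monom_at \<alpha> (\<chi> i. 1)) has_sum
      (\<Sum>\<^sub>\<infinity>\<alpha>. \<bar>c \<alpha>\<bar> * s ^ sum \<alpha> UNIV)) UNIV"
    using assms by (simp add: summable_coeffs_def monom_at_def)
  from hom_part_sums[OF this]
  have "summable (\<lambda>k. hom_part (\<lambda>\<alpha>. \<bar>c \<alpha>\<bar> * s ^ sum \<alpha> UNIV) k (\<chi> i. 1))"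
    by (simp add: sums_iff)
  moreover have "hom_part (\<lambda>\<alpha>. \<bar>c \<alpha>\<bar> * s ^ sum \<alpha> UNIV) k (\<chi> i. 1) =
      (\<Sum>\<alpha> | sum \<alpha> UNIV = k. \<bar>c \<alpha>\<bar>) * s ^ k" for k
    by (simp add: hom_part_def monom_at_def sum_distrib_right)
  ultimately show ?thesis
    by simp
qed

text \<open>From degree \<open>N\<close> on, every term gains the factor
  \<open>(norm x / s) ^ N\<close> over its majorant at radius \<open>s\<close>. The constant is
  therefore the majorant series at radius \<open>s\<close> divided by \<open>s ^ N\<close>.\<close>

lemma power_series_bound:
  fixes c :: "('n::finite \<Rightarrow> nat) \<Rightarrow> real"
  assumes f: "power_series_at f 0 c" and zero: "\<And>k x. k < N \<Longrightarrow> hom_part c k x = 0"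
  obtains C where "C \<ge> 0" "\<forall>\<^sub>F x in nhds 0. \<bar>f x\<bar> \<le> C * norm x ^ N"
proof -
  obtain s where s: "s > 0" "summable_coeffs c s"
    "\<And>x. norm x \<le> s \<Longrightarrow> ((\<lambda>\<alpha>. c \<alpha> * monom_at \<alpha> x) has_sum f x) UNIV"
    using power_series_imp_summable_coeffs[OF f] by blast
  define H where "H k = (\<Sum>\<alpha> | sum \<alpha> UNIV = k. \<bar>c \<alpha>\<bar>)" for k
  have sm: "summable (\<lambda>k. H k * s ^ k)"
    using summable_coeffs_by_degree[OF s(2)] by (simp add: H_def)
  have H0: "H k \<ge> 0" for k
    by (simp add: H_def sum_nonneg)
  have bound: "\<bar>f x\<bar> \<le> (\<Sum>k. H k * s ^ k) / s ^ N * norm x ^ N" if x: "norm x \<le> s" for x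
  proof -
    have *: "norm (hom_part c k x) \<le> H k * s ^ k * (norm x / s) ^ N" for k
    proof (cases "k < N")
      case True
      then show ?thesis
        using zero H0[of k] s by auto
    next
      case False
      have "norm (hom_part c k x) \<le> H k * norm x ^ k"
        using abs_hom_part_le by (auto simp: H_def)
      also have "norm x ^ k = s ^ k * (norm x / s) ^ k"
        using s by (simp add: power_divide)
      also have "H k * (s ^ k * (norm x / s) ^ k) \<le> H k * (s ^ k * (norm x / s) ^ N)"
        using x s False H0 by (intro mult_left_mono power_decreasing) auto
      finally show ?thesis
        by (simp add: mult.assoc)
    qed
    have sm2: "summable (\<lambda>k. H k * s ^ k * (norm x / s) ^ N)"
      by (rule summable_mult2[OF sm])
    have "(\<lambda>k. hom_part c k x) sums f x"
      by (rule hom_part_sums[OF s(3)[OF x]])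
    then have "\<bar>f x\<bar> = norm (\<Sum>k. hom_part c k x)"
      by (simp add: sums_iff)
    also have "\<dots> \<le> (\<Sum>k. H k * s ^ k * (norm x / s) ^ N)"
      by (rule norm_suminf_le[OF * sm2])
    also have "\<dots> = (\<Sum>k. H k * s ^ k) / s ^ N * norm x ^ N"
      using suminf_mult2[OF sm, of "(norm x / s) ^ N"] by (simp add: power_divide)
    finally show ?thesis .
  qed
  show thesis
  proof (rule that)
    show "(\<Sum>k. H k * s ^ k) / s ^ N \<ge> 0"
      using H0 s by (intro divide_nonneg_nonneg suminf_nonneg sm) auto
    show "\<forall>\<^sub>F x in nhds 0. \<bar>f x\<bar> \<le> (\<Sum>k. H k * s ^ k) / s ^ N * norm x ^ N"
      unfolding eventually_nhds_metric using s(1) bound by (intro exI[of _ s]) auto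
  qed
qed

section \<open>Termwise differentiation of power series\<close>

lemma partial_eq:
  assumes "(f has_derivative (\<lambda>h. \<Sum>i\<in>UNIV. h $ i * F i)) (at x)"
  shows "partial i f x = F i"
proof -
  have "partial i f x = (\<Sum>j\<in>UNIV. axis i 1 $ j * F j)"
    unfolding partial_def frechet_derivative_at[OF assms, symmetric] ..
  also have "\<dots> = (\<Sum>j\<in>UNIV. if j = i then F j else 0)"
    by (intro sum.cong) (auto simp: axis_def)
  finally show ?thesis
    by simp
qed

text \<open>The gradients of the homogeneous parts have a summable majorant on the ball of radius
  \<open>s / 2\<close>, so the Weierstrass test gives the uniform convergence that termwise
  differentiation requires. Since the partial derivatives are again power series, the result can be
  iterated.\<close>

lemma power_series_differentiable:
  assumes f: "power_series_at f 0 c"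
  obtains s where "s > 0"
    "\<And>x. norm x < s \<Longrightarrow> (f has_derivative (\<lambda>h. \<Sum>i\<in>UNIV. h $ i * partial i f x)) (at x)"
    "\<And>i. power_series_at (partial i f) 0 (dcoeff i c)"
proof -
  obtain s where s: "s > 0" "summable_coeffs c s"
    "\<And>x. norm x \<le> s \<Longrightarrow> ((\<lambda>\<alpha>. c \<alpha> * monom_at \<alpha> x) has_sum f x) UNIV"
    using power_series_imp_summable_coeffs[OF f] by blast
  define B where "B = ball (0 :: real ^ 'a) (s / 2)"
  \<comment> \<open>The gradient of the part of degree \<open>n\<close> has degree
    \<open>n - 1\<close>, and the constant part contributes 0.\<close>
  define D where "D n x = (\<chi> i. case n of 0 \<Rightarrow> 0 | Suc k \<Rightarrow> hom_part (dcoeff i c) k x)" for n and x :: "real ^ 'a"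
  define M where "M n = (\<Sum>i\<in>UNIV. case n of 0 \<Rightarrow> 0 | Suc k \<Rightarrow>
     (\<Sum>\<alpha> | sum \<alpha> UNIV = k. \<bar>dcoeff i c \<alpha>\<bar>) * (s / 2) ^ k)" for n
  have dc: "summable_coeffs (dcoeff i c) (s / 2)" for i
    by (rule summable_coeffs_dcoeff[OF s(1,2)])
  have "summable M"
    unfolding M_def
  proof (rule summable_sum)
    fix i :: 'a
    show "summable (\<lambda>n. case n of 0 \<Rightarrow> 0 | Suc k \<Rightarrow>
     (\<Sum>\<alpha> | sum \<alpha> UNIV = k. \<bar>dcoeff i c \<alpha>\<bar>) * (s / 2) ^ k)"
      by (subst summable_Suc_iff[symmetric]) (use summable_coeffs_by_degree[OF dc] in simp)
  qed
  moreover have DM: "norm (D n x) \<le> M n" if "x \<in> B" for n x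
  proof -
    have "norm (D n x) \<le> (\<Sum>i\<in>UNIV. \<bar>D n x $ i\<bar>)"
      by (rule norm_le_l1_cart)
    also have "\<dots> \<le> M n"
      unfolding M_def
    proof (rule sum_mono)
      fix i :: 'a
      show "\<bar>D n x $ i\<bar> \<le> (case n of 0 \<Rightarrow> 0 | Suc k \<Rightarrow>
     (\<Sum>\<alpha> | sum \<alpha> UNIV = k. \<bar>dcoeff i c \<alpha>\<bar>) * (s / 2) ^ k)"
      proof (cases n)
        case (Suc k)
        have "\<bar>hom_part (dcoeff i c) k x\<bar> \<le> (\<Sum>\<alpha> | sum \<alpha> UNIV = k. \<bar>dcoeff i c \<alpha>\<bar>) * norm x ^ k"
          by (rule abs_hom_part_le)
        also have "\<dots> \<le> (\<Sum>\<alpha> | sum \<alpha> UNIV = k. \<bar>dcoeff i c \<alpha>\<bar>) * (s / 2) ^ k"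
          using that by (intro mult_left_mono power_mono) (auto simp: B_def sum_nonneg)
        finally show ?thesis
          using Suc by (simp add: D_def)
      qed (simp add: D_def)
    qed
    finally show ?thesis .
  qed
  ultimately have unif: "uniform_limit B (\<lambda>n x. \<Sum>j<n. D j x) (\<lambda>x. \<Sum>j. D j x) sequentially"
    by (intro Weierstrass_m_test) auto
  have sumD: "summable (\<lambda>n. D n x)" if "x \<in> B" for x
    using DM[OF that] \<open>summable M\<close> by (rule summable_comparison_test'[rotated])
  have "\<exists>F. \<forall>x\<in>B. (\<lambda>n. hom_part c n x) sums F x \<and>
      (F has_derivative (\<lambda>h. h \<bullet> (\<Sum>j. D j x))) (at x within B)"
  proof (rule has_derivative_series)
    show "convex B"
      by (simp add: B_def)
    show "0 \<in> B" "(\<lambda>n. hom_part c n 0) sums f 0"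
      using s hom_part_sums[OF s(3)] by (auto simp: B_def)
    show "(hom_part c n has_derivative (\<lambda>h. h \<bullet> D n x)) (at x within B)" for n x
    proof (cases n)
      case 0
      then show ?thesis
        by (simp add: D_def inner_vec_def hom_part_0)
    next
      case (Suc k)
      then show ?thesis
        using hom_part_has_derivative[of c k x]
        by (auto simp: D_def inner_vec_def intro: has_derivative_at_withinI)
    qed
    fix e :: real assume "e > 0"
    with unif have "\<forall>\<^sub>F n in sequentially. \<forall>x\<in>B. dist (\<Sum>j<n. D j x) (\<Sum>j. D j x) < e"
      by (auto simp: uniform_limit_iff)
    then show "\<forall>\<^sub>F n in sequentially. \<forall>x\<in>B. \<forall>h. norm ((\<Sum>i<n. h \<bullet> D i x) - h \<bullet> (\<Sum>j. D j x)) \<le> e * norm h"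
    proof (rule eventually_mono, intro ballI allI)
      fix n x and h :: "real ^ 'a"
      assume *: "\<forall>x\<in>B. dist (\<Sum>j<n. D j x) (\<Sum>j. D j x) < e" and x: "x \<in> B"
      have "norm ((\<Sum>i<n. h \<bullet> D i x) - h \<bullet> (\<Sum>j. D j x)) = norm (h \<bullet> ((\<Sum>i<n. D i x) - (\<Sum>j. D j x)))"
        by (simp add: inner_diff_right inner_sum_right)
      also have "\<dots> \<le> norm h * norm ((\<Sum>i<n. D i x) - (\<Sum>j. D j x))"
        using Cauchy_Schwarz_ineq2 by auto
      also have "\<dots> \<le> norm h * e"
        using * x by (intro mult_left_mono) (auto simp: dist_norm less_imp_le)
      finally show "norm ((\<Sum>i<n. h \<bullet> D i x) - h \<bullet> (\<Sum>j. D j x)) \<le> e * norm h"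
        by (simp add: mult.commute)
    qed
  qed
  then obtain F where F: "\<And>x. x \<in> B \<Longrightarrow> (\<lambda>n. hom_part c n x) sums F x"
    "\<And>x. x \<in> B \<Longrightarrow> (F has_derivative (\<lambda>h. h \<bullet> (\<Sum>j. D j x))) (at x within B)"
    by blast
  \<comment> \<open>Termwise differentiation produces its own limit function \<open>F\<close>;
    uniqueness of sums identifies it with \<open>f\<close> on the ball.\<close>
  have Ff: "F x = f x" if "x \<in> B" for x
    using sums_unique2[OF F(1)[OF that] hom_part_sums[OF s(3)]] that s(1) by (auto simp: B_def)
  have der: "(f has_derivative (\<lambda>h. \<Sum>i\<in>UNIV. h $ i * (\<Sum>j. D j x) $ i)) (at x)" if "x \<in> B" for x
  proof -
    have "(f has_derivative (\<lambda>h. h \<bullet> (\<Sum>j. D j x))) (at x within B)"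
      using Ff that by (intro has_derivative_transform[OF that _ F(2)[OF that]]) auto
    then show ?thesis
      using that at_within_open[of x B] by (simp add: B_def inner_vec_def)
  qed
  have par: "partial i f x = (\<Sum>j. D j x) $ i" if "x \<in> B" for i x
    by (rule partial_eq[OF der[OF that]])
  show thesis
  proof (rule that)
    show "s / 2 > 0"
      using s by simp
    show "(f has_derivative (\<lambda>h. \<Sum>i\<in>UNIV. h $ i * partial i f x)) (at x)" if "norm x < s / 2" for x
      using der[of x] par[of x] that by (simp add: B_def)
    fix i
    show "power_series_at (partial i f) 0 (dcoeff i c)"
      unfolding power_series_at_def
    proof (intro exI[of _ "s / 2"] conjI ballI)
      fix x :: "real ^ 'a" assume x: "x \<in> ball 0 (s / 2)"
      then have xB: "x \<in> B"
        by (simp add: B_def)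
      have hs: "((\<lambda>\<alpha>. dcoeff i c \<alpha> * monom_at \<alpha> x) has_sum (\<Sum>\<^sub>\<infinity>\<alpha>. dcoeff i c \<alpha> * monom_at \<alpha> x)) UNIV"
        using x by (intro has_sum_infsum summable_coeffs_imp_summable[OF dc]) auto
      have "(\<lambda>k. D k x $ i) sums (\<Sum>\<^sub>\<infinity>\<alpha>. dcoeff i c \<alpha> * monom_at \<alpha> x)"
        using hom_part_sums[OF hs] sums_Suc_iff[of "\<lambda>k. D k x $ i"] by (simp add: D_def)
      moreover have "(\<lambda>k. D k x $ i) sums ((\<Sum>j. D j x) $ i)"
        by (rule bounded_linear.sums[OF bounded_linear_vec_nth summable_sums[OF sumD[OF xB]]])
      ultimately have "(\<Sum>\<^sub>\<infinity>\<alpha>. dcoeff i c \<alpha> * monom_at \<alpha> x) = partial i f x"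
        using par[OF xB] sums_unique2 by metis
      with hs show "((\<lambda>\<alpha>. dcoeff i c \<alpha> * monom_at \<alpha> (x - 0)) has_sum partial i f x) UNIV"
        by simp
    qed (use s in simp)
  qed
qed

lemma partial_hom_part: "partial i (hom_part c (Suc k)) x = hom_part (dcoeff i c) k x"
  by (rule partial_eq[OF hom_part_has_derivative])

text \<open>The assumption is about the polynomial function and not about its coefficients, so the
  claim is read off as a partial derivative of the zero function.\<close>

lemma hom_part_dcoeff_zero:
  assumes "\<And>x. hom_part c (Suc k) x = 0"
  shows "hom_part (dcoeff i c) k x = 0"
proof -
  have "hom_part c (Suc k) = (\<lambda>_. 0)"
    using assms by auto
  then have "hom_part (dcoeff i c) k x = partial i (\<lambda>_. 0) x"
    using partial_hom_part[of i c k x] by simp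
  also have "\<dots> = 0"
    by (rule partial_eq) simp
  finally show ?thesis .
qed

section \<open>Remainders and bounds near the origin\<close>

lemma hom_part_diff: "hom_part (\<lambda>\<alpha>. c \<alpha> - c' \<alpha>) k x = hom_part c k x - hom_part c' k x"
  by (simp add: hom_part_def left_diff_distrib sum_subtractf)

lemma hom_part_restrict:
  "hom_part (\<lambda>\<alpha>. if sum \<alpha> UNIV = k then c \<alpha> else 0) j x = (if j = k then hom_part c k x else 0)"
  by (auto simp: hom_part_def intro!: sum.neutral)

lemma power_series_at_diff:
  assumes "power_series_at f 0 c" "power_series_at h 0 c'"
  shows "power_series_at (\<lambda>x. f x - h x) 0 (\<lambda>\<alpha>. c \<alpha> - c' \<alpha>)"
proof -
  obtain r where r: "r > 0" "\<And>x. x \<in> ball 0 r \<Longrightarrow> ((\<lambda>\<alpha>. c \<alpha> * monom_at \<alpha> (x - 0)) has_sum f x) UNIV"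
    using assms(1) unfolding power_series_at_def by blast
  obtain r' where r': "r' > 0" "\<And>x. x \<in> ball 0 r' \<Longrightarrow> ((\<lambda>\<alpha>. c' \<alpha> * monom_at \<alpha> (x - 0)) has_sum h x) UNIV"
    using assms(2) unfolding power_series_at_def by blast
  show ?thesis
    unfolding power_series_at_def
  proof (intro exI[of _ "min r r'"] conjI ballI)
    fix x :: "real ^ 'a" assume "x \<in> ball 0 (min r r')"
    then have "((\<lambda>\<alpha>. c \<alpha> * monom_at \<alpha> (x - 0) + - (c' \<alpha> * monom_at \<alpha> (x - 0))) has_sum (f x + - h x)) UNIV"
      by (intro has_sum_add has_sum_uminusI r(2) r'(2)) auto
    then show "((\<lambda>\<alpha>. (c \<alpha> - c' \<alpha>) * monom_at \<alpha> (x - 0)) has_sum (f x - h x)) UNIV"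
      by (simp add: left_diff_distrib)
  qed (use r(1) r'(1) in auto)
qed

lemma power_series_at_hom_part:
  "power_series_at (hom_part c k) 0 (\<lambda>\<alpha>. if sum \<alpha> UNIV = k then c \<alpha> else 0)"
  unfolding power_series_at_def
proof (intro exI[of _ 1] conjI ballI)
  fix x :: "real ^ 'a"
  have "((\<lambda>\<alpha>. c \<alpha> * monom_at \<alpha> x) has_sum hom_part c k x) {\<alpha>. sum \<alpha> UNIV = k}"
    unfolding hom_part_def by (intro has_sum_finite finite_multi_index)
  then show "((\<lambda>\<alpha>. (if sum \<alpha> UNIV = k then c \<alpha> else 0) * monom_at \<alpha> (x - 0)) has_sum hom_part c k x) UNIV"
    by (rule has_sum_cong_neutral[THEN iffD1, rotated -1]) auto
qed auto

text \<open>Finitely many functions share the sum of their constants. Product types as index type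
  \<open>'i\<close> later cover all components of the metric, of \<sigma> and of their derivatives
  at once.\<close>

lemma power_series_family_bound:
  fixes c :: "'i::finite \<Rightarrow> ('n::finite \<Rightarrow> nat) \<Rightarrow> real"
  assumes f: "\<And>i. power_series_at (f i) 0 (c i)"
    and zero: "\<And>i k x. k < N \<Longrightarrow> hom_part (c i) k x = 0"
  obtains C where "C \<ge> 0" "\<forall>\<^sub>F x in nhds 0. \<forall>i. \<bar>f i x\<bar> \<le> C * norm x ^ N"
proof -
  have "\<exists>C\<ge>0. \<forall>\<^sub>F x in nhds 0. \<bar>f i x\<bar> \<le> C * norm x ^ N" for i
    using power_series_bound[OF f zero] by metis
  then obtain C where C: "\<And>i. C i \<ge> 0" "\<And>i. \<forall>\<^sub>F x in nhds 0. \<bar>f i x\<bar> \<le> C i * norm x ^ N"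
    by metis
  have "\<forall>\<^sub>F x in nhds 0. \<forall>i. \<bar>f i x\<bar> \<le> C i * norm x ^ N"
    using C(2) by (intro eventually_all_finite) auto
  then have "\<forall>\<^sub>F x in nhds 0. \<forall>i. \<bar>f i x\<bar> \<le> (\<Sum>i\<in>UNIV. C i) * norm x ^ N"
  proof (rule eventually_mono, intro allI)
    fix x i assume "\<forall>i. \<bar>f i x\<bar> \<le> C i * norm x ^ N"
    then have "\<bar>f i x\<bar> \<le> C i * norm x ^ N"
      by blast
    also have "\<dots> \<le> (\<Sum>i\<in>UNIV. C i) * norm x ^ N"
      using C(1) by (intro mult_right_mono member_le_sum) auto
    finally show "\<bar>f i x\<bar> \<le> (\<Sum>i\<in>UNIV. C i) * norm x ^ N" .
  qed
  then show thesis
    using that[of "\<Sum>i\<in>UNIV. C i"] C(1) by (simp add: sum_nonneg)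
qed

text \<open>Local statements become statements about all sufficiently small radii, so that finitely
  many of them can be combined and a single radius chosen at the end.\<close>

lemma eventually_small_cball:
  assumes "\<forall>\<^sub>F x in nhds (0::'a::real_normed_vector). P x"
  shows "\<forall>\<^sub>F \<rho> in at_right 0. \<forall>x\<in>cball 0 \<rho>. P x"
proof -
  obtain d where "d > 0" "\<And>x. norm x < d \<Longrightarrow> P x"
    using assms by (auto simp: eventually_nhds_metric)
  then show ?thesis
    by (auto simp: eventually_at_right intro!: exI[of _ d])
qed

lemma power_series_eventually_differentiable:
  assumes "power_series_at f 0 c"
  shows "\<forall>\<^sub>F x in nhds 0. (f has_derivative (\<lambda>h. \<Sum>i\<in>UNIV. h $ i * partial i f x)) (at x)"
proof -
  obtain s where s: "s > 0"
    "\<And>x. norm x < s \<Longrightarrow> (f has_derivative (\<lambda>h. \<Sum>i\<in>UNIV. h $ i * partial i f x)) (at x)"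
    "\<And>i. power_series_at (partial i f) 0 (dcoeff i c)"
    using power_series_differentiable[OF assms] by blast
  show ?thesis
    unfolding eventually_nhds_metric
  proof (intro exI[of _ s] conjI allI impI)
    fix x :: "real ^ 'a" assume "dist x 0 < s"
    then show "(f has_derivative (\<lambda>h. \<Sum>i\<in>UNIV. h $ i * partial i f x)) (at x)"
      by (intro s(2)) simp
  qed (rule s(1))
qed

lemma power_series_partial:
  assumes "power_series_at f 0 c"
  shows "power_series_at (partial i f) 0 (dcoeff i c)"
proof -
  obtain s where s: "s > 0"
    "\<And>x. norm x < s \<Longrightarrow> (f has_derivative (\<lambda>h. \<Sum>i\<in>UNIV. h $ i * partial i f x)) (at x)"
    "\<And>i. power_series_at (partial i f) 0 (dcoeff i c)"
    using power_series_differentiable[OF assms] by blast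
  show ?thesis
    by (rule s(3))
qed

section \<open>Degrees of the non-zero homogeneous terms\<close>

lemma nonzero_term_iff:
  "power_series_at f 0 c \<Longrightarrow> nonzero_term f k \<longleftrightarrow> (\<exists>x. hom_part c k x \<noteq> 0)"
  by (simp add: nonzero_term_def hom_term_eq)

text \<open>A series with one non-zero homogeneous term reduces to that term. This is the link to
  the hypothesis that \<open>U\<close> is not a homogeneous polynomial.\<close>

lemma eventually_eq_hom_part:
  assumes f: "power_series_at f 0 c" and zero: "\<And>k x. k \<noteq> j \<Longrightarrow> hom_part c k x = 0"
  shows "\<forall>\<^sub>F x in nhds 0. f x = hom_part c j x"
proof -
  obtain s where s: "s > 0" "summable_coeffs c s"
    "\<And>x. norm x \<le> s \<Longrightarrow> ((\<lambda>\<alpha>. c \<alpha> * monom_at \<alpha> x) has_sum f x) UNIV"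
    using power_series_imp_summable_coeffs[OF f] by blast
  show ?thesis
    unfolding eventually_nhds_metric
  proof (intro exI[of _ s] conjI allI impI)
    fix x :: "real ^ 'a" assume "dist x 0 < s"
    then have "(\<lambda>k. hom_part c k x) sums f x"
      by (intro hom_part_sums s(3)) simp
    moreover have "(\<lambda>k. hom_part c k x) sums hom_part c j x"
      using sums_finite[of "{j}" "\<lambda>k. hom_part c k x"] zero by simp
    ultimately show "f x = hom_part c j x"
      by (rule sums_unique2)
  qed (rule s(1))
qed

text \<open>Since the germ is not homogeneous, for every \<open>j\<close> some degree other than
  \<open>j\<close> carries a non-zero term. This makes the first \<open>LEAST\<close> well defined,
  and with \<open>j = first_degree f\<close> also the second, because nothing non-zero lies below
  the first degree.\<close>

lemma first_second_degree:
  assumes f: "power_series_at f 0 c"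
    and nonhom: "\<not> (\<exists>P. homogeneous_polynomial P \<and> (\<forall>\<^sub>F x in nhds 0. f x = P x))"
  shows "first_degree f < second_degree f"
    and "\<And>j x. j < first_degree f \<Longrightarrow> hom_part c j x = 0"
    and "\<And>j x. first_degree f < j \<Longrightarrow> j < second_degree f \<Longrightarrow> hom_part c j x = 0"
    and "\<exists>x. hom_part c (first_degree f) x \<noteq> 0"
proof -
  note iff = nonzero_term_iff[OF f]
  have other: "\<exists>k. k \<noteq> j \<and> nonzero_term f k" for j
  proof (rule ccontr)
    assume "\<nexists>k. k \<noteq> j \<and> nonzero_term f k"
    then have "\<forall>\<^sub>F x in nhds 0. f x = hom_part c j x"
      using iff by (intro eventually_eq_hom_part[OF f]) auto
    moreover have "homogeneous_polynomial (hom_part c j)"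
      unfolding homogeneous_polynomial_def by blast
    ultimately show False
      using nonhom by blast
  qed
  have 1: "nonzero_term f (first_degree f)"
    unfolding first_degree_def using other by (metis LeastI)
  have below: "\<not> nonzero_term f j" if "j < first_degree f" for j
    using not_less_Least that unfolding first_degree_def by blast
  obtain k where "k \<noteq> first_degree f" "nonzero_term f k"
    using other by blast
  then have "first_degree f < k \<and> nonzero_term f k"
    using below by (metis linorder_neqE_nat)
  then have "first_degree f < second_degree f \<and> nonzero_term f (second_degree f)"
    unfolding second_degree_def by (rule LeastI)
  then show "first_degree f < second_degree f"
    by blast
  show "\<And>j x. j < first_degree f \<Longrightarrow> hom_part c j x = 0"
    using below iff by blast
  show "\<And>j x. first_degree f < j \<Longrightarrow> j < second_degree f \<Longrightarrow> hom_part c j x = 0"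
    using not_less_Least iff unfolding second_degree_def by blast
  show "\<exists>x. hom_part c (first_degree f) x \<noteq> 0"
    using 1 iff by blast
qed

lemma hom_part_0_eq_value:
  assumes f: "power_series_at f 0 c"
  shows "hom_part c 0 x = f 0"
proof -
  obtain s where s: "s > 0" "summable_coeffs c s"
    "\<And>x. norm x \<le> s \<Longrightarrow> ((\<lambda>\<alpha>. c \<alpha> * monom_at \<alpha> x) has_sum f x) UNIV"
    using power_series_imp_summable_coeffs[OF f] by blast
  have "(\<lambda>k. hom_part c k 0) sums f 0"
    using s by (intro hom_part_sums) auto
  moreover have "hom_part c k 0 = 0" if "k \<noteq> 0" for k
    using hom_part_scale[of c k 0 0] that by (simp add: power_0_left)
  then have "(\<lambda>k. hom_part c k 0) sums hom_part c 0 0"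
    using sums_finite[of "{0}" "\<lambda>k. hom_part c k 0"] by simp
  ultimately have "f 0 = hom_part c 0 0"
    by (rule sums_unique2)
  then show ?thesis
    by (simp add: hom_part_0)
qed

text \<open>Euler's identity recovers the linear part from its coefficients, which are the partial
  derivatives at 0. The lemma yields \<open>l1 \<ge> 2\<close>.\<close>

lemma critical_zero_hom_part_low:
  assumes f: "power_series_at f 0 c" and f0: "f 0 = 0" "(f has_derivative (\<lambda>_. 0)) (at 0)" and k: "k < 2"
  shows "hom_part c k x = 0"
proof (cases "k = 0")
  case True
  then show ?thesis
    using hom_part_0_eq_value[OF f] f0(1) by simp
next
  case False
  then have "k = Suc 0"
    using k by simp
  moreover have "hom_part (dcoeff i c) 0 x = 0" for i
  proof -
    have "hom_part (dcoeff i c) 0 x = partial i f 0"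
      by (rule hom_part_0_eq_value[OF power_series_partial[OF f]])
    also have "\<dots> = 0"
      by (rule partial_eq) (use f0(2) in simp)
    finally show ?thesis .
  qed
  ultimately show ?thesis
    using hom_part_euler[of x c 0] by simp
qed

lemma power_series_tendsto:
  assumes "power_series_at f 0 c"
  shows "(f \<longlongrightarrow> f 0) (nhds 0)"
proof -
  have "(f has_derivative (\<lambda>h. \<Sum>i\<in>UNIV. h $ i * partial i f 0)) (at 0)"
    using eventually_nhds_x_imp_x[OF power_series_eventually_differentiable[OF assms]] .
  from has_derivative_continuous[OF this] show ?thesis
    by (simp add: continuous_at tendsto_at_iff_tendsto_nhds)
qed

section \<open>The radial inequality\<close>

text \<open>The set where \<open>h \<le> 0\<close> is compact and \<open>f\<close> has a positive
  minimum on it, so a large multiple of \<open>f\<close> outweighs the minimum of \<open>h\<close>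
  there. Elsewhere \<open>h\<close> is already positive. A second minimum over \<open>S\<close>
  turns positivity into the uniform bound \<open>b\<close>.\<close>

lemma compact_positive_combination:
  fixes f h :: "'a::t2_space \<Rightarrow> real"
  assumes S: "compact S" and f: "continuous_on S f" "\<And>q. q \<in> S \<Longrightarrow> f q \<ge> 0"
    and h: "continuous_on S h" and pos: "\<And>q. q \<in> S \<Longrightarrow> f q = 0 \<Longrightarrow> h q > 0"
  obtains A b where "A \<ge> 0" "b > 0" "\<And>q. q \<in> S \<Longrightarrow> A * f q + h q \<ge> b"
proof -
  have "\<exists>A\<ge>0. \<forall>q\<in>S. A * f q + h q > 0"
  proof (cases "{q \<in> S. h q \<le> 0} = {}")
    case True
    then show ?thesis
      by (intro exI[of _ 0]) force
  next
    case False
    have comp: "compact {q \<in> S. h q \<le> 0}"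
    proof -
      have "closed (S \<inter> h -` {..0})"
        by (intro continuous_closed_preimage[OF h] compact_imp_closed[OF S]) auto
      moreover have "{q \<in> S. h q \<le> 0} = S \<inter> (S \<inter> h -` {..0})"
        by auto
      ultimately show ?thesis
        using compact_Int_closed[OF S] by metis
    qed
    obtain q0 where q0: "q0 \<in> S" "h q0 \<le> 0" "\<And>q. q \<in> S \<Longrightarrow> h q \<le> 0 \<Longrightarrow> f q0 \<le> f q"
      using continuous_attains_inf[OF comp False continuous_on_subset[OF f(1)]] by auto
    obtain q1 where q1: "q1 \<in> S" "\<And>q. q \<in> S \<Longrightarrow> h q1 \<le> h q"
      using continuous_attains_inf[OF S _ h] q0(1) by auto
    have f0: "f q0 > 0"
      using f(2)[OF q0(1)] pos[OF q0(1)] q0(2) by force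
    define A where "A = (\<bar>h q1\<bar> + 1) / f q0"
    have "A \<ge> 0"
      using f0 by (simp add: A_def)
    moreover have "A * f q + h q > 0" if q: "q \<in> S" for q
    proof (cases "h q \<le> 0")
      case True
      have "\<bar>h q1\<bar> + 1 = A * f q0"
        using f0 by (simp add: A_def)
      also have "\<dots> \<le> A * f q"
        using q0(3)[OF q True] \<open>A \<ge> 0\<close> by (intro mult_left_mono)
      finally show ?thesis
        using q1(2)[OF q] by linarith
    next
      case False
      then show ?thesis
        using \<open>A \<ge> 0\<close> f(2)[OF q] by (intro add_nonneg_pos) auto
    qed
    ultimately show ?thesis by blast
  qed
  then obtain A where A: "A \<ge> 0" "\<And>q. q \<in> S \<Longrightarrow> A * f q + h q > 0"
    by blast
  show thesis
  proof (cases "S = {}")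
    case True
    then show ?thesis using that[of 0 1] by auto
  next
    case False
    have "continuous_on S (\<lambda>q. A * f q + h q)"
      by (intro continuous_intros f h)
    from continuous_attains_inf[OF S False this] obtain q where "q \<in> S" "\<And>y. y \<in> S \<Longrightarrow> A * f q + h q \<le> A * f y + h y"
      by auto
    then show ?thesis
      using that[of A "A * f q + h q"] A by auto
  qed
qed

text \<open>For \<open>a = l1 - 2\<close> this is the \<open>i\<close>-th component of \<open>|x|^(k - l1 + 2) grad U_l1\<close>: the weight makes it
  homogeneous of degree \<open>k + 1\<close>, so that its product with \<open>grad U\<close> has the order \<open>l1 + k\<close> of the criterion.
  The exponent may be negative, and the value at 0 is the junk value 0.\<close>

definition weighted_grad :: "(('n::finite \<Rightarrow> nat) \<Rightarrow> real) \<Rightarrow> nat \<Rightarrow> nat \<Rightarrow> 'n \<Rightarrow> real ^ 'n \<Rightarrow> real" where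
  "weighted_grad c a k i x = norm x powr (real k - real a) * hom_part (dcoeff i c) (Suc a) x"

lemma powr_diff_mult_power:
  assumes "(r::real) > 0"
  shows "r powr (real k - real a) * r ^ (a + j) = r ^ (k + j)"
  using assms by (simp add: powr_realpow[symmetric] powr_add[symmetric])

lemma hom_part_family_bound:
  fixes c :: "'i::finite \<Rightarrow> ('n::finite \<Rightarrow> nat) \<Rightarrow> real"
  obtains C where "C \<ge> 0" "\<And>i x. \<bar>hom_part (c i) k x\<bar> \<le> C * norm x ^ k"
proof -
  define H where "H i = (\<Sum>\<alpha> | sum \<alpha> UNIV = k. \<bar>c i \<alpha>\<bar>)" for i
  have H: "H i \<ge> 0" for i
    by (simp add: H_def sum_nonneg)
  have "\<bar>hom_part (c i) k x\<bar> \<le> (\<Sum>i\<in>UNIV. H i) * norm x ^ k" for i x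
  proof -
    have "\<bar>hom_part (c i) k x\<bar> \<le> H i * norm x ^ k"
      unfolding H_def by (rule abs_hom_part_le)
    also have "\<dots> \<le> (\<Sum>i\<in>UNIV. H i) * norm x ^ k"
      using H by (intro mult_right_mono member_le_sum) auto
    finally show ?thesis .
  qed
  then show thesis
    using that[of "\<Sum>i\<in>UNIV. H i"] H by (simp add: sum_nonneg)
qed

text \<open>The derivative has two contributions: the radial derivative of the weight times the
  first derivatives of the polynomial, and the weight times its second derivatives. Both are
  homogeneous of degree \<open>k\<close>, whatever the sign of the exponent of the weight.\<close>

lemma weighted_grad_estimates:
  fixes c :: "('n::finite \<Rightarrow> nat) \<Rightarrow> real"
  obtains C D where "C \<ge> 0"
    "\<And>i x. x \<noteq> 0 \<Longrightarrow> (weighted_grad c a k i has_derivative (\<lambda>h. \<Sum>j\<in>UNIV. h $ j * D i j x)) (at x)"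
    "\<And>i x. x \<noteq> 0 \<Longrightarrow> \<bar>weighted_grad c a k i x\<bar> \<le> C * norm x ^ Suc k"
    "\<And>i j x. x \<noteq> 0 \<Longrightarrow> \<bar>D i j x\<bar> \<le> C * norm x ^ k"
proof -
  define \<beta> where "\<beta> = real k - real a"
  define G where "G i = hom_part (dcoeff i c) (Suc a)" for i
  define H where "H i j = hom_part (dcoeff j (dcoeff i c)) a" for i j
  define D where "D i j x = \<beta> * norm x powr (\<beta> - 1) * sgn x $ j * G i x + norm x powr \<beta> * H i j x" for i j x
  obtain C1 where C1: "C1 \<ge> 0" "\<And>i x. \<bar>G i x\<bar> \<le> C1 * norm x ^ Suc a"
    using hom_part_family_bound[of "\<lambda>i. dcoeff i c" "Suc a"] unfolding G_def by metis
  obtain C2 where C2: "C2 \<ge> 0" "\<And>i j x. \<bar>H i j x\<bar> \<le> C2 * norm x ^ a"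
    using hom_part_family_bound[of "\<lambda>(i, j). dcoeff j (dcoeff i c)" a] unfolding H_def
    by (metis case_prod_conv)
  define C where "C = \<bar>\<beta>\<bar> * C1 + C2 + C1"
  show thesis
  proof (rule that[of C D])
    show "C \<ge> 0"
      using C1 C2 by (simp add: C_def)
    fix i and x :: "real ^ 'n" assume x: "x \<noteq> 0"
    have nx: "norm x > 0"
      using x by simp
    have "((\<lambda>x. norm x powr \<beta>) has_derivative (\<lambda>h. \<beta> * norm x powr (\<beta> - 1) * (h \<bullet> sgn x))) (at x)"
      using has_derivative_compose[OF has_derivative_norm[OF x]
          has_real_derivative_powr[OF nx, of \<beta>, unfolded has_field_derivative_def]] by simp
    from has_derivative_mult[OF this hom_part_has_derivative[of "dcoeff i c" a x]]
    have "(weighted_grad c a k i has_derivative (\<lambda>h. norm x powr \<beta> * (\<Sum>j\<in>UNIV. h $ j * H i j x)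
        + \<beta> * norm x powr (\<beta> - 1) * (h \<bullet> sgn x) * G i x)) (at x)"
      by (simp add: weighted_grad_def[abs_def] \<beta>_def G_def H_def)
    moreover have "norm x powr \<beta> * (\<Sum>j\<in>UNIV. h $ j * H i j x)
        + \<beta> * norm x powr (\<beta> - 1) * (h \<bullet> sgn x) * G i x = (\<Sum>j\<in>UNIV. h $ j * D i j x)" for h
      by (simp add: D_def inner_vec_def sum_distrib_left sum_distrib_right sum.distrib[symmetric] algebra_simps)
    ultimately show "(weighted_grad c a k i has_derivative (\<lambda>h. \<Sum>j\<in>UNIV. h $ j * D i j x)) (at x)"
      by simp
    have "\<bar>weighted_grad c a k i x\<bar> = norm x powr \<beta> * \<bar>G i x\<bar>"
      by (simp add: weighted_grad_def \<beta>_def G_def abs_mult)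
    also have "\<dots> \<le> norm x powr \<beta> * (C1 * norm x ^ Suc a)"
      by (intro mult_left_mono C1) auto
    also have "\<dots> = C1 * norm x ^ Suc k"
      using powr_diff_mult_power[OF nx, of k a 1] by (simp add: \<beta>_def)
    also have "\<dots> \<le> C * norm x ^ Suc k"
      using C1 C2 by (intro mult_right_mono) (auto simp: C_def)
    finally show "\<bar>weighted_grad c a k i x\<bar> \<le> C * norm x ^ Suc k" .
    fix j
    have "\<bar>sgn x $ j\<bar> \<le> 1"
      using component_le_norm_cart[of "sgn x" j] x by (simp add: norm_sgn)
    then have "\<bar>\<beta> * norm x powr (\<beta> - 1) * sgn x $ j * G i x\<bar> \<le> \<bar>\<beta>\<bar> * norm x powr (\<beta> - 1) * 1 * (C1 * norm x ^ Suc a)"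
      unfolding abs_mult using C1(2)[of i x] by (intro mult_mono) (auto intro!: mult_nonneg_nonneg)
    also have "\<dots> = \<bar>\<beta>\<bar> * C1 * norm x ^ k"
      using powr_diff_mult_power[OF nx, of k "Suc a" 0] by (simp add: \<beta>_def algebra_simps)
    finally have 1: "\<bar>\<beta> * norm x powr (\<beta> - 1) * sgn x $ j * G i x\<bar> \<le> \<bar>\<beta>\<bar> * C1 * norm x ^ k" .
    have "\<bar>norm x powr \<beta> * H i j x\<bar> \<le> norm x powr \<beta> * (C2 * norm x ^ a)"
      unfolding abs_mult using C2(2)[of i j x] by (intro mult_mono) auto
    also have "\<dots> = C2 * norm x ^ k"
      using powr_diff_mult_power[OF nx, of k a 0] by (simp add: \<beta>_def)
    finally have 2: "\<bar>norm x powr \<beta> * H i j x\<bar> \<le> C2 * norm x ^ k" .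
    have "\<bar>D i j x\<bar> \<le> (\<bar>\<beta>\<bar> * C1 + C2) * norm x ^ k"
      unfolding D_def distrib_right using 1 2 by linarith
    also have "\<dots> \<le> C * norm x ^ k"
      using C1 by (intro mult_right_mono) (auto simp: C_def)
    finally show "\<bar>D i j x\<bar> \<le> C * norm x ^ k" .
  qed
qed

lemma abs_sum_mult_le:
  fixes u w :: "'n::finite \<Rightarrow> real"
  assumes "\<And>i. \<bar>u i\<bar> \<le> p" "\<And>i. \<bar>w i\<bar> \<le> q"
  shows "\<bar>\<Sum>i\<in>UNIV. u i * w i\<bar> \<le> real CARD('n) * (p * q)"
proof -
  have "p \<ge> 0"
    using assms(1)[of undefined] by linarith
  then have "\<bar>u i * w i\<bar> \<le> p * q" for i
    unfolding abs_mult using assms by (intro mult_mono) auto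
  then have "(\<Sum>i\<in>UNIV. \<bar>u i * w i\<bar>) \<le> (\<Sum>i\<in>(UNIV::'n set). p * q)"
    by (intro sum_mono)
  then have "(\<Sum>i\<in>UNIV. \<bar>u i * w i\<bar>) \<le> real CARD('n) * (p * q)"
    by simp
  then show ?thesis
    by (rule order_trans[OF sum_abs])
qed

text \<open>Where \<open>grad U_l1\<close> vanishes on the sphere, \<open>U_l1\<close> vanishes as well by Euler's identity, so the hypothesis
  \<open>crit\<close> is all that the criterion says about such points.\<close>

lemma radial_inequality:
  fixes U :: "real ^ 'n::finite \<Rightarrow> real"
  assumes U: "power_series_at U 0 c"
    and low: "\<And>j x. j < Suc (Suc a) \<Longrightarrow> hom_part c j x = 0"
    and mid: "\<And>j x. Suc (Suc a) < j \<Longrightarrow> j < l2 \<Longrightarrow> hom_part c j x = 0"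
    and l2: "Suc (Suc a) + k \<le> l2" and k: "k \<ge> 1"
    and crit: "\<And>q. norm q = 1 \<Longrightarrow> (\<And>i. hom_part (dcoeff i c) (Suc a) q = 0) \<Longrightarrow>
       l2 = Suc (Suc a) + k \<and> hom_part c l2 q < 0"
  obtains A where "A \<ge> 0"
    "\<And>K. \<forall>\<^sub>F x in nhds 0. x \<noteq> 0 \<longrightarrow> K * norm x ^ (Suc (Suc a) + k + 1) \<le>
       A * (\<Sum>i\<in>UNIV. weighted_grad c a k i x * partial i U x)
       - ((\<Sum>i\<in>UNIV. x $ i * partial i U x) - real (Suc (Suc a)) * U x)"
proof -
  define l1 where "l1 = Suc (Suc a)"
  define e where "e = l1 + k + 1"
  define n where "n = real CARD('n)"
  define P where "P = hom_part c l1"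
  define Q where "Q = hom_part c l2"
  define gP where "gP i = hom_part (dcoeff i c) (Suc a)" for i
  define gQ where "gQ i = hom_part (dcoeff i c) (l2 - 1)" for i
  define w where "w = weighted_grad c a k"
  \<comment> \<open>The remainder begins in degree \<open>l2 + 1\<close> and its partial derivatives
    in degree \<open>l2\<close>, so \<open>R\<close> and its radial derivative are both of order at
    least \<open>e\<close>.\<close>
  define R where "R x = U x - P x - Q x" for x
  define cR where "cR \<alpha> = c \<alpha> - (if sum \<alpha> UNIV = l1 then c \<alpha> else 0) - (if sum \<alpha> UNIV = l2 then c \<alpha> else 0)" for \<alpha>
  have l2_Suc: "l2 = Suc (l2 - 1)" "l1 < l2"
    using l2 k by (auto simp: l1_def)
  have R: "power_series_at R 0 cR"
    unfolding R_def[abs_def] cR_def[abs_def] P_def Q_def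
    by (intro power_series_at_diff U power_series_at_hom_part)
  have Rzero: "hom_part cR j x = 0" if "j < Suc l2" for j x
    using that low[of j x] mid[of j x] l2_Suc(2)
    by (cases "j < l1"; cases "j = l1"; cases "j = l2") (auto simp: cR_def[abs_def] hom_part_diff hom_part_restrict l1_def)
  obtain s where s: "s > 0"
    "\<And>x. norm x < s \<Longrightarrow> (R has_derivative (\<lambda>h. \<Sum>i\<in>UNIV. h $ i * partial i R x)) (at x)"
    "\<And>i. power_series_at (partial i R) 0 (dcoeff i cR)"
    using power_series_differentiable[OF R] by blast
  obtain CR where CR: "CR \<ge> 0" "\<forall>\<^sub>F x in nhds 0. \<bar>R x\<bar> \<le> CR * norm x ^ Suc l2"
    using power_series_bound[OF R Rzero] by blast
  obtain CD where CD: "CD \<ge> 0" "\<forall>\<^sub>F x in nhds 0. \<forall>i. \<bar>partial i R x\<bar> \<le> CD * norm x ^ l2"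
  proof (rule power_series_family_bound[of "\<lambda>i. partial i R" "\<lambda>i. dcoeff i cR" l2])
    show "power_series_at (partial i R) 0 (dcoeff i cR)" for i
      by (rule s(3))
    show "hom_part (dcoeff i cR) j x = 0" if "j < l2" for i j x
      by (rule hom_part_dcoeff_zero, rule Rzero) (use that in simp)
  qed blast
  have dU: "partial i U x = gP i x + gQ i x + partial i R x" if "norm x < s" for i x
  proof (rule partial_eq)
    have "((\<lambda>x. P x + Q x + R x) has_derivative (\<lambda>h. (\<Sum>i\<in>UNIV. h $ i * gP i x) +
       (\<Sum>i\<in>UNIV. h $ i * gQ i x) + (\<Sum>i\<in>UNIV. h $ i * partial i R x))) (at x)"
      using hom_part_has_derivative[of c "Suc a" x] hom_part_has_derivative[of c "l2 - 1" x]
        l2_Suc(1) s(2)[OF that]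
      unfolding P_def Q_def gP_def gQ_def l1_def by (intro has_derivative_add) auto
    moreover have "(\<lambda>x. P x + Q x + R x) = U"
      by (auto simp: R_def)
    ultimately show "(U has_derivative (\<lambda>h. \<Sum>i\<in>UNIV. h $ i * (gP i x + gQ i x + partial i R x))) (at x)"
      by (simp add: sum.distrib distrib_left)
  qed
  \<comment> \<open>On the sphere \<open>f\<close> and \<open>h\<close> are the coefficients of
    \<open>r ^ (l1 + k)\<close> in the two competing terms. If \<open>l2 > l1 + k\<close>, then
    \<open>Q\<close> belongs to the error and \<open>h\<close> is 0; in that case
    \<open>crit\<close> excludes zeros of \<open>f\<close>.\<close>
  define f where "f q = (\<Sum>i\<in>UNIV. (gP i q)\<^sup>2)" for q
  define h where "h q = (if l2 = l1 + k then - real (l2 - l1) * Q q else 0)" for q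
  obtain A b where Ab: "A \<ge> 0" "b > 0" "\<And>q. q \<in> sphere 0 1 \<Longrightarrow> A * f q + h q \<ge> b"
  proof (rule compact_positive_combination)
    show "continuous_on (sphere 0 1) f"
      unfolding f_def gP_def by (intro continuous_intros continuous_on_hom_part)
    show "continuous_on (sphere 0 1) h"
    proof (cases "l2 = l1 + k")
      case True
      then show ?thesis
        unfolding h_def Q_def by (simp add: continuous_intros continuous_on_hom_part)
    qed (simp add: h_def)
    show "f q \<ge> 0" for q
      by (simp add: f_def sum_nonneg)
    show "h q > 0" if "q \<in> sphere 0 1" "f q = 0" for q
    proof -
      have "gP i q = 0" for i
        using that(2) by (simp add: f_def sum_nonneg_eq_0_iff)
      then have "l2 = l1 + k \<and> Q q < 0"
        using crit[of q] that(1) by (auto simp: gP_def l1_def Q_def)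
      then show ?thesis
        using k by (simp add: h_def mult_pos_neg)
    qed
  qed auto
  obtain Cw D where Cw: "Cw \<ge> 0" "\<And>i x. x \<noteq> 0 \<Longrightarrow> \<bar>w i x\<bar> \<le> Cw * norm x ^ Suc k"
    using weighted_grad_estimates[of c a k] unfolding w_def by metis
  obtain CQ where CQ: "CQ \<ge> 0" "\<And>i x. \<bar>gQ i x\<bar> \<le> CQ * norm x ^ (l2 - 1)"
    using hom_part_family_bound[of "\<lambda>i. dcoeff i c" "l2 - 1"] unfolding gQ_def by metis
  obtain CQ' where CQ': "CQ' \<ge> 0" "\<And>x. \<bar>Q x\<bar> \<le> CQ' * norm x ^ l2"
  proof (rule that)
    show "(\<Sum>\<alpha> | sum \<alpha> UNIV = l2. \<bar>c \<alpha>\<bar>) \<ge> 0"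
      by (simp add: sum_nonneg)
    show "\<bar>Q x\<bar> \<le> (\<Sum>\<alpha> | sum \<alpha> UNIV = l2. \<bar>c \<alpha>\<bar>) * norm x ^ l2" for x
      unfolding Q_def by (rule abs_hom_part_le)
  qed
  \<comment> \<open>One summand for each error of order \<open>e\<close>: \<open>w\<close> paired
    with the derivatives of \<open>Q\<close> and \<open>R\<close>, the term \<open>Q\<close> in the
    case \<open>l2 > l1 + k\<close>, the radial derivative of \<open>R\<close>, and
    \<open>l1 * R\<close>.\<close>
  define C where "C = A * (n * (Cw * (CQ + CD))) + real l2 * CQ' + n * CD + real l1 * CR"
  have n: "n \<ge> 0" by (simp add: n_def)
  show thesis
  proof (rule that[OF Ab(1)])
    fix K
    have "\<forall>\<^sub>F x::real ^ 'n in nhds 0. norm x < min (min s 1) (b / (\<bar>K\<bar> + \<bar>C\<bar> + 1))"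
      using s(1) Ab(2) by (intro eventually_nhds_metric[THEN iffD2] exI[of _ "min (min s 1) (b / (\<bar>K\<bar> + \<bar>C\<bar> + 1))"]) auto
    with CR(2) CD(2) show "\<forall>\<^sub>F x in nhds 0. x \<noteq> 0 \<longrightarrow> K * norm x ^ (Suc (Suc a) + k + 1) \<le>
       A * (\<Sum>i\<in>UNIV. weighted_grad c a k i x * partial i U x)
       - ((\<Sum>i\<in>UNIV. x $ i * partial i U x) - real (Suc (Suc a)) * U x)"
      unfolding w_def[symmetric] l1_def[symmetric] e_def[symmetric]
    proof (eventually_elim, intro impI)
      fix x :: "real ^ 'n"
      assume Rx: "\<bar>R x\<bar> \<le> CR * norm x ^ Suc l2"
        and Dx: "\<forall>i. \<bar>partial i R x\<bar> \<le> CD * norm x ^ l2"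
        and small: "norm x < min (min s 1) (b / (\<bar>K\<bar> + \<bar>C\<bar> + 1))" and x: "x \<noteq> 0"
      define r where "r = norm x"
      have r: "0 < r" "r \<le> 1" "r < s"
        using small x by (auto simp: r_def)
      have pow: "r ^ j \<le> r ^ e" if "e \<le> j" for j
        using r that by (intro power_decreasing) auto
      define q where "q = sgn x"
      have q: "q \<in> sphere 0 1" "x = r *\<^sub>R q"
        using x by (auto simp: q_def r_def norm_sgn sgn_div_norm)
      define T where "T = (\<Sum>i\<in>UNIV. w i x * (gQ i x + partial i R x))"
      have wP: "w i x * gP i x = r ^ (l1 + k) * (gP i q)\<^sup>2" for i
      proof -
        have "gP i x = gP i q * r ^ Suc a"
          unfolding gP_def q(2) hom_part_scale ..
        then have "w i x * gP i x = (r powr (real k - real a) * r ^ (a + (a + 2))) * (gP i q)\<^sup>2"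
          unfolding w_def weighted_grad_def gP_def r_def by (simp add: power2_eq_square power_add mult_ac)
        also have "r powr (real k - real a) * r ^ (a + (a + 2)) = r ^ (l1 + k)"
          unfolding powr_diff_mult_power[OF r(1)] by (simp add: l1_def add_ac)
        finally show ?thesis .
      qed
      have "(\<Sum>i\<in>UNIV. w i x * partial i U x) = (\<Sum>i\<in>UNIV. w i x * gP i x + w i x * (gQ i x + partial i R x))"
        using dU[of x] r by (intro sum.cong) (auto simp: r_def distrib_left)
      also have "\<dots> = r ^ (l1 + k) * f q + T"
        unfolding sum.distrib wP by (simp add: f_def T_def sum_distrib_left)
      finally have sum_w: "(\<Sum>i\<in>UNIV. w i x * partial i U x) = r ^ (l1 + k) * f q + T" .
      have "\<bar>gQ i x + partial i R x\<bar> \<le> (CQ + CD) * r ^ (l2 - 1)" for i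
      proof -
        have "\<bar>partial i R x\<bar> \<le> CD * r ^ l2"
          using Dx by (simp add: r_def)
        also have "\<dots> \<le> CD * r ^ (l2 - 1)"
          using CD(1) r by (intro mult_left_mono power_decreasing) auto
        finally show ?thesis
          using CQ(2)[of i x] by (simp add: distrib_right r_def)
      qed
      then have "\<bar>T\<bar> \<le> n * ((Cw * r ^ Suc k) * ((CQ + CD) * r ^ (l2 - 1)))"
        unfolding T_def n_def using Cw(2)[OF x] by (intro abs_sum_mult_le) (auto simp: r_def)
      also have "\<dots> = n * (Cw * (CQ + CD)) * r ^ (Suc k + (l2 - 1))"
        by (simp add: power_add)
      also have "\<dots> \<le> n * (Cw * (CQ + CD)) * r ^ e"
        using n Cw(1) CQ(1) CD(1) l2 l2_Suc
        by (intro mult_left_mono pow) (auto simp: e_def l1_def)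
      finally have T: "\<bar>T\<bar> \<le> n * (Cw * (CQ + CD)) * r ^ e" .
      have AT: "\<bar>A * T\<bar> \<le> A * (n * (Cw * (CQ + CD))) * r ^ e"
        using mult_left_mono[OF T Ab(1)] Ab(1) by (simp add: abs_mult mult.assoc)
      define V where "V = (\<Sum>i\<in>UNIV. x $ i * partial i R x)"
      have "\<bar>V\<bar> \<le> n * (r * (CD * r ^ l2))"
        unfolding V_def n_def r_def using Dx component_le_norm_cart[of x] by (intro abs_sum_mult_le) auto
      also have "\<dots> = n * CD * r ^ Suc l2" by simp
      also have "\<dots> \<le> n * CD * r ^ e"
        using n CD(1) l2 by (intro mult_left_mono pow) (auto simp: e_def l1_def)
      finally have V: "\<bar>V\<bar> \<le> n * CD * r ^ e" .
      have "\<bar>R x\<bar> \<le> CR * r ^ Suc l2"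
        using Rx by (simp add: r_def)
      also have "\<dots> \<le> CR * r ^ e"
        using CR(1) l2 by (intro mult_left_mono pow) (auto simp: e_def l1_def)
      finally have lR: "\<bar>real l1 * R x\<bar> \<le> real l1 * CR * r ^ e"
        using mult_left_mono[of "\<bar>R x\<bar>" "CR * r ^ e" "real l1"] by (simp add: abs_mult mult.assoc)
      have "(\<Sum>i\<in>UNIV. x $ i * partial i U x) = (\<Sum>i\<in>UNIV. x $ i * gP i x) + (\<Sum>i\<in>UNIV. x $ i * gQ i x) + V"
        unfolding V_def sum.distrib[symmetric] using dU[of x] r
        by (intro sum.cong) (auto simp: r_def distrib_left)
      also have "(\<Sum>i\<in>UNIV. x $ i * gP i x) = real l1 * P x"
        unfolding gP_def P_def l1_def by (rule hom_part_euler)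
      also have "(\<Sum>i\<in>UNIV. x $ i * gQ i x) = real l2 * Q x"
        unfolding gQ_def Q_def using hom_part_euler[of x c "l2 - 1"] l2_Suc(1) by simp
      \<comment> \<open>The term \<open>P\<close> cancels against \<open>l1 * U\<close>, and
        \<open>Q\<close> survives with the factor \<open>l2 - l1\<close>.\<close>
      finally have radial: "(\<Sum>i\<in>UNIV. x $ i * partial i U x) - real l1 * U x = real (l2 - l1) * Q x + V - real l1 * R x"
        using l2_Suc(2) by (simp add: R_def algebra_simps)
      have hQ: "- (real (l2 - l1) * Q x) \<ge> r ^ (l1 + k) * h q - real l2 * CQ' * r ^ e"
      proof (cases "l2 = l1 + k")
        case True
        have "Q x = Q q * r ^ l2"
          unfolding Q_def q(2) hom_part_scale ..
        then have "- (real (l2 - l1) * Q x) = r ^ (l1 + k) * h q"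
          using True by (simp add: h_def)
        then show ?thesis
          using CQ'(1) r by simp
      next
        case False
        have "\<bar>Q x\<bar> \<le> CQ' * r ^ l2"
          using CQ'(2) by (simp add: r_def)
        also have "\<dots> \<le> CQ' * r ^ e"
          using CQ'(1) False l2 by (intro mult_left_mono pow) (auto simp: e_def l1_def)
        finally have "real (l2 - l1) * \<bar>Q x\<bar> \<le> real l2 * (CQ' * r ^ e)"
          by (intro mult_mono) auto
        moreover have "\<bar>real (l2 - l1) * Q x\<bar> = real (l2 - l1) * \<bar>Q x\<bar>"
          by (simp add: abs_mult)
        ultimately show ?thesis
          using False by (simp add: h_def mult.assoc)
      qed
      \<comment> \<open>The neighbourhood was chosen for this inequality: the margin
        \<open>b * r ^ (l1 + k)\<close> dominates \<open>(K + C) * r ^ e\<close>, since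
        \<open>e = l1 + k + 1\<close>.\<close>
      have "(\<bar>K\<bar> + \<bar>C\<bar> + 1) * r < b"
        using small Ab(2) by (simp add: r_def pos_less_divide_eq mult.commute)
      then have "(K + C) * r \<le> b"
        using r mult_right_mono[of "K + C" "\<bar>K\<bar> + \<bar>C\<bar> + 1" r] by linarith
      then have "r ^ (l1 + k) * ((K + C) * r) \<le> r ^ (l1 + k) * (A * f q + h q)"
        using Ab(3)[OF q(1)] r by (intro mult_left_mono) auto
      then have main: "K * r ^ e + C * r ^ e \<le> A * (r ^ (l1 + k) * f q) + r ^ (l1 + k) * h q"
        by (simp add: e_def algebra_simps)
      have "A * (r ^ (l1 + k) * f q + T) - (real (l2 - l1) * Q x + V - real l1 * R x)
         \<ge> A * (r ^ (l1 + k) * f q) + r ^ (l1 + k) * h q - C * r ^ e"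
        using AT V lR hQ unfolding C_def distrib_right distrib_left by linarith
      then show "K * norm x ^ e \<le> A * (\<Sum>i\<in>UNIV. w i x * partial i U x) -
          ((\<Sum>i\<in>UNIV. x $ i * partial i U x) - real l1 * U x)"
        unfolding sum_w radial r_def[symmetric] using main by linarith
    qed
  qed
qed

section \<open>Solutions of ordinary differential equations\<close>

text \<open>Rescaling the unknown by \<open>exp (- K t)\<close> makes the Picard operator a contraction on all of \<open>[0, T]\<close>,
  so that no gluing of local solutions is needed.\<close>
lemma global_lipschitz_ode:
  fixes F :: "'a::euclidean_space \<Rightarrow> 'a"
  assumes F: "\<And>x y. norm (F x - F y) \<le> L * norm (x - y)" and T: "T \<ge> 0"
  obtains \<phi> where "\<phi> 0 = z"
    "\<And>t. t \<in> {0..T} \<Longrightarrow> (\<phi> has_vector_derivative F (\<phi> t)) (at t within {0..T})"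
proof -
  \<comment> \<open>With \<open>L \<le> K / 2\<close>, the integral of
    \<open>K / 2 * exp (K * s)\<close> over \<open>{0..u}\<close> is at most
    \<open>exp (K * u) / 2\<close>; after the rescaling this is the contraction factor 1/2.\<close>
  define K where "K = 2 * (\<bar>L\<bar> + 1)"
  have K: "K > 0" "\<bar>L\<bar> \<le> K / 2"
    by (auto simp: K_def)
  have FL: "norm (F x - F y) \<le> (K / 2) * norm (x - y)" for x y
  proof -
    have "L \<le> K / 2"
      using K(2) by linarith
    then show ?thesis
      using F[of x y] mult_right_mono[of L "K/2" "norm (x - y)"] by (meson norm_ge_zero order_trans)
  qed
  have contF: "continuous_on UNIV F"
  proof (rule lipschitz_on_continuous_on)
    show "(K / 2)-lipschitz_on UNIV F"
      using FL K by (intro lipschitz_onI) (auto simp: dist_norm)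
  qed
  \<comment> \<open>Clamping the time to \<open>{0..T}\<close> lets the Picard operator act on
    bounded continuous functions on the whole line, which form a complete space.\<close>
  define cl where "cl t = max 0 (min T t)" for t :: real
  have cl: "cl t \<in> {0..T}" "t \<in> {0..T} \<Longrightarrow> cl t = t" for t
    using T by (auto simp: cl_def)
  have contcl: "continuous_on UNIV cl"
    unfolding cl_def by (intro continuous_intros)
  define I where "I \<psi> t = integral {0..t} (\<lambda>s. F (exp (K * s) *\<^sub>R apply_bcontfun \<psi> s))" for \<psi> :: "real \<Rightarrow>\<^sub>C 'a" and t
  define Q where "Q \<psi> t = exp (- (K * cl t)) *\<^sub>R (z + I \<psi> (cl t))" for \<psi> t
  have cont_in: "continuous_on S (\<lambda>s. F (exp (K * s) *\<^sub>R apply_bcontfun \<psi> s))" for S \<psi>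
    by (rule continuous_on_compose2[OF contF]) (auto intro!: continuous_intros)
  have int: "(\<lambda>s. F (exp (K * s) *\<^sub>R apply_bcontfun \<psi> s)) integrable_on {0..t}" for t \<psi>
    by (rule integrable_continuous_real[OF cont_in])
  have contI: "continuous_on {0..T} (I \<psi>)" for \<psi>
    unfolding I_def by (rule indefinite_integral_continuous_1[OF int])
  have contQ: "continuous_on UNIV (Q \<psi>)" for \<psi>
    unfolding Q_def using cl(1)
    by (intro continuous_intros continuous_on_compose2[OF contI contcl] contcl) auto
  have "Q \<psi> \<in> bcontfun" for \<psi>
  proof -
    have "bounded (Q \<psi> ` {0..T})"
      by (intro compact_imp_bounded compact_continuous_image continuous_on_subset[OF contQ]) auto
    moreover have "range (Q \<psi>) \<subseteq> Q \<psi> ` {0..T}"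
    proof
      fix y assume "y \<in> range (Q \<psi>)"
      then obtain t where "y = Q \<psi> t" by blast
      then have "y = Q \<psi> (cl t)"
        using cl(2)[OF cl(1)[of t]] by (simp add: Q_def)
      then show "y \<in> Q \<psi> ` {0..T}"
        using cl(1) by blast
    qed
    ultimately show ?thesis
      using contQ bounded_subset by (auto simp: bcontfun_def)
  qed
  then have app: "apply_bcontfun (Bcontfun (Q \<psi>)) = Q \<psi>" for \<psi>
    by (simp add: Bcontfun_inverse)
  have contr: "dist (Bcontfun (Q \<psi>)) (Bcontfun (Q \<omega>)) \<le> (1/2) * dist \<psi> \<omega>" for \<psi> \<omega>
  proof (rule dist_bound)
    fix t
    define u where "u = cl t"
    have u: "u \<ge> 0"
      using cl(1)[of t] by (simp add: u_def)
    have hi: "((\<lambda>s. K / 2 * (exp (K * s) * dist \<psi> \<omega>)) has_integral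
        (exp (K * u) * dist \<psi> \<omega> / 2 - exp (K * 0) * dist \<psi> \<omega> / 2)) {0..u}"
      using u by (intro fundamental_theorem_of_calculus)
        (auto intro!: derivative_eq_intros simp: has_real_derivative_iff_has_vector_derivative[symmetric])
    have "norm (I \<psi> u - I \<omega> u) = norm (integral {0..u} (\<lambda>s. F (exp (K * s) *\<^sub>R apply_bcontfun \<psi> s) - F (exp (K * s) *\<^sub>R apply_bcontfun \<omega> s)))"
      unfolding I_def by (subst integral_diff[OF int int]) simp
    also have "\<dots> \<le> integral {0..u} (\<lambda>s. K / 2 * (exp (K * s) * dist \<psi> \<omega>))"
    proof (rule integral_norm_bound_integral)
      show "(\<lambda>s. F (exp (K * s) *\<^sub>R apply_bcontfun \<psi> s) - F (exp (K * s) *\<^sub>R apply_bcontfun \<omega> s)) integrable_on {0..u}"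
        by (intro integrable_diff int)
      show "(\<lambda>s. K / 2 * (exp (K * s) * dist \<psi> \<omega>)) integrable_on {0..u}"
        using hi by (rule has_integral_integrable)
      fix s
      have "norm (F (exp (K * s) *\<^sub>R apply_bcontfun \<psi> s) - F (exp (K * s) *\<^sub>R apply_bcontfun \<omega> s))
         \<le> K / 2 * norm (exp (K * s) *\<^sub>R apply_bcontfun \<psi> s - exp (K * s) *\<^sub>R apply_bcontfun \<omega> s)"
        by (rule FL)
      also have "norm (exp (K * s) *\<^sub>R apply_bcontfun \<psi> s - exp (K * s) *\<^sub>R apply_bcontfun \<omega> s)
         = exp (K * s) * dist (apply_bcontfun \<psi> s) (apply_bcontfun \<omega> s)"
        by (simp add: scaleR_diff_right[symmetric] dist_norm)
      also have "\<dots> \<le> exp (K * s) * dist \<psi> \<omega>"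
        by (intro mult_left_mono dist_bounded) auto
      finally show "norm (F (exp (K * s) *\<^sub>R apply_bcontfun \<psi> s) - F (exp (K * s) *\<^sub>R apply_bcontfun \<omega> s))
         \<le> K / 2 * (exp (K * s) * dist \<psi> \<omega>)"
        using K by auto
    qed
    also have "\<dots> \<le> exp (K * u) * dist \<psi> \<omega> / 2"
      using integral_unique[OF hi] by simp
    finally have *: "norm (I \<psi> u - I \<omega> u) \<le> exp (K * u) * dist \<psi> \<omega> / 2" .
    have "dist (Q \<psi> t) (Q \<omega> t) = exp (- (K * u)) * norm (I \<psi> u - I \<omega> u)"
      by (simp add: Q_def u_def dist_norm scaleR_diff_right[symmetric])
    also have "\<dots> \<le> exp (- (K * u)) * (exp (K * u) * dist \<psi> \<omega> / 2)"
      using * by (intro mult_left_mono) auto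
    also have "\<dots> = (1/2) * dist \<psi> \<omega>"
      by (simp add: exp_minus)
    finally show "dist (apply_bcontfun (Bcontfun (Q \<psi>)) t) (apply_bcontfun (Bcontfun (Q \<omega>)) t) \<le> (1/2) * dist \<psi> \<omega>"
      by (simp add: app)
  qed
  have "\<exists>!\<psi>. \<psi> \<in> UNIV \<and> Bcontfun (Q \<psi>) = \<psi>"
    by (rule Banach_fix[where c = "1/2"]) (use contr in \<open>auto simp: complete_UNIV\<close>)
  then obtain \<psi> where "Bcontfun (Q \<psi>) = \<psi>"
    by blast
  then have \<psi>: "apply_bcontfun \<psi> = Q \<psi>"
    using app by metis
  define \<phi> where "\<phi> t = z + I \<psi> t" for t
  have \<phi>: "exp (K * t) *\<^sub>R apply_bcontfun \<psi> t = \<phi> t" if "t \<in> {0..T}" for t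
    using cl(2)[OF that] by (simp add: \<psi> Q_def \<phi>_def exp_minus)
  show thesis
  proof (rule that)
    show "\<phi> 0 = z"
      by (simp add: \<phi>_def I_def)
    fix t assume t: "t \<in> {0..T}"
    have "(I \<psi> has_vector_derivative F (exp (K * t) *\<^sub>R apply_bcontfun \<psi> t)) (at t within {0..T})"
      unfolding I_def by (rule integral_has_vector_derivative[OF cont_in t])
    then show "(\<phi> has_vector_derivative F (\<phi> t)) (at t within {0..T})"
      unfolding \<phi>[OF t] \<phi>_def[abs_def] by (auto intro!: derivative_eq_intros)
  qed
qed

text \<open>The projection to the nearest point of \<open>S\<close> does not increase distances, so
  composing \<open>F\<close> with it gives a globally Lipschitz field. A solution of the modified
  equation solves the original one as long as it stays in \<open>S\<close>, and the a priori
  statement \<open>inv\<close> prevents a first exit.\<close>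

lemma ode_solution_in_invariant_set:
  fixes F :: "'a::euclidean_space \<Rightarrow> 'a"
  assumes S: "convex S" "closed S"
    and F: "\<And>x y. x \<in> S \<Longrightarrow> y \<in> S \<Longrightarrow> norm (F x - F y) \<le> L * norm (x - y)"
    and z: "z \<in> S" and T: "T \<ge> 0"
    and inv: "\<And>\<tau> \<phi>. \<lbrakk>\<tau> \<ge> 0; \<phi> 0 = z; \<And>t. t \<in> {0..\<tau>} \<Longrightarrow> \<phi> t \<in> S;
        \<And>t. t \<in> {0..\<tau>} \<Longrightarrow> (\<phi> has_vector_derivative F (\<phi> t)) (at t within {0..\<tau>})\<rbrakk>
        \<Longrightarrow> \<phi> \<tau> \<in> interior S"
  obtains \<phi> where "\<phi> 0 = z" "\<And>t. t \<in> {0..T} \<Longrightarrow> \<phi> t \<in> S"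
    "\<And>t. t \<in> {0..T} \<Longrightarrow> (\<phi> has_vector_derivative F (\<phi> t)) (at t within {0..T})"
proof -
  define P where "P = closest_point S"
  have ne: "S \<noteq> {}"
    using z by auto
  have P: "P x \<in> S" for x
    unfolding P_def using S ne by (intro closest_point_in_set)
  have PS: "P x = x" if "x \<in> S" for x
    unfolding P_def using that by (rule closest_point_self)
  have "norm (F (P x) - F (P y)) \<le> \<bar>L\<bar> * norm (x - y)" for x y
  proof -
    have "norm (F (P x) - F (P y)) \<le> L * norm (P x - P y)"
      by (intro F P)
    also have "\<dots> \<le> \<bar>L\<bar> * norm (P x - P y)"
      by (intro mult_right_mono) auto
    also have "\<dots> \<le> \<bar>L\<bar> * norm (x - y)"
      using closest_point_lipschitz[OF S ne, of x y] by (intro mult_left_mono) (auto simp: P_def dist_norm)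
    finally show ?thesis .
  qed
  then obtain \<phi> where \<phi>: "\<phi> 0 = z"
    "\<And>t. t \<in> {0..T} \<Longrightarrow> (\<phi> has_vector_derivative F (P (\<phi> t))) (at t within {0..T})"
    using global_lipschitz_ode[of "\<lambda>x. F (P x)" "\<bar>L\<bar>" T z] T by metis
  have cont: "continuous_on {0..T} \<phi>"
    unfolding continuous_on_eq_continuous_within using \<phi>(2) has_vector_derivative_continuous by blast
  \<comment> \<open>The curve lies in the closed set \<open>S\<close> before time \<open>t\<close>,
    hence also at time \<open>t\<close>. On \<open>{0..t}\<close> the projection is then the
    identity and \<open>inv\<close> applies. For \<open>t = 0\<close> the premise on earlier times
    is empty and \<open>z \<in> S\<close> takes over.\<close>
  have stay: "\<phi> t \<in> interior S" if t: "t \<in> {0..T}" and S': "\<And>s. s \<in> {0..<t} \<Longrightarrow> \<phi> s \<in> S" for t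
  proof -
    have clo: "\<phi> s \<in> S" if s: "s \<in> {0..t}" for s
    proof (cases "s < t")
      case True
      then show ?thesis using S' s by auto
    next
      case False
      then have st: "s = t" using s by auto
      show ?thesis
      proof (cases "t = 0")
        case True
        then show ?thesis using st \<phi>(1) z by simp
      next
        case False
        then have "t > 0" using t by auto
        have "closure {0..<t} = {0..t}"
          using \<open>t > 0\<close> by simp
        moreover have "continuous_on {0..t} \<phi>"
          using t by (intro continuous_on_subset[OF cont]) auto
        ultimately have "\<phi> ` closure {0..<t} \<subseteq> S"
          using S' S(2) by (intro image_closure_subset) auto
        then show ?thesis
          using \<open>closure {0..<t} = {0..t}\<close> s by auto
      qed
    qed
    show ?thesis
    proof (rule inv)
      show "t \<ge> 0" "\<phi> 0 = z" using t \<phi>(1) by auto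
      fix s assume s: "s \<in> {0..t}"
      show "\<phi> s \<in> S" by (rule clo[OF s])
      have "(\<phi> has_vector_derivative F (P (\<phi> s))) (at s within {0..t})"
        using s t by (intro has_vector_derivative_within_subset[OF \<phi>(2)]) auto
      then show "(\<phi> has_vector_derivative F (\<phi> s)) (at s within {0..t})"
        using PS[OF clo[OF s]] by simp
    qed
  qed
  have all: "\<phi> t \<in> interior S" if "t \<in> {0..T}" for t
  proof (rule ccontr)
    assume n: "\<phi> t \<notin> interior S"
    \<comment> \<open>These are the times outside the interior. The set is closed, so it contains
      its infimum, and \<open>stay\<close> contradicts this first time.\<close>
    define E where "E = {0..T} \<inter> \<phi> -` (- interior S)"
    have "closed E"
      unfolding E_def by (intro continuous_closed_preimage[OF cont]) auto
    moreover have "t \<in> E" "bdd_below E"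
      using n that by (auto simp: E_def)
    ultimately have "Inf E \<in> E"
      using closed_contains_Inf[of E] by auto
    then have "Inf E \<in> {0..T}" "\<phi> (Inf E) \<notin> interior S"
      by (auto simp: E_def)
    moreover have "\<phi> s \<in> S" if "s \<in> {0..<Inf E}" for s
    proof -
      have "s \<notin> E"
        using that cInf_lower[of s E] \<open>bdd_below E\<close> by force
      then show ?thesis
        using that \<open>Inf E \<in> {0..T}\<close> interior_subset by (auto simp: E_def)
    qed
    ultimately show False
      using stay by blast
  qed
  show thesis
  proof (rule that)
    show "\<phi> 0 = z" by fact
    fix t assume t: "t \<in> {0..T}"
    then show S': "\<phi> t \<in> S"
      using all interior_subset by blast
    show "(\<phi> has_vector_derivative F (\<phi> t)) (at t within {0..T})"
      using \<phi>(2)[OF t] PS[OF S'] by simp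
  qed
qed

section \<open>Lipschitz continuity of the Euler--Lagrange field\<close>

text \<open>Boundedness is bundled with the Lipschitz condition to obtain closure under products.
  The components of the force are polynomial in such functions and are then covered by structural
  rules.\<close>

definition lip_bdd :: "'a::real_normed_vector set \<Rightarrow> ('a \<Rightarrow> real) \<Rightarrow> bool" where
  "lip_bdd S f \<longleftrightarrow> (\<exists>L. \<forall>p\<in>S. \<bar>f p\<bar> \<le> L \<and> (\<forall>q\<in>S. \<bar>f p - f q\<bar> \<le> L * norm (p - q)))"

lemma lip_bddI:
  assumes "\<And>p. p \<in> S \<Longrightarrow> \<bar>f p\<bar> \<le> M" "\<And>p q. p \<in> S \<Longrightarrow> q \<in> S \<Longrightarrow> \<bar>f p - f q\<bar> \<le> L * norm (p - q)"
  shows "lip_bdd S f"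
  unfolding lip_bdd_def
proof (intro exI[of _ "max M L"] ballI conjI)
  fix p q assume "p \<in> S" "q \<in> S"
  then have "\<bar>f p - f q\<bar> \<le> L * norm (p - q)"
    by (rule assms(2))
  also have "\<dots> \<le> max M L * norm (p - q)"
    by (intro mult_right_mono) auto
  finally show "\<bar>f p - f q\<bar> \<le> max M L * norm (p - q)" .
next
  fix p assume "p \<in> S"
  then show "\<bar>f p\<bar> \<le> max M L"
    by (intro max.coboundedI1 assms(1))
qed

lemma lip_bddD:
  assumes "lip_bdd S f"
  shows "\<exists>L\<ge>0. (\<forall>p\<in>S. \<bar>f p\<bar> \<le> L) \<and> (\<forall>p\<in>S. \<forall>q\<in>S. \<bar>f p - f q\<bar> \<le> L * norm (p - q))"
proof -
  obtain L where L: "\<forall>p\<in>S. \<bar>f p\<bar> \<le> L \<and> (\<forall>q\<in>S. \<bar>f p - f q\<bar> \<le> L * norm (p - q))"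
    using assms unfolding lip_bdd_def by blast
  show ?thesis
  proof (intro exI[of _ "\<bar>L\<bar>"] conjI ballI)
    fix p assume p: "p \<in> S"
    show "\<bar>f p\<bar> \<le> \<bar>L\<bar>"
      using L p by (meson abs_ge_self order_trans)
    fix q assume "q \<in> S"
    then have "\<bar>f p - f q\<bar> \<le> L * norm (p - q)"
      using L p by blast
    also have "\<dots> \<le> \<bar>L\<bar> * norm (p - q)"
      by (intro mult_right_mono) auto
    finally show "\<bar>f p - f q\<bar> \<le> \<bar>L\<bar> * norm (p - q)" .
  qed simp
qed

lemma lip_bdd_const: "lip_bdd S (\<lambda>_. a)"
  by (rule lip_bddI[of _ _ "\<bar>a\<bar>" 0]) auto

lemma lip_bdd_minus: "lip_bdd S f \<Longrightarrow> lip_bdd S (\<lambda>p. - f p)"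
  by (auto simp: lip_bdd_def abs_minus_commute)

lemma lip_bdd_add:
  assumes "lip_bdd S f" "lip_bdd S h"
  shows "lip_bdd S (\<lambda>p. f p + h p)"
proof -
  obtain L where L: "L \<ge> 0" "\<And>p. p \<in> S \<Longrightarrow> \<bar>f p\<bar> \<le> L"
    "\<And>p q. p \<in> S \<Longrightarrow> q \<in> S \<Longrightarrow> \<bar>f p - f q\<bar> \<le> L * norm (p - q)"
    using lip_bddD[OF assms(1)] by blast
  obtain L' where L': "L' \<ge> 0" "\<And>p. p \<in> S \<Longrightarrow> \<bar>h p\<bar> \<le> L'"
    "\<And>p q. p \<in> S \<Longrightarrow> q \<in> S \<Longrightarrow> \<bar>h p - h q\<bar> \<le> L' * norm (p - q)"
    using lip_bddD[OF assms(2)] by blast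
  show ?thesis
  proof (rule lip_bddI)
    fix p q assume pq: "p \<in> S" "q \<in> S"
    show "\<bar>f p + h p\<bar> \<le> L + L'"
      using L(2)[OF pq(1)] L'(2)[OF pq(1)] by linarith
    show "\<bar>f p + h p - (f q + h q)\<bar> \<le> (L + L') * norm (p - q)"
      unfolding distrib_right using L(3)[OF pq] L'(3)[OF pq] by linarith
  qed
qed

lemma lip_bdd_diff: "lip_bdd S f \<Longrightarrow> lip_bdd S h \<Longrightarrow> lip_bdd S (\<lambda>p. f p - h p)"
  using lip_bdd_add[of S f "\<lambda>p. - h p"] lip_bdd_minus[of S h] by simp

lemma lip_bdd_mult:
  assumes "lip_bdd S f" "lip_bdd S h"
  shows "lip_bdd S (\<lambda>p. f p * h p)"
proof -
  obtain L where L: "L \<ge> 0" "\<And>p. p \<in> S \<Longrightarrow> \<bar>f p\<bar> \<le> L"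
    "\<And>p q. p \<in> S \<Longrightarrow> q \<in> S \<Longrightarrow> \<bar>f p - f q\<bar> \<le> L * norm (p - q)"
    using lip_bddD[OF assms(1)] by blast
  obtain L' where L': "L' \<ge> 0" "\<And>p. p \<in> S \<Longrightarrow> \<bar>h p\<bar> \<le> L'"
    "\<And>p q. p \<in> S \<Longrightarrow> q \<in> S \<Longrightarrow> \<bar>h p - h q\<bar> \<le> L' * norm (p - q)"
    using lip_bddD[OF assms(2)] by blast
  show ?thesis
  proof (rule lip_bddI)
    fix p q assume pq: "p \<in> S" "q \<in> S"
    show "\<bar>f p * h p\<bar> \<le> L * L'"
      unfolding abs_mult using L(1,2) L'(2) pq by (intro mult_mono) auto
    have "f p * h p - f q * h q = f p * (h p - h q) + (f p - f q) * h q"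
      by (simp add: algebra_simps)
    moreover have "\<bar>f p * (h p - h q)\<bar> \<le> L * (L' * norm (p - q))"
      unfolding abs_mult using L(1,2) L'(3) pq by (intro mult_mono) auto
    moreover have "\<bar>(f p - f q) * h q\<bar> \<le> (L * norm (p - q)) * L'"
      unfolding abs_mult using L(1,3) L'(2) pq by (intro mult_mono) auto
    ultimately show "\<bar>f p * h p - f q * h q\<bar> \<le> (2 * (L * L')) * norm (p - q)"
      by (simp add: algebra_simps)
  qed
qed

lemma lip_bdd_sum: "(\<And>i. i \<in> I \<Longrightarrow> lip_bdd S (f i)) \<Longrightarrow> lip_bdd S (\<lambda>p. \<Sum>i\<in>I. f i p)"
  by (induction I rule: infinite_finite_induct) (auto intro: lip_bdd_const lip_bdd_add)

lemma norm_fst_diff_le: "norm (fst p - fst q) \<le> norm (p - q)"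
  by (metis fst_diff norm_fst_le prod.collapse)

lemma norm_snd_diff_le: "norm (snd p - snd q) \<le> norm (p - q)"
  by (metis snd_diff norm_snd_le prod.collapse)

lemma lip_bdd_fst:
  assumes "lip_bdd A f"
  shows "lip_bdd (A \<times> B) (\<lambda>p. f (fst p))"
proof -
  obtain L where L: "L \<ge> 0" "\<And>p. p \<in> A \<Longrightarrow> \<bar>f p\<bar> \<le> L"
    "\<And>p q. p \<in> A \<Longrightarrow> q \<in> A \<Longrightarrow> \<bar>f p - f q\<bar> \<le> L * norm (p - q)"
    using lip_bddD[OF assms] by blast
  show ?thesis
  proof (rule lip_bddI)
    fix p q assume pq: "p \<in> A \<times> B" "q \<in> A \<times> B"
    show "\<bar>f (fst p)\<bar> \<le> L"
      using L(2) pq by auto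
    have "\<bar>f (fst p) - f (fst q)\<bar> \<le> L * norm (fst p - fst q)"
      using L(3)[of "fst p" "fst q"] pq by auto
    also have "\<dots> \<le> L * norm (p - q)"
      by (intro mult_left_mono norm_fst_diff_le L(1))
    finally show "\<bar>f (fst p) - f (fst q)\<bar> \<le> L * norm (p - q)" .
  qed
qed

lemma lip_bdd_snd_nth:
  fixes A :: "'a::real_normed_vector set"
  shows "lip_bdd (A \<times> cball 0 M) (\<lambda>p. snd p $ i)"
proof (rule lip_bddI)
  fix p q :: "'a \<times> (real ^ 'b)" assume pq: "p \<in> A \<times> cball 0 M" "q \<in> A \<times> cball 0 M"
  show "\<bar>snd p $ i\<bar> \<le> M"
    using component_le_norm_cart[of "snd p" i] pq by auto
  have "\<bar>snd p $ i - snd q $ i\<bar> \<le> norm (snd p - snd q)"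
    using component_le_norm_cart[of "snd p - snd q" i] by simp
  also have "\<dots> \<le> 1 * norm (p - q)"
    using norm_snd_diff_le by simp
  finally show "\<bar>snd p $ i - snd q $ i\<bar> \<le> 1 * norm (p - q)" .
qed

text \<open>On a small ball the partial derivatives are bounded, and the ball is convex, so the mean
  value inequality applies. The exponent 0 in the bounds expresses plain boundedness.\<close>

lemma lip_bdd_power_series:
  fixes f :: "real ^ 'n::finite \<Rightarrow> real"
  assumes f: "power_series_at f 0 c"
  shows "\<forall>\<^sub>F \<rho> in at_right 0. lip_bdd (cball 0 \<rho>) f"
proof -
  obtain M where M: "M \<ge> 0" "\<forall>\<^sub>F x in nhds 0. \<bar>f x\<bar> \<le> M * norm x ^ 0"
    using power_series_bound[OF f, of 0] by auto
  obtain D where D: "D \<ge> 0" "\<forall>\<^sub>F x in nhds 0. \<forall>i. \<bar>partial i f x\<bar> \<le> D * norm x ^ 0"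
    using power_series_family_bound[of "\<lambda>i. partial i f" "\<lambda>i. dcoeff i c" 0] power_series_partial[OF f] by auto
  show ?thesis
    using eventually_small_cball[OF M(2)] eventually_small_cball[OF D(2)]
      eventually_small_cball[OF power_series_eventually_differentiable[OF f]]
  proof eventually_elim
    case (elim \<rho>)
    show ?case
    proof (rule lip_bddI)
      fix p q :: "real ^ 'n" assume pq: "p \<in> cball 0 \<rho>" "q \<in> cball 0 \<rho>"
      show "\<bar>f p\<bar> \<le> M"
        using elim(1) pq by auto
      have "norm (f p - f q) \<le> (real CARD('n) * (1 * D)) * norm (p - q)"
      proof (rule differentiable_bound)
        fix x assume x: "x \<in> cball (0::real ^ 'n) \<rho>"
        show "(f has_derivative (\<lambda>h. \<Sum>i\<in>UNIV. h $ i * partial i f x)) (at x within cball 0 \<rho>)"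
          by (rule has_derivative_at_withinI, rule elim(3)[rule_format, OF x])
        show "onorm (\<lambda>h. \<Sum>i\<in>UNIV. h $ i * partial i f x) \<le> real CARD('n) * (1 * D)"
        proof (rule onorm_le)
          fix h :: "real ^ 'n"
          have "\<bar>\<Sum>i\<in>UNIV. h $ i * partial i f x\<bar> \<le> real CARD('n) * (norm h * D)"
            using elim(2)[rule_format, OF x] component_le_norm_cart[of h] by (intro abs_sum_mult_le) simp_all
          then show "norm (\<Sum>i\<in>UNIV. h $ i * partial i f x) \<le> real CARD('n) * (1 * D) * norm h"
            by (simp add: mult_ac)
        qed
      qed (use pq in auto)
      then show "\<bar>f p - f q\<bar> \<le> (real CARD('n) * (1 * D)) * norm (p - q)"
        by simp
    qed
  qed
qed

lemma lip_bdd_vecD: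
  fixes F :: "'a::real_normed_vector \<Rightarrow> real ^ 'n::finite"
  assumes "\<And>i. lip_bdd S (\<lambda>p. F p $ i)"
  shows "\<exists>L\<ge>0. (\<forall>p\<in>S. norm (F p) \<le> L) \<and> (\<forall>p\<in>S. \<forall>q\<in>S. norm (F p - F q) \<le> L * norm (p - q))"
proof -
  have "\<exists>L\<ge>0. (\<forall>p\<in>S. \<bar>F p $ i\<bar> \<le> L) \<and> (\<forall>p\<in>S. \<forall>q\<in>S. \<bar>F p $ i - F q $ i\<bar> \<le> L * norm (p - q))" for i
    by (rule lip_bddD[OF assms])
  then obtain L where L: "\<And>i. L i \<ge> 0" "\<And>i p. p \<in> S \<Longrightarrow> \<bar>F p $ i\<bar> \<le> L i"
    "\<And>i p q. p \<in> S \<Longrightarrow> q \<in> S \<Longrightarrow> \<bar>F p $ i - F q $ i\<bar> \<le> L i * norm (p - q)"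
    by metis
  show ?thesis
  proof (intro exI[of _ "\<Sum>i\<in>UNIV. L i"] conjI ballI)
    show "(\<Sum>i\<in>UNIV. L i) \<ge> 0"
      using L(1) by (simp add: sum_nonneg)
    fix p assume p: "p \<in> S"
    show "norm (F p) \<le> (\<Sum>i\<in>UNIV. L i)"
      using L(2)[OF p] by (intro order_trans[OF norm_le_l1_cart] sum_mono) auto
    fix q assume q: "q \<in> S"
    show "norm (F p - F q) \<le> (\<Sum>i\<in>UNIV. L i) * norm (p - q)"
      unfolding sum_distrib_right
      using L(3)[OF p q] by (intro order_trans[OF norm_le_l1_cart] sum_mono) auto
  qed
qed

section \<open>Inverting the metric\<close>

lemma coercive_imp_invertible:
  fixes G :: "real ^ 'n ^ 'n"
  assumes "\<And>w. w \<noteq> 0 \<Longrightarrow> w \<bullet> (G *v w) > 0"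
  shows "G ** matrix_inv G = mat 1"
proof -
  have "\<forall>x. G *v x = 0 \<longrightarrow> x = 0"
    using assms by fastforce
  then have "invertible G"
    unfolding invertible_left_inverse matrix_left_invertible_ker .
  then have "\<exists>B. G ** B = mat 1 \<and> B ** G = mat 1"
    by (simp add: invertible_def)
  then show ?thesis
    unfolding matrix_inv_def by (rule someI2_ex) simp
qed

text \<open>No regularity of the matrix inverse is needed as a separate fact. The solutions
  \<open>y\<close> of \<open>G y = b\<close> satisfy
  \<open>G p (y p - y q) = (b p - b q) - (G p - G q) (y q)\<close>, and coercivity bounds a vector
  by twice the norm of its image under \<open>G p\<close>.\<close>

lemma lipschitz_matrix_inv_apply:
  fixes G :: "'a::real_normed_vector \<Rightarrow> real ^ 'n ^ 'n::finite" and b :: "'a \<Rightarrow> real ^ 'n"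
  assumes G: "\<And>i j. lip_bdd S (\<lambda>p. G p $ i $ j)" and b: "\<And>i. lip_bdd S (\<lambda>p. b p $ i)"
    and coer: "\<And>p w. p \<in> S \<Longrightarrow> (norm w)\<^sup>2 \<le> 2 * (w \<bullet> (G p *v w))"
  shows "\<exists>L. \<forall>p\<in>S. \<forall>q\<in>S.
     norm (matrix_inv (G p) *v b p - matrix_inv (G q) *v b q) \<le> L * norm (p - q)"
proof -
  define y where "y p = matrix_inv (G p) *v b p" for p
  have Gy: "G p *v y p = b p" if "p \<in> S" for p
  proof -
    have "w \<bullet> (G p *v w) > 0" if "w \<noteq> 0" for w
    proof -
      have "(norm w)\<^sup>2 > 0"
        using that by simp
      then show ?thesis
        using coer[OF \<open>p \<in> S\<close>, of w] by linarith
    qed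
    then show ?thesis
      by (simp add: y_def matrix_vector_mul_assoc coercive_imp_invertible)
  qed
  have est: "norm w \<le> 2 * norm (G p *v w)" if "p \<in> S" for p w
  proof (cases "w = 0")
    case False
    have "norm w * norm w \<le> 2 * (norm w * norm (G p *v w))"
      using coer[OF that, of w] norm_cauchy_schwarz[of w "G p *v w"] by (simp add: power2_eq_square)
    then have "norm w * norm w \<le> norm w * (2 * norm (G p *v w))"
      by simp
    then show ?thesis
      using False by simp
  qed simp
  obtain Lb where Lb: "Lb \<ge> 0" "\<And>p. p \<in> S \<Longrightarrow> norm (b p) \<le> Lb"
    "\<And>p q. p \<in> S \<Longrightarrow> q \<in> S \<Longrightarrow> norm (b p - b q) \<le> Lb * norm (p - q)"
    using lip_bdd_vecD[OF b] by blast
  have "\<exists>L\<ge>0. \<forall>p\<in>S. \<forall>q\<in>S. norm (G p $ i - G q $ i) \<le> L * norm (p - q)" for i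
    using lip_bdd_vecD[of S "\<lambda>p. G p $ i", OF G] by blast
  then obtain L where L: "\<And>i. L i \<ge> 0" "\<And>i p q. p \<in> S \<Longrightarrow> q \<in> S \<Longrightarrow> norm (G p $ i - G q $ i) \<le> L i * norm (p - q)"
    by metis
  define LG where "LG = (\<Sum>i\<in>UNIV. L i)"
  show ?thesis
  proof (intro exI[of _ "2 * (Lb + LG * (2 * Lb))"] ballI)
    fix p q assume pq: "p \<in> S" "q \<in> S"
    have "norm ((G p - G q) *v y q) \<le> (\<Sum>i\<in>UNIV. L i * norm (p - q) * norm (y q))"
    proof (intro order_trans[OF norm_le_l1_cart] sum_mono)
      fix i
      have "((G p - G q) *v y q) $ i = (G p $ i - G q $ i) \<bullet> y q"
        by (simp add: matrix_vector_mul_component)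
      then have "\<bar>((G p - G q) *v y q) $ i\<bar> \<le> norm (G p $ i - G q $ i) * norm (y q)"
        using Cauchy_Schwarz_ineq2 by simp
      also have "\<dots> \<le> L i * norm (p - q) * norm (y q)"
        by (intro mult_right_mono L pq) auto
      finally show "\<bar>((G p - G q) *v y q) $ i\<bar> \<le> L i * norm (p - q) * norm (y q)" .
    qed
    also have "\<dots> = LG * norm (p - q) * norm (y q)"
      by (simp add: LG_def sum_distrib_right)
    also have "\<dots> \<le> LG * norm (p - q) * (2 * Lb)"
    proof (intro mult_left_mono)
      show "norm (y q) \<le> 2 * Lb"
        using est[OF pq(2), of "y q"] Gy[OF pq(2)] Lb(2)[OF pq(2)] by simp
    qed (use L(1) in \<open>auto simp: LG_def sum_nonneg\<close>)
    finally have 1: "norm ((G p - G q) *v y q) \<le> LG * norm (p - q) * (2 * Lb)" .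
    have "G p *v (y p - y q) = (b p - b q) - (G p - G q) *v y q"
      by (simp add: matrix_vector_mult_diff_distrib matrix_vector_mult_diff_rdistrib Gy pq)
    then have "norm (G p *v (y p - y q)) \<le> Lb * norm (p - q) + LG * norm (p - q) * (2 * Lb)"
      using 1 Lb(3)[OF pq] norm_triangle_ineq4[of "b p - b q" "(G p - G q) *v y q"] by simp
    then have "2 * norm (G p *v (y p - y q)) \<le> 2 * (Lb * norm (p - q) + LG * norm (p - q) * (2 * Lb))"
      by (rule mult_left_mono) simp
    from order_trans[OF est[OF pq(1)] this]
    have "norm (y p - y q) \<le> 2 * (Lb * norm (p - q) + LG * norm (p - q) * (2 * Lb))" .
    then show "norm (matrix_inv (G p) *v b p - matrix_inv (G q) *v b q) \<le> 2 * (Lb + LG * (2 * Lb)) * norm (p - q)"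
      by (simp add: y_def algebra_simps)
  qed
qed

text \<open>The acceleration with its index lowered by the metric: a covector without the inverse
  metric, whose components are polynomial in \<open>v\<close>.\<close>

definition EL_force ::
    "(real ^ 'n \<Rightarrow> real ^ 'n ^ 'n) \<Rightarrow> (real ^ 'n \<Rightarrow> real ^ 'n) \<Rightarrow> (real ^ 'n::finite \<Rightarrow> real) \<Rightarrow>
     real ^ 'n \<Rightarrow> real ^ 'n \<Rightarrow> real ^ 'n" where
  "EL_force g \<sigma> U x v = (\<chi> l. - (\<Sum>i\<in>UNIV. \<Sum>j\<in>UNIV. 1 / 2 *
      (partial i (\<lambda>y. g y $ j $ l) x + partial j (\<lambda>y. g y $ i $ l) x
       - partial l (\<lambda>y. g y $ i $ j) x) * v $ i * v $ j)
     - partial l U x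
     - (\<Sum>i\<in>UNIV. v $ i * (partial i (\<lambda>y. \<sigma> y $ l) x - partial l (\<lambda>y. \<sigma> y $ i) x)))"

lemma EL_acceleration:
  "- christoffel g x v v - grad g U x - riesz (g x) (contract_d \<sigma> x v) = matrix_inv (g x) *v EL_force g \<sigma> U x v"
proof -
  have "EL_force g \<sigma> U x v = - (\<chi> l. \<Sum>i\<in>UNIV. \<Sum>j\<in>UNIV. 1 / 2 *
      (partial i (\<lambda>y. g y $ j $ l) x + partial j (\<lambda>y. g y $ i $ l) x
       - partial l (\<lambda>y. g y $ i $ j) x) * v $ i * v $ j) - (\<chi> l. partial l U x) - contract_d \<sigma> x v"
    by (simp add: EL_force_def contract_d_def vec_eq_iff)
  moreover have "A *v (- a - b - c) = - (A *v a) - A *v b - A *v c" for A :: "real ^ 'a ^ 'a" and a b c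
    using matrix_vector_mult_diff_distrib[of A 0 a] by (simp add: matrix_vector_mult_diff_distrib)
  ultimately show ?thesis
    unfolding christoffel_def grad_def riesz_def by simp
qed

lemma EL_field_lipschitz:
  assumes U: "\<And>i. lip_bdd (cball 0 \<rho>) (partial i U)"
    and g: "\<And>i j. lip_bdd (cball 0 \<rho>) (\<lambda>x. g x $ i $ j)"
    and dg: "\<And>i j k. lip_bdd (cball 0 \<rho>) (partial k (\<lambda>x. g x $ i $ j))"
    and d\<sigma>: "\<And>i j. lip_bdd (cball 0 \<rho>) (partial i (\<lambda>x. \<sigma> x $ j))"
    and coer: "\<And>x w. x \<in> cball 0 \<rho> \<Longrightarrow> (norm w)\<^sup>2 \<le> 2 * (w \<bullet> (g x *v w))"
  shows "\<exists>L. \<forall>p\<in>cball 0 \<rho> \<times> cball 0 M. \<forall>q\<in>cball 0 \<rho> \<times> cball 0 M.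
     norm ((snd p, matrix_inv (g (fst p)) *v EL_force g \<sigma> U (fst p) (snd p))
         - (snd q, matrix_inv (g (fst q)) *v EL_force g \<sigma> U (fst q) (snd q))) \<le> L * norm (p - q)"
proof -
  let ?S = "cball (0::real^'a) \<rho> \<times> cball (0::real^'a) M"
  have "\<exists>L. \<forall>p\<in>?S. \<forall>q\<in>?S.
     norm (matrix_inv (g (fst p)) *v EL_force g \<sigma> U (fst p) (snd p)
         - matrix_inv (g (fst q)) *v EL_force g \<sigma> U (fst q) (snd q)) \<le> L * norm (p - q)"
  proof (rule lipschitz_matrix_inv_apply[of ?S "\<lambda>p. g (fst p)" "\<lambda>p. EL_force g \<sigma> U (fst p) (snd p)"])
    show "lip_bdd ?S (\<lambda>p. g (fst p) $ i $ j)" for i j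
      by (rule lip_bdd_fst[OF g])
    show "lip_bdd ?S (\<lambda>p. EL_force g \<sigma> U (fst p) (snd p) $ i)" for i
      unfolding EL_force_def vec_lambda_beta
      by (intro lip_bdd_diff lip_bdd_minus lip_bdd_sum lip_bdd_mult lip_bdd_const lip_bdd_add
          lip_bdd_snd_nth lip_bdd_fst U dg d\<sigma>)
    show "(norm w)\<^sup>2 \<le> 2 * (w \<bullet> (g (fst p) *v w))" if "p \<in> ?S" for p w
      using that by (intro coer) auto
  qed
  then obtain L where L: "\<forall>p\<in>?S. \<forall>q\<in>?S.
     norm (matrix_inv (g (fst p)) *v EL_force g \<sigma> U (fst p) (snd p)
         - matrix_inv (g (fst q)) *v EL_force g \<sigma> U (fst q) (snd q)) \<le> L * norm (p - q)"
    by blast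
  show ?thesis
  proof (intro exI[of _ "1 + L"] ballI)
    fix p q assume pq: "p \<in> ?S" "q \<in> ?S"
    have "norm (snd p - snd q) \<le> norm (p - q)"
      by (rule norm_snd_diff_le)
    moreover have "norm ((snd p, a) - (snd q, b)) \<le> norm (snd p - snd q) + norm (a - b)" for a b :: "real ^ 'a"
      using norm_Pair_le[of "snd p - snd q" "a - b"] by simp
    ultimately show "norm ((snd p, matrix_inv (g (fst p)) *v EL_force g \<sigma> U (fst p) (snd p))
         - (snd q, matrix_inv (g (fst q)) *v EL_force g \<sigma> U (fst q) (snd q))) \<le> (1 + L) * norm (p - q)"
      unfolding distrib_right using L[rule_format, OF pq] by (smt (verit) mult_1)
  qed
qed

section \<open>Evolution of momentum and energy\<close>

lemma has_real_derivative_along_curve: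
  assumes f: "(f has_derivative (\<lambda>h. \<Sum>i\<in>UNIV. h $ i * F i)) (at (x t))"
    and x: "(x has_vector_derivative w) (at t within S)"
  shows "((\<lambda>s. f (x s)) has_real_derivative (\<Sum>i\<in>UNIV. w $ i * F i)) (at t within S)"
proof -
  have "((\<lambda>s. f (x s)) has_derivative (\<lambda>h. \<Sum>i\<in>UNIV. (h *\<^sub>R w) $ i * F i)) (at t within S)"
    by (rule has_derivative_compose[OF x[unfolded has_vector_derivative_def] f])
  also have "(\<lambda>h. \<Sum>i\<in>UNIV. (h *\<^sub>R w) $ i * F i) = (*) (\<Sum>i\<in>UNIV. w $ i * F i)"
    by (rule ext) (simp add: mult_ac flip: sum_distrib_left)
  finally show ?thesis
    unfolding has_field_derivative_def .
qed

lemma has_real_derivative_nth: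
  assumes "(v has_vector_derivative w) (at t within S)"
  shows "((\<lambda>s. v s $ i) has_real_derivative w $ i) (at t within S)"
  using bounded_linear.has_vector_derivative[OF bounded_linear_vec_nth assms]
  by (simp add: has_real_derivative_iff_has_vector_derivative)

text \<open>The covector \<open>(d/dt g) v\<close> along a curve with velocity \<open>v\<close>.\<close>

definition momentum_drift :: "(real ^ 'n \<Rightarrow> real ^ 'n ^ 'n) \<Rightarrow> real ^ 'n::finite \<Rightarrow> real ^ 'n \<Rightarrow> 'n \<Rightarrow> real" where
  "momentum_drift g x v l = (\<Sum>j\<in>UNIV. (\<Sum>k\<in>UNIV. v $ k * partial k (\<lambda>y. g y $ l $ j) x) * v $ j)"

text \<open>In the derivative of the momentum \<open>g v\<close> the factor \<open>g\<close> cancels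
  the inverse matrix of the equation of motion. Only the drift of the metric along the curve and the
  force remain.\<close>

lemma momentum_has_derivative:
  assumes g: "\<And>i j. ((\<lambda>y. g y $ i $ j) has_derivative
      (\<lambda>h. \<Sum>k\<in>UNIV. h $ k * partial k (\<lambda>y. g y $ i $ j) (x t))) (at (x t))"
    and inv: "g (x t) ** matrix_inv (g (x t)) = mat 1"
    and x: "(x has_vector_derivative v t) (at t within S)"
    and v: "(v has_vector_derivative matrix_inv (g (x t)) *v EL_force g \<sigma> U (x t) (v t)) (at t within S)"
  shows "((\<lambda>s. (g (x s) *v v s) $ l) has_real_derivative
      (momentum_drift g (x t) (v t) l + EL_force g \<sigma> U (x t) (v t) $ l)) (at t within S)"
proof -
  define b where "b = matrix_inv (g (x t)) *v EL_force g \<sigma> U (x t) (v t)"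
  have gb: "g (x t) *v b = EL_force g \<sigma> U (x t) (v t)"
    by (simp add: b_def matrix_vector_mul_assoc inv)
  have "((\<lambda>s. \<Sum>j\<in>UNIV. g (x s) $ l $ j * v s $ j) has_real_derivative
     (\<Sum>j\<in>UNIV. (\<Sum>k\<in>UNIV. v t $ k * partial k (\<lambda>y. g y $ l $ j) (x t)) * v t $ j + b $ j * g (x t) $ l $ j)) (at t within S)"
    by (intro DERIV_sum DERIV_mult has_real_derivative_along_curve[OF g x]
        has_real_derivative_nth[OF v[folded b_def]])
  moreover have "(\<Sum>j\<in>UNIV. (\<Sum>k\<in>UNIV. v t $ k * partial k (\<lambda>y. g y $ l $ j) (x t)) * v t $ j + b $ j * g (x t) $ l $ j)
     = momentum_drift g (x t) (v t) l + (g (x t) *v b) $ l"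
    unfolding sum.distrib momentum_drift_def by (simp add: matrix_vector_mult_def mult.commute)
  ultimately show ?thesis
    unfolding gb by (simp add: matrix_vector_mult_def)
qed

text \<open>After renaming summation indices, each of the three Christoffel sums equals the same
  cubic form \<open>T\<close>, so together they give half of \<open>T + T - T\<close>. The magnetic
  force does no work, because \<open>d\<sigma>\<close> is antisymmetric.\<close>

lemma power_balance:
  fixes g :: "real ^ 'n::finite \<Rightarrow> real ^ 'n ^ 'n"
  shows "(\<Sum>l\<in>UNIV. EL_force g \<sigma> U x v $ l * v $ l) =
     - (1/2) * (\<Sum>l\<in>UNIV. momentum_drift g x v l * v $ l) - (\<Sum>l\<in>UNIV. v $ l * partial l U x)"
proof -
  define a where "a k i j = partial k (\<lambda>y. g y $ i $ j) x" for k i j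
  define s where "s i j = partial i (\<lambda>y. \<sigma> y $ j) x" for i j
  define T where "T = (\<Sum>k\<in>UNIV. \<Sum>i\<in>UNIV. \<Sum>j\<in>UNIV. a k i j * v $ k * v $ i * v $ j)"
  have 1: "(\<Sum>l\<in>UNIV. \<Sum>i\<in>UNIV. \<Sum>j\<in>UNIV. a i j l * v $ i * v $ j * v $ l) = T"
    unfolding T_def
    by (subst sum.swap, rule sum.cong[OF refl], subst sum.swap, simp)
  have 2: "(\<Sum>l\<in>UNIV. \<Sum>i\<in>UNIV. \<Sum>j\<in>UNIV. a j i l * v $ i * v $ j * v $ l) = T"
  proof -
    have "(\<Sum>l\<in>UNIV. \<Sum>i\<in>UNIV. \<Sum>j\<in>UNIV. a j i l * v $ i * v $ j * v $ l) =
      (\<Sum>l\<in>UNIV. \<Sum>j\<in>UNIV. \<Sum>i\<in>UNIV. a j i l * v $ j * v $ i * v $ l)"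
      by (rule sum.cong[OF refl], subst sum.swap, simp add: mult_ac)
    then show ?thesis
      using 1 by simp
  qed
  have 3: "(\<Sum>l\<in>UNIV. \<Sum>i\<in>UNIV. \<Sum>j\<in>UNIV. a l i j * v $ i * v $ j * v $ l) = T"
    unfolding T_def by (simp add: mult_ac)
  have 4: "(\<Sum>l\<in>UNIV. momentum_drift g x v l * v $ l) = T"
  proof -
    have "(\<Sum>l\<in>UNIV. momentum_drift g x v l * v $ l) =
      (\<Sum>l\<in>UNIV. \<Sum>j\<in>UNIV. \<Sum>k\<in>UNIV. a k l j * v $ k * v $ l * v $ j)"
      by (simp add: momentum_drift_def a_def sum_distrib_right sum_distrib_left mult_ac)
    also have "\<dots> = (\<Sum>l\<in>UNIV. \<Sum>k\<in>UNIV. \<Sum>j\<in>UNIV. a k l j * v $ k * v $ l * v $ j)"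
      by (rule sum.cong[OF refl], rule sum.swap)
    also have "\<dots> = T"
      unfolding T_def by (rule sum.swap)
    finally show ?thesis .
  qed
  have 5: "(\<Sum>l\<in>UNIV. (\<Sum>i\<in>UNIV. v $ i * (s i l - s l i)) * v $ l) = 0"
  proof -
    have "(\<Sum>l\<in>UNIV. \<Sum>i\<in>UNIV. s i l * v $ i * v $ l) = (\<Sum>l\<in>UNIV. \<Sum>i\<in>UNIV. s l i * v $ i * v $ l)"
      by (subst sum.swap, simp add: mult_ac)
    then show ?thesis
      by (simp add: sum_distrib_right sum_distrib_left right_diff_distrib left_diff_distrib sum_subtractf mult_ac)
  qed
  have "(\<Sum>l\<in>UNIV. (\<Sum>i\<in>UNIV. \<Sum>j\<in>UNIV. 1 / 2 * (a i j l + a j i l - a l i j) * v $ i * v $ j) * v $ l)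
     = 1 / 2 * ((\<Sum>l\<in>UNIV. \<Sum>i\<in>UNIV. \<Sum>j\<in>UNIV. a i j l * v $ i * v $ j * v $ l)
        + (\<Sum>l\<in>UNIV. \<Sum>i\<in>UNIV. \<Sum>j\<in>UNIV. a j i l * v $ i * v $ j * v $ l)
        - (\<Sum>l\<in>UNIV. \<Sum>i\<in>UNIV. \<Sum>j\<in>UNIV. a l i j * v $ i * v $ j * v $ l))"
    by (simp add: sum_distrib_left sum_distrib_right sum.distrib[symmetric] sum_subtractf[symmetric] algebra_simps)
  then have 6: "(\<Sum>l\<in>UNIV. (\<Sum>i\<in>UNIV. \<Sum>j\<in>UNIV. 1 / 2 * (a i j l + a j i l - a l i j) * v $ i * v $ j) * v $ l)
     = 1 / 2 * T"
    unfolding 1 2 3 by simp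
  have "(\<Sum>l\<in>UNIV. EL_force g \<sigma> U x v $ l * v $ l) =
     - (\<Sum>l\<in>UNIV. (\<Sum>i\<in>UNIV. \<Sum>j\<in>UNIV. 1 / 2 * (a i j l + a j i l - a l i j) * v $ i * v $ j) * v $ l)
     - (\<Sum>l\<in>UNIV. v $ l * partial l U x) - (\<Sum>l\<in>UNIV. (\<Sum>i\<in>UNIV. v $ i * (s i l - s l i)) * v $ l)"
    unfolding EL_force_def vec_lambda_beta a_def[symmetric] s_def[symmetric] left_diff_distrib
      sum_subtractf by (simp add: sum_negf mult.commute[of _ "v $ _"])
  then show ?thesis
    unfolding 4 5 6 by simp
qed

text \<open>By symmetry of the metric, the term with the derivative of \<open>v\<close> equals the
  power of the force. The kinetic energy therefore changes at the rate of this power plus half of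
  the drift term, and \<open>power_balance\<close> cancels both against the change of
  \<open>U\<close>.\<close>

lemma energy_has_derivative_zero:
  assumes U: "(U has_derivative (\<lambda>h. \<Sum>i\<in>UNIV. h $ i * partial i U (x t))) (at (x t))"
    and g: "\<And>i j. ((\<lambda>y. g y $ i $ j) has_derivative
      (\<lambda>h. \<Sum>k\<in>UNIV. h $ k * partial k (\<lambda>y. g y $ i $ j) (x t))) (at (x t))"
    and inv: "g (x t) ** matrix_inv (g (x t)) = mat 1"
    and sym: "transpose (g (x t)) = g (x t)"
    and x: "(x has_vector_derivative v t) (at t within S)"
    and v: "(v has_vector_derivative matrix_inv (g (x t)) *v EL_force g \<sigma> U (x t) (v t)) (at t within S)"
  shows "((\<lambda>s. energy g U (x s, v s)) has_real_derivative 0) (at t within S)"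
proof -
  define b where "b = matrix_inv (g (x t)) *v EL_force g \<sigma> U (x t) (v t)"
  have gb: "g (x t) *v b = EL_force g \<sigma> U (x t) (v t)"
    by (simp add: b_def matrix_vector_mul_assoc inv)
  have "((\<lambda>s. 1 / 2 * (\<Sum>l\<in>UNIV. v s $ l * (g (x s) *v v s) $ l) + U (x s)) has_real_derivative
     1 / 2 * (\<Sum>l\<in>UNIV. b $ l * (g (x t) *v v t) $ l
       + (momentum_drift g (x t) (v t) l + EL_force g \<sigma> U (x t) (v t) $ l) * v t $ l)
       + (\<Sum>l\<in>UNIV. v t $ l * partial l U (x t))) (at t within S)"
    by (intro DERIV_add DERIV_cmult DERIV_sum DERIV_mult momentum_has_derivative[OF g inv x v]
      has_real_derivative_nth[OF v[folded b_def]] has_real_derivative_along_curve[OF U x])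
  moreover have "(\<Sum>l\<in>UNIV. b $ l * (g (x t) *v v t) $ l) = (\<Sum>l\<in>UNIV. EL_force g \<sigma> U (x t) (v t) $ l * v t $ l)"
  proof -
    have "b \<bullet> (g (x t) *v v t) = (g (x t) *v b) \<bullet> v t"
      using dot_lmul_matrix[of b "g (x t)" "v t"] sym by (metis transpose_matrix_vector)
    then show ?thesis
      unfolding gb by (simp add: inner_vec_def)
  qed
  ultimately show ?thesis
    unfolding sum.distrib distrib_right
    by (simp add: energy_def inner_vec_def power_balance)
qed

lemma energy_constant:
  assumes U: "\<And>x. x \<in> X \<Longrightarrow> (U has_derivative (\<lambda>h. \<Sum>i\<in>UNIV. h $ i * partial i U x)) (at x)"
    and g: "\<And>i j x. x \<in> X \<Longrightarrow> ((\<lambda>y. g y $ i $ j) has_derivative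
      (\<lambda>h. \<Sum>k\<in>UNIV. h $ k * partial k (\<lambda>y. g y $ i $ j) x)) (at x)"
    and inv: "\<And>x. x \<in> X \<Longrightarrow> g x ** matrix_inv (g x) = mat 1"
    and sym: "\<And>x. x \<in> X \<Longrightarrow> transpose (g x) = g x"
    and X: "\<And>t. t \<in> {0..T} \<Longrightarrow> x t \<in> X"
    and x: "\<And>t. t \<in> {0..T} \<Longrightarrow> (x has_vector_derivative v t) (at t within {0..T})"
    and v: "\<And>t. t \<in> {0..T} \<Longrightarrow> (v has_vector_derivative matrix_inv (g (x t)) *v EL_force g \<sigma> U (x t) (v t)) (at t within {0..T})"
    and t: "t \<in> {0..T}"
  shows "energy g U (x t, v t) = energy g U (x 0, v 0)"
proof -
  have "\<exists>c. \<forall>t\<in>{0..T}. energy g U (x t, v t) = c"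
  proof (rule has_field_derivative_zero_constant)
    fix t assume t: "t \<in> {0..T}"
    show "((\<lambda>t. energy g U (x t, v t)) has_real_derivative 0) (at t within {0..T})"
      by (rule energy_has_derivative_zero[OF U g inv sym x v]) (use X t in auto)
  qed simp
  with t show ?thesis
    by force
qed

section \<open>Growth of the Lyapunov function\<close>

text \<open>The left-hand side is the derivative of the Lyapunov function. Its kinetic part and the
  two pairings with the gradient of \<open>U\<close> are kept exactly; the rest is \<open>R\<close>
  and carries a factor \<open>r\<close> from \<open>Z\<close> or from \<open>D\<close>. Here
  \<open>d\<close> is the order of the derivatives of \<open>\<sigma>\<close>. In \<open>K\<close>,
  the number 5/2 is 1 from the metric drift plus 3/2 from the Christoffel terms, and 2 comes from
  the two halves of \<open>d\<sigma>\<close>.\<close>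

lemma lyapunov_rate_estimate:
  fixes g :: "real ^ 'n::finite \<Rightarrow> real ^ 'n ^ 'n" and w :: "'n \<Rightarrow> real"
  assumes A: "A \<ge> 0" and M: "M \<ge> 0"
    and g: "\<And>i j. \<bar>g x $ i $ j\<bar> \<le> M"
    and dg: "\<And>i j k. \<bar>partial k (\<lambda>y. g y $ i $ j) x\<bar> \<le> M"
    and d\<sigma>: "\<And>i j. \<bar>partial i (\<lambda>y. \<sigma> y $ j) x\<bar> \<le> M * norm x ^ d"
    and w: "\<And>l. \<bar>w l\<bar> \<le> M * norm x"
    and D: "\<And>l j. \<bar>D l j\<bar> \<le> M * norm x"
    and N: "N = real CARD('n)"
    and K: "K = N * (A * N\<^sup>2 * M\<^sup>2 + (1 + A * M) * (5 / 2 * N\<^sup>2 * M) + (1 + A * M) * (2 * N * M))"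
  shows "(\<Sum>l\<in>UNIV. (v $ l - A * (\<Sum>j\<in>UNIV. v $ j * D l j)) * (g x *v v) $ l
      + (momentum_drift g x v l + EL_force g \<sigma> U x v $ l) * (x $ l - A * w l))
    \<ge> v \<bullet> (g x *v v) - (\<Sum>l\<in>UNIV. x $ l * partial l U x) + A * (\<Sum>l\<in>UNIV. w l * partial l U x)
      - K * (norm x * (norm v)\<^sup>2 + norm x * (norm x ^ d * norm v))"
proof -
  define r where "r = norm x"
  define u where "u = norm v"
  define p where "p l = (g x *v v) $ l" for l
  define G where "G = momentum_drift g x v"
  define a where "a k i j = partial k (\<lambda>y. g y $ i $ j) x" for k i j
  define s where "s i j = partial i (\<lambda>y. \<sigma> y $ j) x" for i j
  define \<Gamma> where "\<Gamma> l = (\<Sum>i\<in>UNIV. \<Sum>j\<in>UNIV. 1 / 2 * (a i j l + a j i l - a l i j) * v $ i * v $ j)" for l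
  define B where "B l = (\<Sum>i\<in>UNIV. v $ i * (s i l - s l i))" for l
  define Z where "Z l = x $ l - A * w l" for l
  define R where "R l = (G l - \<Gamma> l - B l) * Z l - A * (\<Sum>j\<in>UNIV. v $ j * D l j) * p l" for l
  have r: "r \<ge> 0" and u: "u \<ge> 0" and N0: "N \<ge> 0"
    by (auto simp: r_def u_def N)
  have vle: "\<bar>v $ i\<bar> \<le> u" for i
    using component_le_norm_cart[of v i] by (simp add: u_def)
  have p: "\<bar>p l\<bar> \<le> N * (M * u)" for l
    unfolding p_def N matrix_vector_mult_def vec_lambda_beta by (rule abs_sum_mult_le[OF g vle])
  have vD: "\<bar>\<Sum>j\<in>UNIV. v $ j * D l j\<bar> \<le> N * (u * (M * r))" for l
    unfolding N using D by (intro abs_sum_mult_le[OF vle]) (simp add: r_def)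
  have G: "\<bar>G l\<bar> \<le> N\<^sup>2 * M * u\<^sup>2" for l
  proof -
    have "\<bar>\<Sum>k\<in>UNIV. v $ k * a k l j\<bar> \<le> N * (u * M)" for j
      unfolding N a_def by (rule abs_sum_mult_le[OF vle dg])
    then have "\<bar>G l\<bar> \<le> N * (N * (u * M) * u)"
      unfolding G_def momentum_drift_def N a_def by (intro abs_sum_mult_le[OF _ vle])
    then show ?thesis
      by (simp add: power2_eq_square mult_ac)
  qed
  have \<Gamma>: "\<bar>\<Gamma> l\<bar> \<le> 3 / 2 * N\<^sup>2 * M * u\<^sup>2" for l
  proof -
    have "\<bar>a i j l + a j i l - a l i j\<bar> \<le> 3 * M" for i j
      using dg[where k = i and i = j and j = l] dg[where k = j and i = i and j = l]
        dg[where k = l and i = i and j = j] unfolding a_def by linarith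
    then have "\<bar>1 / 2 * (a i j l + a j i l - a l i j)\<bar> \<le> 3 / 2 * M" for i j
      unfolding abs_mult by simp
    then have "\<bar>\<Sum>j\<in>UNIV. 1 / 2 * (a i j l + a j i l - a l i j) * v $ j\<bar> \<le> N * (3 / 2 * M * u)" for i
      unfolding N by (intro abs_sum_mult_le[OF _ vle])
    then have "\<bar>\<Sum>i\<in>UNIV. v $ i * (\<Sum>j\<in>UNIV. 1 / 2 * (a i j l + a j i l - a l i j) * v $ j)\<bar> \<le> N * (u * (N * (3 / 2 * M * u)))"
      unfolding N by (intro abs_sum_mult_le[OF vle])
    moreover have "\<Gamma> l = (\<Sum>i\<in>UNIV. v $ i * (\<Sum>j\<in>UNIV. 1 / 2 * (a i j l + a j i l - a l i j) * v $ j))"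
      unfolding \<Gamma>_def sum_distrib_left by (intro sum.cong refl) simp
    ultimately show ?thesis
      by (simp add: power2_eq_square mult_ac)
  qed
  have B: "\<bar>B l\<bar> \<le> 2 * N * M * (r ^ d * u)" for l
  proof -
    have "\<bar>s i l - s l i\<bar> \<le> 2 * (M * r ^ d)" for i
      using d\<sigma>[where i = i and j = l] d\<sigma>[where i = l and j = i] unfolding s_def r_def by linarith
    then have "\<bar>B l\<bar> \<le> N * (u * (2 * (M * r ^ d)))"
      unfolding B_def N by (intro abs_sum_mult_le[OF vle])
    then show ?thesis
      by (simp add: mult_ac)
  qed
  have Z: "\<bar>Z l\<bar> \<le> (1 + A * M) * r" for l
  proof -
    have "\<bar>A * w l\<bar> \<le> A * (M * r)"
      using w[of l] A by (simp add: abs_mult mult_left_mono r_def)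
    then show ?thesis
      using component_le_norm_cart[of x l] unfolding Z_def r_def[symmetric] by (simp add: algebra_simps)
  qed
  have Rl: "\<bar>R l\<bar> \<le> (A * N\<^sup>2 * M\<^sup>2 + (1 + A * M) * (5 / 2 * N\<^sup>2 * M) + (1 + A * M) * (2 * N * M))
      * (r * u\<^sup>2 + r * (r ^ d * u))" for l
  proof -
    have "\<bar>G l - \<Gamma> l - B l\<bar> \<le> 5 / 2 * N\<^sup>2 * M * u\<^sup>2 + 2 * N * M * (r ^ d * u)"
      using G[of l] \<Gamma>[of l] B[of l] by linarith
    then have 1: "\<bar>(G l - \<Gamma> l - B l) * Z l\<bar> \<le> (5 / 2 * N\<^sup>2 * M * u\<^sup>2 + 2 * N * M * (r ^ d * u)) * ((1 + A * M) * r)"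
      unfolding abs_mult using Z[of l] N0 M r u by (intro mult_mono) auto
    have "\<bar>A * (\<Sum>j\<in>UNIV. v $ j * D l j) * p l\<bar> \<le> (A * (N * (u * (M * r)))) * (N * (M * u))"
      unfolding abs_mult using vD[of l] p[of l] A N0 M r u by (intro mult_mono) auto
    then have 2: "\<bar>A * (\<Sum>j\<in>UNIV. v $ j * D l j) * p l\<bar> \<le> A * N\<^sup>2 * M\<^sup>2 * (r * u\<^sup>2)"
      by (simp add: power2_eq_square mult_ac)
    \<comment> \<open>Multiplying the total coefficient by both orders creates cross terms that do
      not occur in the bounds 1 and 2; they are nonnegative and can be added.\<close>
    have "0 \<le> (A * N\<^sup>2 * M\<^sup>2 + (1 + A * M) * (5 / 2 * N\<^sup>2 * M)) * (r * (r ^ d * u))"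
         "0 \<le> (1 + A * M) * (2 * N * M) * (r * u\<^sup>2)"
      using A M N0 r u by simp_all
    moreover have "(A * N\<^sup>2 * M\<^sup>2 + (1 + A * M) * (5 / 2 * N\<^sup>2 * M) + (1 + A * M) * (2 * N * M)) * (r * u\<^sup>2 + r * (r ^ d * u))
       = (5 / 2 * N\<^sup>2 * M * u\<^sup>2 + 2 * N * M * (r ^ d * u)) * ((1 + A * M) * r) + A * N\<^sup>2 * M\<^sup>2 * (r * u\<^sup>2)
         + (A * N\<^sup>2 * M\<^sup>2 + (1 + A * M) * (5 / 2 * N\<^sup>2 * M)) * (r * (r ^ d * u)) + (1 + A * M) * (2 * N * M) * (r * u\<^sup>2)"
      by (simp add: field_simps)
    moreover have "\<bar>R l\<bar> \<le> \<bar>(G l - \<Gamma> l - B l) * Z l\<bar> + \<bar>A * (\<Sum>j\<in>UNIV. v $ j * D l j) * p l\<bar>"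
      unfolding R_def by (rule abs_triangle_ineq4)
    ultimately show ?thesis
      using 1 2 by linarith
  qed
  have "\<bar>\<Sum>l\<in>UNIV. R l\<bar> \<le> (\<Sum>l\<in>UNIV. \<bar>R l\<bar>)"
    by (rule sum_abs)
  also have "\<dots> \<le> (\<Sum>l\<in>(UNIV::'n set). (A * N\<^sup>2 * M\<^sup>2 + (1 + A * M) * (5 / 2 * N\<^sup>2 * M) + (1 + A * M) * (2 * N * M))
      * (r * u\<^sup>2 + r * (r ^ d * u)))"
    by (intro sum_mono Rl)
  also have "\<dots> = K * (r * u\<^sup>2 + r * (r ^ d * u))"
    by (simp add: K N)
  finally have R: "\<bar>\<Sum>l\<in>UNIV. R l\<bar> \<le> K * (r * u\<^sup>2 + r * (r ^ d * u))" .
  have F: "EL_force g \<sigma> U x v $ l = - \<Gamma> l - partial l U x - B l" for l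
    by (simp add: EL_force_def \<Gamma>_def B_def a_def s_def)
  have "(v $ l - A * (\<Sum>j\<in>UNIV. v $ j * D l j)) * p l + (G l + EL_force g \<sigma> U x v $ l) * Z l
      = v $ l * p l - x $ l * partial l U x + A * (w l * partial l U x) + R l" for l
    unfolding F R_def by (simp add: Z_def algebra_simps)
  then have "(\<Sum>l\<in>UNIV. (v $ l - A * (\<Sum>j\<in>UNIV. v $ j * D l j)) * p l + (G l + EL_force g \<sigma> U x v $ l) * Z l)
      = v \<bullet> (g x *v v) - (\<Sum>l\<in>UNIV. x $ l * partial l U x) + A * (\<Sum>l\<in>UNIV. w l * partial l U x) + (\<Sum>l\<in>UNIV. R l)"
    by (simp add: sum.distrib sum_subtractf sum_distrib_left inner_vec_def p_def)
  then show ?thesis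
    using R unfolding p_def G_def Z_def r_def u_def by linarith
qed

text \<open>Here \<open>a\<close> stands for \<open>v \<bullet> g v\<close>. The inequality
  \<open>r ^ d * u \<le> r ^ (2 * d) + u\<^sup>2\<close> splits the magnetic error. The pure power
  of \<open>r\<close> is covered by \<open>radial\<close>; the two copies of
  \<open>r * u\<^sup>2\<close> cost at most \<open>4 * K * r * a\<close>, hence at most
  \<open>a / 2\<close> by the smallness of \<open>r\<close>.\<close>

lemma lyapunov_rate_lower_bound:
  fixes a u r K U h X Y A :: real
  assumes rate: "V \<ge> a - X + A * Y - K * (r * u\<^sup>2 + r * (r ^ d * u))"
    and coer: "u\<^sup>2 \<le> 2 * a" and r: "0 \<le> r" "r \<le> 1" and u: "u \<ge> 0"
    and K: "K \<ge> 0" "8 * K * r \<le> 1"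
    and radial: "K * r ^ e \<le> A * Y - (X - real l1 * U)"
    and e: "e \<le> 2 * d + 1" and l1: "l1 \<ge> 1" and h: "h = a / 2 + U" "h < 0"
  shows "V \<ge> - h"
proof -
  have a: "a \<ge> 0"
    using coer zero_le_power2[of u] by linarith
  have "0 \<le> r ^ d * u"
    using r u by simp
  then have "r ^ d * u \<le> (r ^ d)\<^sup>2 + u\<^sup>2"
    using sum_squares_bound[of "r ^ d" u] by linarith
  then have "r ^ d * u \<le> r ^ (2 * d) + u\<^sup>2"
    by (simp add: power_mult[symmetric] mult.commute)
  then have "r * (r ^ d * u) \<le> r * (r ^ (2 * d) + u\<^sup>2)"
    using r by (intro mult_left_mono)
  also have "\<dots> = r ^ (2 * d + 1) + r * u\<^sup>2"
    by (simp add: algebra_simps)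
  also have "r ^ (2 * d + 1) \<le> r ^ e"
    using r e by (intro power_decreasing) auto
  finally have "r * u\<^sup>2 + r * (r ^ d * u) \<le> r ^ e + 2 * (r * u\<^sup>2)"
    by simp
  also have "r * u\<^sup>2 \<le> r * (2 * a)"
    using r coer by (intro mult_left_mono)
  finally have "K * (r * u\<^sup>2 + r * (r ^ d * u)) \<le> K * (r ^ e + 2 * (r * (2 * a)))"
    using K(1) by (intro mult_left_mono) auto
  also have "\<dots> = K * r ^ e + (8 * K * r) * (a / 2)"
    by (simp add: algebra_simps)
  also have "(8 * K * r) * (a / 2) \<le> 1 * (a / 2)"
    using K(2) a by (intro mult_right_mono) auto
  finally have 1: "K * (r * u\<^sup>2 + r * (r ^ d * u)) \<le> K * r ^ e + a / 2"
    by simp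
  \<comment> \<open>Negative energy and \<open>a \<ge> 0\<close> force \<open>U < 0\<close>, so
    lowering the factor \<open>l1\<close> to 1 increases the product.\<close>
  have "real l1 * U \<le> 1 * U"
    using l1 h a by (intro mult_right_mono_neg) auto
  then show ?thesis
    using 1 rate radial h a unfolding mult_1_left by linarith
qed

text \<open>Confinement to the ball is assumed for contradiction and used first to continue the
  solution up to time \<open>T\<close>; the growth of \<open>V\<close> then refutes it. The phase
  region is the closed ball in position times the ball of radius 2 in velocity.\<close>

lemma escape_from_ball:
  fixes g :: "real ^ 'n::finite \<Rightarrow> real ^ 'n ^ 'n" and w :: "'n \<Rightarrow> real ^ 'n \<Rightarrow> real"
  assumes \<rho>: "\<rho> > 0" "\<rho> \<le> 1" "cball 0 \<rho> \<subseteq> W"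
    and U0: "U 0 = 0" and U1: "\<And>x. x \<in> cball 0 \<rho> \<Longrightarrow> \<bar>U x\<bar> < 1"
    and dU: "\<And>x. x \<in> cball 0 \<rho> \<Longrightarrow> (U has_derivative (\<lambda>h. \<Sum>i\<in>UNIV. h $ i * partial i U x)) (at x)"
    and dg: "\<And>i j x. x \<in> cball 0 \<rho> \<Longrightarrow> ((\<lambda>y. g y $ i $ j) has_derivative
      (\<lambda>h. \<Sum>k\<in>UNIV. h $ k * partial k (\<lambda>y. g y $ i $ j) x)) (at x)"
    and sym: "\<And>x. x \<in> cball 0 \<rho> \<Longrightarrow> transpose (g x) = g x"
    and coer: "\<And>x w. x \<in> cball 0 \<rho> \<Longrightarrow> (norm w)\<^sup>2 \<le> 2 * (w \<bullet> (g x *v w))"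
    and lipU: "\<And>i. lip_bdd (cball 0 \<rho>) (partial i U)"
    and lipg: "\<And>i j. lip_bdd (cball 0 \<rho>) (\<lambda>x. g x $ i $ j)"
    and lipdg: "\<And>i j k. lip_bdd (cball 0 \<rho>) (partial k (\<lambda>x. g x $ i $ j))"
    and lip\<sigma>: "\<And>i j. lip_bdd (cball 0 \<rho>) (partial i (\<lambda>x. \<sigma> x $ j))"
    and A: "A \<ge> 0" and M: "M \<ge> 0"
    and gM: "\<And>i j x. x \<in> cball 0 \<rho> \<Longrightarrow> \<bar>g x $ i $ j\<bar> \<le> M"
    and dw: "\<And>l x. x \<noteq> 0 \<Longrightarrow> (w l has_derivative (\<lambda>h. \<Sum>j\<in>UNIV. h $ j * D l j x)) (at x)"
    and wM: "\<And>l x. x \<in> cball 0 \<rho> \<Longrightarrow> x \<noteq> 0 \<Longrightarrow> \<bar>w l x\<bar> \<le> M * norm x"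
    and rate: "\<And>x v. x \<in> cball 0 \<rho> \<Longrightarrow> x \<noteq> 0 \<Longrightarrow> energy g U (x, v) < 0 \<Longrightarrow>
      - energy g U (x, v) \<le> (\<Sum>l\<in>UNIV. (v $ l - A * (\<Sum>j\<in>UNIV. v $ j * D l j x)) * (g x *v v) $ l
      + (momentum_drift g x v l + EL_force g \<sigma> U x v $ l) * (x $ l - A * w l x))"
  shows "totally_unstable W g \<sigma> U 0"
  unfolding totally_unstable_def
proof (intro exI[of _ "ball 0 \<rho>"] conjI ballI impI)
  show "open (ball (0::real^'n) \<rho>)" "0 \<in> ball (0::real^'n) \<rho>" "ball 0 \<rho> \<subseteq> W"
    using \<rho> ball_subset_cball by auto
  fix z assume z: "z \<in> ball 0 \<rho> \<times> (UNIV :: (real ^ 'n) set)" and neg: "energy g U z < 0"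
  show "\<not> positive_orbit W g \<sigma> U z \<subseteq> ball 0 \<rho> \<times> UNIV"
  proof
    assume stay: "positive_orbit W g \<sigma> U z \<subseteq> ball 0 \<rho> \<times> UNIV"
    define S where "S = cball (0::real^'n) \<rho> \<times> cball (0::real^'n) 2"
    define F where "F p = (snd p, matrix_inv (g (fst p)) *v EL_force g \<sigma> U (fst p) (snd p))" for p
    have inv: "g x ** matrix_inv (g x) = mat 1" if "x \<in> cball 0 \<rho>" for x
    proof (rule coercive_imp_invertible)
      fix w :: "real ^ 'n" assume "w \<noteq> 0"
      then have "(norm w)\<^sup>2 > 0" by simp
      then show "w \<bullet> (g x *v w) > 0"
        using coer[OF that, of w] by linarith
    qed
    \<comment> \<open>Negative energy and \<open>\<bar>U x\<bar> < 1\<close> give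
      \<open>v \<bullet> (g x *v v) < 2\<close>, and coercivity then bounds the squared speed by
      4.\<close>
    have speed: "norm v < 2" if "x \<in> cball 0 \<rho>" "energy g U (x, v) < 0" for x v
    proof (rule power2_less_imp_less)
      have "v \<bullet> (g x *v v) < 2"
        using that(2) U1[OF that(1)] by (simp add: energy_def)
      then show "(norm v)\<^sup>2 < 2\<^sup>2"
        using coer[OF that(1), of v] by simp
    qed simp
    have "\<exists>L. \<forall>p\<in>S. \<forall>q\<in>S. norm (F p - F q) \<le> L * norm (p - q)"
      unfolding S_def F_def by (rule EL_field_lipschitz[OF lipU lipg lipdg lip\<sigma> coer])
    then obtain L where L: "\<forall>p\<in>S. \<forall>q\<in>S. norm (F p - F q) \<le> L * norm (p - q)"
      by blast
    have curve: "((\<lambda>s. fst (\<phi> s)) has_vector_derivative snd (\<phi> t)) (at t within {0..\<tau>})"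
      "((\<lambda>s. snd (\<phi> s)) has_vector_derivative matrix_inv (g (fst (\<phi> t))) *v EL_force g \<sigma> U (fst (\<phi> t)) (snd (\<phi> t))) (at t within {0..\<tau>})"
      if "(\<phi> has_vector_derivative F (\<phi> t)) (at t within {0..\<tau>})" for \<phi> t \<tau>
      using bounded_linear.has_vector_derivative[OF bounded_linear_fst that]
        bounded_linear.has_vector_derivative[OF bounded_linear_snd that] by (simp_all add: F_def)
    have conserved: "energy g U (\<phi> t) = energy g U z"
      if "\<phi> 0 = z" "\<And>t. t \<in> {0..\<tau>} \<Longrightarrow> \<phi> t \<in> S"
        "\<And>t. t \<in> {0..\<tau>} \<Longrightarrow> (\<phi> has_vector_derivative F (\<phi> t)) (at t within {0..\<tau>})" "t \<in> {0..\<tau>}" for \<phi> \<tau> t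
    proof -
      have "energy g U (fst (\<phi> t), snd (\<phi> t)) = energy g U (fst (\<phi> 0), snd (\<phi> 0))"
      proof (rule energy_constant[OF dU dg inv sym])
        show "fst (\<phi> s) \<in> cball 0 \<rho>" if "s \<in> {0..\<tau>}" for s
          using \<open>\<And>t. t \<in> {0..\<tau>} \<Longrightarrow> \<phi> t \<in> S\<close>[OF that] by (auto simp: S_def)
      qed (rule curve curve(1) that | assumption)+
      then show ?thesis
        using that(1) by simp
    qed
    define h where "h = - energy g U z"
    have h: "h > 0"
      using neg by (simp add: h_def)
    define N where "N = real CARD('n)"
    define Vb where "Vb = N * (N * (M * 2) * (1 + A * M))"
    \<comment> \<open>Growth at rate \<open>h\<close> during this time exceeds
      \<open>2 * Vb\<close>, the largest variation compatible with the bound on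
      \<open>V\<close>.\<close>
    define T where "T = (2 * Vb + 1) / h"
    have Vb: "Vb \<ge> 0"
      using A M by (simp add: Vb_def N_def)
    have T: "T > 0"
      using Vb h by (simp add: T_def)
    have "z \<in> S"
      using z speed[of "fst z" "snd z"] neg by (auto simp: S_def less_imp_le)
    obtain \<phi> where \<phi>: "\<phi> 0 = z" "\<And>t. t \<in> {0..T} \<Longrightarrow> \<phi> t \<in> S"
      "\<And>t. t \<in> {0..T} \<Longrightarrow> (\<phi> has_vector_derivative F (\<phi> t)) (at t within {0..T})"
    proof (rule ode_solution_in_invariant_set[of S F L z T])
      show "convex S" "closed S"
        by (auto simp: S_def intro!: convex_Times closed_Times)
      show "norm (F p - F q) \<le> L * norm (p - q)" if "p \<in> S" "q \<in> S" for p q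
        using L that by blast
      show "z \<in> S" "T \<ge> 0"
        using \<open>z \<in> S\<close> T by auto
      fix \<tau> \<phi>
      assume \<tau>: "\<tau> \<ge> 0" and 0: "\<phi> 0 = z" and inS: "\<And>t. t \<in> {0..\<tau>} \<Longrightarrow> \<phi> t \<in> S"
        and sol: "\<And>t. t \<in> {0..\<tau>} \<Longrightarrow> (\<phi> has_vector_derivative F (\<phi> t)) (at t within {0..\<tau>})"
      \<comment> \<open>Every partial solution contributes its endpoint to
        \<open>positive_orbit\<close>, so the assumed confinement puts its position strictly inside
        the ball. Conservation of energy puts its speed strictly below 2, and the endpoint is
        interior to \<open>S\<close>.\<close>
      have "EL_solution W g \<sigma> U \<tau> (\<lambda>s. fst (\<phi> s)) (\<lambda>s. snd (\<phi> s))"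
        unfolding EL_solution_def EL_acceleration
      proof (intro ballI conjI)
        fix t assume t: "t \<in> {0..\<tau>}"
        show "fst (\<phi> t) \<in> W"
          using inS[OF t] \<rho>(3) by (auto simp: S_def)
      qed (rule curve sol | assumption)+
      then have "(fst (\<phi> \<tau>), snd (\<phi> \<tau>)) \<in> positive_orbit W g \<sigma> U z"
        unfolding positive_orbit_def using \<tau> 0
        by (intro CollectI exI[of _ "\<lambda>s. fst (\<phi> s)"] exI[of _ "\<lambda>s. snd (\<phi> s)"] exI[of _ \<tau>]) simp
      then have 1: "fst (\<phi> \<tau>) \<in> ball 0 \<rho>"
        using stay by blast
      have "energy g U (\<phi> \<tau>) < 0"
        using conserved[OF 0 inS sol, of \<tau>] \<tau> neg by simp
      then have "norm (snd (\<phi> \<tau>)) < 2"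
        using speed[of "fst (\<phi> \<tau>)" "snd (\<phi> \<tau>)"] 1 by simp
      with 1 show "\<phi> \<tau> \<in> interior S"
        by (auto simp: S_def interior_Times interior_cball mem_Times_iff)
    qed blast
    define x where "x t = fst (\<phi> t)" for t
    define v where "v t = snd (\<phi> t)" for t
    have x: "x t \<in> cball 0 \<rho>" and v: "norm (v t) \<le> 2" if "t \<in> {0..T}" for t
      using \<phi>(2)[OF that] by (auto simp: S_def x_def v_def mem_Times_iff)
    have en: "energy g U (x t, v t) = - h" if "t \<in> {0..T}" for t
      using conserved[OF \<phi> that] by (simp add: x_def v_def h_def)
    \<comment> \<open>At the origin the energy would be purely kinetic, hence nonnegative. The curve
      thus stays where the functions \<open>w l\<close> are differentiable.\<close>
    have x0: "x t \<noteq> 0" if "t \<in> {0..T}" for t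
    proof
      assume "x t = 0"
      then have "U (x t) = 0"
        using U0 by simp
      moreover have "1 / 2 * (v t \<bullet> (g (x t) *v v t)) + U (x t) = - h"
        using en[OF that] unfolding energy_def prod.case .
      ultimately show False
        using h coer[OF x[OF that], of "v t"] zero_le_power2[of "norm (v t)"] by linarith
    qed
    define V where "V t = (\<Sum>l\<in>UNIV. (x t $ l - A * w l (x t)) * (g (x t) *v v t) $ l)" for t
    define V' where "V' t = (\<Sum>l\<in>UNIV. (v t $ l - A * (\<Sum>j\<in>UNIV. v t $ j * D l j (x t))) * (g (x t) *v v t) $ l
      + (momentum_drift g (x t) (v t) l + EL_force g \<sigma> U (x t) (v t) $ l) * (x t $ l - A * w l (x t)))" for t
    have der: "(V has_real_derivative V' t) (at t within {0..T})" if t: "t \<in> {0..T}" for t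
    proof -
      have xv: "(x has_vector_derivative v t) (at t within {0..T})"
        "(v has_vector_derivative matrix_inv (g (x t)) *v EL_force g \<sigma> U (x t) (v t)) (at t within {0..T})"
        using curve[OF \<phi>(3)[OF t]] unfolding x_def[abs_def] v_def[abs_def] .
      show ?thesis
        unfolding V_def[abs_def] V'_def
        by (intro DERIV_sum DERIV_mult DERIV_diff DERIV_cmult has_real_derivative_nth[OF xv(1)]
            has_real_derivative_along_curve[OF dw[OF x0[OF t]] xv(1)]
            momentum_has_derivative[OF dg inv xv] x t)
    qed
    have V'_ge: "V' t \<ge> h" if "t \<in> {0..T}" for t
      using rate[OF x[OF that] x0[OF that], of "v t"] en[OF that] h unfolding V'_def by simp
    have V_le: "\<bar>V t\<bar> \<le> Vb" if t: "t \<in> {0..T}" for t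
    proof -
      have nx: "norm (x t) \<le> 1"
        using x[OF t] \<rho>(2) by simp
      have p: "\<bar>(g (x t) *v v t) $ l\<bar> \<le> N * (M * 2)" for l
        unfolding N_def matrix_vector_mult_def vec_lambda_beta
      proof (rule abs_sum_mult_le[OF gM[OF x[OF t]]])
        show "\<bar>v t $ i\<bar> \<le> 2" for i
          using component_le_norm_cart[of "v t" i] v[OF t] by linarith
      qed
      have "\<bar>x t $ l - A * w l (x t)\<bar> \<le> 1 + A * M" for l
      proof -
        have "M * norm (x t) \<le> M * 1"
          using nx M by (intro mult_left_mono)
        then have "\<bar>w l (x t)\<bar> \<le> M"
          using wM[OF x[OF t] x0[OF t], of l] by simp
        then have "\<bar>A * w l (x t)\<bar> \<le> A * M"
          using A by (simp add: abs_mult mult_left_mono)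
        then show ?thesis
          using component_le_norm_cart[of "x t" l] nx by linarith
      qed
      then have "\<bar>V t\<bar> \<le> N * ((1 + A * M) * (N * (M * 2)))"
        unfolding V_def N_def using p[unfolded N_def] by (rule abs_sum_mult_le)
      then show ?thesis
        by (simp add: Vb_def mult_ac)
    qed
    obtain t where t: "t \<in> {0<..<T}" "V T - V 0 = V' t * (T - 0)"
      using mvt_simple[OF T, of V "\<lambda>t s. V' t * s"] der unfolding has_field_derivative_def by auto
    have "2 * Vb + 1 = h * T"
      using h by (simp add: T_def)
    also have "\<dots> \<le> V' t * T"
      using V'_ge[of t] t(1) T by (intro mult_right_mono) auto
    also have "\<dots> \<le> 2 * Vb"
      using t(2) V_le[of T] V_le[of 0] T by simp
    finally show False
      by simp
  qed
qed

section \<open>Total instability\<close>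

lemma eventually_coercive:
  fixes g :: "real ^ 'n::finite \<Rightarrow> real ^ 'n ^ 'n"
  assumes g: "\<And>i j. ((\<lambda>x. g x $ i $ j) \<longlongrightarrow> g 0 $ i $ j) (nhds 0)" and g0: "g 0 = mat 1"
  shows "\<forall>\<^sub>F x in nhds 0. \<forall>w. (norm w)\<^sup>2 \<le> 2 * (w \<bullet> (g x *v w))"
proof -
  define N where "N = real CARD('n)"
  have N: "N > 0"
    by (simp add: N_def)
  \<comment> \<open>An error \<open>e\<close> in each of the \<open>N\<^sup>2\<close> entries
    changes the quadratic form by at most half of the squared norm, which leaves the coercivity
    constant 1/2.\<close>
  define e where "e = 1 / (2 * N\<^sup>2)"
  have "e > 0"
    using N by (simp add: e_def)
  then have "\<forall>\<^sub>F x in nhds 0. \<forall>i j. dist (g x $ i $ j) (g 0 $ i $ j) < e"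
    by (intro eventually_all_finite tendstoD[OF g])
  then show ?thesis
  proof (rule eventually_mono, intro allI)
    fix x and w :: "real ^ 'n"
    assume x: "\<forall>i j. dist (g x $ i $ j) (g 0 $ i $ j) < e"
    have w: "\<bar>w $ i\<bar> \<le> norm w" for i
      by (rule component_le_norm_cart)
    have "\<bar>((g x - g 0) *v w) $ i\<bar> \<le> N * (e * norm w)" for i
      unfolding matrix_vector_mult_def vec_lambda_beta N_def
      using x w by (intro abs_sum_mult_le) (auto simp: dist_real_def less_imp_le)
    then have "\<bar>\<Sum>i\<in>UNIV. w $ i * ((g x - g 0) *v w) $ i\<bar> \<le> N * (norm w * (N * (e * norm w)))"
      unfolding N_def by (intro abs_sum_mult_le w)
    also have "\<dots> = (norm w)\<^sup>2 / 2"
      using N by (simp add: e_def power2_eq_square field_simps)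
    finally have "\<bar>w \<bullet> ((g x - g 0) *v w)\<bar> \<le> (norm w)\<^sup>2 / 2"
      by (simp add: inner_vec_def)
    moreover have "w \<bullet> ((g x - g 0) *v w) = w \<bullet> (g x *v w) - (norm w)\<^sup>2"
      by (simp add: matrix_vector_mult_diff_rdistrib inner_diff_right g0 power2_norm_eq_inner)
    ultimately show "(norm w)\<^sup>2 \<le> 2 * (w \<bullet> (g x *v w))"
      by linarith
  qed
qed

lemma metric_degree_pos: "1 \<le> metric_degree g"
  unfolding metric_degree_def by (rule Inf_greatest) (auto simp: one_enat_def)

lemma magnetic_degree_le: "nonzero_term (\<lambda>x. \<sigma> x $ i) k \<Longrightarrow> magnetic_degree \<sigma> \<le> enat k"
  unfolding magnetic_degree_def by (rule Inf_lower) auto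

theorem proposition1p3:
  fixes W :: "(real ^ 'n::finite) set"
    and U :: "real ^ 'n \<Rightarrow> real"
    and \<sigma> :: "real ^ 'n \<Rightarrow> real ^ 'n"
    and g :: "real ^ 'n \<Rightarrow> real ^ 'n ^ 'n"
    and l1 l2 :: nat
    and m \<kappa> d :: enat
  assumes "open W" and "0 \<in> W"
    and "real_analytic_on U W"
    and "analytic_one_form_on \<sigma> W"
    and "analytic_metric_on g W"
    and "U 0 = 0"
    and "(U has_derivative (\<lambda>_. 0)) (at 0)"
    and "g 0 = mat 1"
    and "\<not> (\<exists>P. homogeneous_polynomial P \<and> (\<forall>\<^sub>F x in nhds 0. U x = P x))"
    and "l1 = first_degree U"
    and "l2 = second_degree U"
    and "m = metric_degree g"
    and "\<kappa> = min (enat (l2 - l1)) m"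
    and "d = magnetic_degree \<sigma>"
    and "ereal_of_enat d - ereal (real l1 / 2) > ereal_of_enat \<kappa>"
    and "\<And>q. sphere_critical_point (hom_term U l1) q \<Longrightarrow> hom_term U l1 q \<le> 0 \<Longrightarrow>
           criterion l1 l2 m \<kappa> U g q > 0"
  shows "totally_unstable W g \<sigma> U 0"
proof -
  obtain c where c: "power_series_at U 0 c"
    using assms(2,3) unfolding real_analytic_on_def by blast
  have "\<forall>i. \<exists>c. power_series_at (\<lambda>x. \<sigma> x $ i) 0 c"
    using assms(2,4) unfolding analytic_one_form_on_def real_analytic_on_def by blast
  then obtain c\<sigma> where c\<sigma>: "\<And>i. power_series_at (\<lambda>x. \<sigma> x $ i) 0 (c\<sigma> i)"
    by metis
  have "\<forall>i j. \<exists>c. power_series_at (\<lambda>x. g x $ i $ j) 0 c"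
    using assms(2,5) unfolding analytic_metric_on_def real_analytic_on_def by blast
  then obtain cg where cg: "\<And>i j. power_series_at (\<lambda>x. g x $ i $ j) 0 (cg i j)"
    by metis
  have sym: "transpose (g x) = g x" if "x \<in> W" for x
    using assms(5) that unfolding analytic_metric_on_def by blast
  note deg = first_second_degree[OF c assms(9), folded assms(10,11)]
  have "\<not> l1 < 2"
    using deg(4) critical_zero_hom_part_low[OF c assms(6,7)] by blast
  then obtain a where a: "l1 = Suc (Suc a)"
    by (metis One_nat_def less_2_cases_iff nat.exhaust)
  \<comment> \<open>\<open>\<kappa>\<close> is finite even for a Euclidean metric, being bounded by
    \<open>l2 - l1\<close>.\<close>
  obtain k where k: "\<kappa> = enat k"
    using assms(13) by (metis enat_ord_simps(4) min.strict_coboundedI1 not_enat_eq enat_ord_code(4))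
  have k_le: "k \<le> l2 - l1"
    using assms(13) k by (metis enat_ord_simps(1) min.cobounded1)
  have "1 \<le> \<kappa>"
    using assms(12,13) deg(1) metric_degree_pos[of g] by (simp add: one_enat_def)
  then have k1: "k \<ge> 1"
    using k by (simp add: one_enat_def)
  \<comment> \<open>If the germ of \<open>\<sigma>\<close> is zero, its degree is infinite and every
    \<open>D\<close> satisfies the first condition; a sufficiently large one is taken.\<close>
  obtain D where D: "\<And>i j x. j < D \<Longrightarrow> hom_part (c\<sigma> i) j x = 0" "l1 + 2 * k < 2 * D"
  proof (cases d)
    case (enat D)
    have "real D - real l1 / 2 > real k"
      using assms(15) k enat by simp
    then have "l1 + 2 * k < 2 * D"
      by linarith
    moreover have "hom_part (c\<sigma> i) j x = 0" if "j < D" for i j x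
    proof (rule ccontr)
      assume "hom_part (c\<sigma> i) j x \<noteq> 0"
      then have "magnetic_degree \<sigma> \<le> enat j"
        using nonzero_term_iff[OF c\<sigma>] by (intro magnetic_degree_le) blast
      then show False
        using that enat assms(14) by simp
    qed
    ultimately show thesis
      by (intro that[of D])
  next
    case infinity
    have "hom_part (c\<sigma> i) j x = 0" for i j x
    proof (rule ccontr)
      assume "hom_part (c\<sigma> i) j x \<noteq> 0"
      then have "magnetic_degree \<sigma> \<le> enat j"
        using nonzero_term_iff[OF c\<sigma>] by (intro magnetic_degree_le) blast
      then show False
        using infinity assms(14) by simp
    qed
    then show thesis
      by (intro that[of "l1 + 2 * k + 1"]) auto
  qed
  define e where "e = Suc (Suc a) + k + 1"
  \<comment> \<open>The derivatives of \<open>\<sigma>\<close> begin in degree \<open>D - 1\<close>.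
    From \<open>l1 + 2 * k < 2 * D\<close> follows \<open>2 * D - 1 \<ge> l1 + 2 * k\<close>, which
    is at least \<open>l1 + k + 1\<close> because \<open>k \<ge> 1\<close>.\<close>
  have e: "e \<le> 2 * (D - 1) + 1"
    using D(2) k1 by (simp add: e_def a)
  \<comment> \<open>A zero of the full gradient is critical on the sphere, and the first term of
    \<open>U\<close> vanishes there, so the criterion hypothesis applies. The metric summand
    contains this zero value as a factor, and positivity of the other summand forces its Kronecker
    factor to be 1.\<close>
  have crit: "l2 = Suc (Suc a) + k \<and> hom_part c l2 q < 0"
    if q: "norm q = 1" "\<And>i. hom_part (dcoeff i c) (Suc a) q = 0" for q
  proof -
    have f0: "hom_part c l1 q = 0"
      using hom_part_euler[of q c "Suc a"] q(2) by (simp add: a)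
    have "(hom_part c l1 has_derivative (\<lambda>h. \<Sum>i\<in>UNIV. h $ i * hom_part (dcoeff i c) (Suc a) q)) (at q)"
      unfolding a by (rule hom_part_has_derivative)
    then have "sphere_critical_point (hom_term U l1) q"
      unfolding sphere_critical_point_def hom_term_eq[OF c] using q by (intro conjI exI) auto
    then have pos: "criterion l1 l2 m \<kappa> U g q > 0"
      using f0 by (intro assms(16)) (simp_all add: hom_term_eq[OF c])
    have "criterion l1 l2 m \<kappa> U g q = - kronecker \<kappa> (enat (l2 - l1)) * real (l2 - l1) * hom_part c l2 q"
      by (simp add: criterion_def hom_term_eq[OF c] f0)
    with pos have *: "- kronecker \<kappa> (enat (l2 - l1)) * real (l2 - l1) * hom_part c l2 q > 0"
      by (simp only:)
    then have kl: "k = l2 - l1"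
      using k by (auto simp: kronecker_def split: if_splits)
    then have "l2 = Suc (Suc a) + k"
      using deg(1) a by linarith
    moreover have "hom_part c l2 q < 0"
      using * kl k deg(1) by (simp add: kronecker_def zero_less_mult_iff mult_less_0_iff)
    ultimately show ?thesis ..
  qed
  obtain A where A: "A \<ge> 0"
    "\<And>K. \<forall>\<^sub>F x in nhds 0. x \<noteq> 0 \<longrightarrow> K * norm x ^ e \<le>
       A * (\<Sum>i\<in>UNIV. weighted_grad c a k i x * partial i U x)
       - ((\<Sum>i\<in>UNIV. x $ i * partial i U x) - real (Suc (Suc a)) * U x)"
  proof (rule radial_inequality[OF c, of a l2 k, folded e_def])
    show "Suc (Suc a) + k \<le> l2"
      using k_le deg(1) by (simp add: a)
  qed (use deg(2,3)[unfolded a] k1 crit in blast)+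
  obtain Cw Dw where w: "Cw \<ge> 0"
    "\<And>i x. x \<noteq> 0 \<Longrightarrow> (weighted_grad c a k i has_derivative (\<lambda>h. \<Sum>j\<in>UNIV. h $ j * Dw i j x)) (at x)"
    "\<And>i x. x \<noteq> 0 \<Longrightarrow> \<bar>weighted_grad c a k i x\<bar> \<le> Cw * norm x ^ Suc k"
    "\<And>i j x. x \<noteq> 0 \<Longrightarrow> \<bar>Dw i j x\<bar> \<le> Cw * norm x ^ k"
    by (rule weighted_grad_estimates[of c a k]) blast
  obtain Cg where Cg: "Cg \<ge> 0" "\<forall>\<^sub>F x in nhds 0. \<forall>p. \<bar>g x $ fst p $ snd p\<bar> \<le> Cg * norm x ^ 0"
    by (rule power_series_family_bound[of "\<lambda>p x. g x $ fst p $ snd p" "\<lambda>p. cg (fst p) (snd p)" 0, OF cg]) auto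
  obtain Cdg where Cdg: "Cdg \<ge> 0" "\<forall>\<^sub>F x in nhds 0. \<forall>p. \<bar>partial (fst p) (\<lambda>y. g y $ fst (snd p) $ snd (snd p)) x\<bar> \<le> Cdg * norm x ^ 0"
    by (rule power_series_family_bound[of "\<lambda>p. partial (fst p) (\<lambda>y. g y $ fst (snd p) $ snd (snd p))"
          "\<lambda>p. dcoeff (fst p) (cg (fst (snd p)) (snd (snd p)))" 0, OF power_series_partial[OF cg]]) auto
  \<comment> \<open>Differentiation lowers the order of vanishing of \<open>\<sigma>\<close> by
    one.\<close>
  have d\<sigma>0: "hom_part (dcoeff i (c\<sigma> l)) j x = 0" if "j < D - 1" for i l j x
    by (rule hom_part_dcoeff_zero, rule D(1)) (use that in simp)
  obtain C\<sigma> where C\<sigma>: "C\<sigma> \<ge> 0" "\<forall>\<^sub>F x in nhds 0. \<forall>p. \<bar>partial (fst p) (\<lambda>y. \<sigma> y $ snd p) x\<bar> \<le> C\<sigma> * norm x ^ (D - 1)"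
    by (rule power_series_family_bound[of "\<lambda>p. partial (fst p) (\<lambda>y. \<sigma> y $ snd p)"
          "\<lambda>p. dcoeff (fst p) (c\<sigma> (snd p))" "D - 1", OF power_series_partial[OF c\<sigma>] d\<sigma>0]) auto
  define M where "M = Cw + Cg + Cdg + C\<sigma>"
  have M: "M \<ge> 0" "Cw \<le> M" "Cg \<le> M" "Cdg \<le> M" "C\<sigma> \<le> M"
    using w(1) Cg(1) Cdg(1) C\<sigma>(1) by (auto simp: M_def)
  define N where "N = real CARD('n)"
  define K where "K = N * (A * N\<^sup>2 * M\<^sup>2 + (1 + A * M) * (5 / 2 * N\<^sup>2 * M) + (1 + A * M) * (2 * N * M))"
  have K: "K \<ge> 0"
    using A(1) M(1) by (simp add: K_def N_def)
  have "\<forall>\<^sub>F \<rho> in at_right 0. \<forall>i j. lip_bdd (cball 0 \<rho>) (\<lambda>x. g x $ i $ j)"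
    by (intro eventually_all_finite lip_bdd_power_series[OF cg])
  moreover have "\<forall>\<^sub>F \<rho> in at_right 0. \<forall>i j k. lip_bdd (cball 0 \<rho>) (partial k (\<lambda>x. g x $ i $ j))"
    by (intro eventually_all_finite lip_bdd_power_series[OF power_series_partial[OF cg]])
  moreover have "\<forall>\<^sub>F \<rho> in at_right 0. \<forall>i j. lip_bdd (cball 0 \<rho>) (partial i (\<lambda>x. \<sigma> x $ j))"
    by (intro eventually_all_finite lip_bdd_power_series[OF power_series_partial[OF c\<sigma>]])
  moreover have "\<forall>\<^sub>F \<rho> in at_right 0. \<forall>i. lip_bdd (cball 0 \<rho>) (partial i U)"
    by (intro eventually_all_finite lip_bdd_power_series[OF power_series_partial[OF c]])
  moreover have "\<forall>\<^sub>F \<rho> in at_right 0. 0 < \<rho> \<and> \<rho> < 1 \<and> 8 * K * \<rho> \<le> 1"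
  proof -
    have "\<forall>\<^sub>F \<rho> in at_right 0. \<rho> < min 1 (1 / (8 * K + 1))"
      using K by (intro order_tendstoD(2)[OF tendsto_ident_at]) auto
    then show ?thesis
      using eventually_at_right_less[of "0::real"]
    proof eventually_elim
      case (elim \<rho>)
      then have "\<rho> * (8 * K + 1) < 1"
        using K by (simp add: pos_less_divide_eq)
      then show ?case
        using elim by (simp add: algebra_simps)
    qed
  qed
  moreover have "\<forall>\<^sub>F \<rho> in at_right 0. \<forall>x\<in>cball 0 \<rho>. x \<in> W"
    by (intro eventually_small_cball eventually_nhds_in_open assms(1,2))
  moreover have "\<forall>\<^sub>F \<rho> in at_right 0. \<forall>x\<in>cball 0 \<rho>. \<bar>U x\<bar> < 1"
    using tendstoD[OF power_series_tendsto[OF c], of 1]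
    by (intro eventually_small_cball) (simp add: assms(6))
  moreover have "\<forall>\<^sub>F \<rho> in at_right 0. \<forall>x\<in>cball 0 \<rho>. (U has_derivative (\<lambda>h. \<Sum>i\<in>UNIV. h $ i * partial i U x)) (at x)"
    by (intro eventually_small_cball power_series_eventually_differentiable[OF c])
  moreover have "\<forall>\<^sub>F \<rho> in at_right 0. \<forall>x\<in>cball 0 \<rho>. \<forall>i j. ((\<lambda>y. g y $ i $ j) has_derivative
      (\<lambda>h. \<Sum>k\<in>UNIV. h $ k * partial k (\<lambda>y. g y $ i $ j) x)) (at x)"
    by (intro eventually_small_cball eventually_all_finite power_series_eventually_differentiable[OF cg])
  moreover have "\<forall>\<^sub>F \<rho> in at_right 0. \<forall>x\<in>cball 0 \<rho>. \<forall>w. (norm w)\<^sup>2 \<le> 2 * (w \<bullet> (g x *v w))"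
    by (intro eventually_small_cball eventually_coercive power_series_tendsto[OF cg] assms(8))
  moreover note eventually_small_cball[OF Cg(2)] eventually_small_cball[OF Cdg(2)]
    eventually_small_cball[OF C\<sigma>(2)] eventually_small_cball[OF A(2)[of K]]
  ultimately have "\<forall>\<^sub>F \<rho> in at_right (0::real). totally_unstable W g \<sigma> U 0"
  proof eventually_elim
    case (elim \<rho>)
    have r1: "norm x \<le> 1" if "x \<in> cball 0 \<rho>" for x :: "real ^ 'n"
      using that elim(5) by simp
    have gM: "\<bar>g x $ i $ j\<bar> \<le> M" if "x \<in> cball 0 \<rho>" for i j x
      using elim(11)[rule_format, OF that, of "(i, j)"] M(3) by simp
    have dgM: "\<bar>partial l (\<lambda>y. g y $ i $ j) x\<bar> \<le> M" if "x \<in> cball 0 \<rho>" for i j l x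
      using elim(12)[rule_format, OF that, of "(l, i, j)"] M(4) by simp
    have d\<sigma>M: "\<bar>partial i (\<lambda>y. \<sigma> y $ j) x\<bar> \<le> M * norm x ^ (D - 1)" if "x \<in> cball 0 \<rho>" for i j x
    proof -
      have "\<bar>partial i (\<lambda>y. \<sigma> y $ j) x\<bar> \<le> C\<sigma> * norm x ^ (D - 1)"
        using elim(13)[rule_format, OF that, of "(i, j)"] by simp
      also have "\<dots> \<le> M * norm x ^ (D - 1)"
        using M(5) by (intro mult_right_mono) auto
      finally show ?thesis .
    qed
    have wM: "\<bar>weighted_grad c a k i x\<bar> \<le> M * norm x" and DwM: "\<bar>Dw i j x\<bar> \<le> M * norm x"
      if x: "x \<in> cball 0 \<rho>" "x \<noteq> 0" for i j x
    proof -
      \<comment> \<open>Here \<open>k \<ge> 1\<close> enters: in the unit ball the derivative of the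
        weighted gradient, of degree \<open>k\<close>, is bounded by a multiple of
        \<open>norm x\<close>, just like the weighted gradient itself.\<close>
      have "Cw * norm x ^ j \<le> M * norm x" if "j \<ge> 1" for j
        using M(1,2) power_decreasing[OF that norm_ge_zero r1[OF x(1)]] by (intro mult_mono) auto
      from this[of "Suc k"] this[OF k1]
      have "Cw * norm x ^ Suc k \<le> M * norm x" "Cw * norm x ^ k \<le> M * norm x"
        by auto
      then show "\<bar>weighted_grad c a k i x\<bar> \<le> M * norm x" "\<bar>Dw i j x\<bar> \<le> M * norm x"
        using w(3)[OF x(2), of i] w(4)[OF x(2), of i j] by linarith+
    qed
    show ?case
    proof (rule escape_from_ball[of \<rho> W U g \<sigma> A M "weighted_grad c a k" Dw])
      show "\<rho> > 0" "\<rho> \<le> 1" "cball 0 \<rho> \<subseteq> W"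
        using elim(5,6) by auto
      show "transpose (g x) = g x" if "x \<in> cball 0 \<rho>" for x
        by (rule sym[OF elim(6)[rule_format, OF that]])
      fix x v :: "real ^ 'n"
      assume x: "x \<in> cball 0 \<rho>" "x \<noteq> 0" and neg: "energy g U (x, v) < 0"
      show "- energy g U (x, v) \<le> (\<Sum>l\<in>UNIV. (v $ l - A * (\<Sum>j\<in>UNIV. v $ j * Dw l j x)) * (g x *v v) $ l
        + (momentum_drift g x v l + EL_force g \<sigma> U x v $ l) * (x $ l - A * weighted_grad c a k l x))"
      proof (rule lyapunov_rate_lower_bound[OF lyapunov_rate_estimate[OF A(1) M(1) gM[OF x(1)] dgM[OF x(1)]
              d\<sigma>M[OF x(1)] wM[OF x] DwM[OF x] N_def K_def], where e = e and ?l1.0 = "Suc (Suc a)" and U = "U x"])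
        show "(norm v)\<^sup>2 \<le> 2 * (v \<bullet> (g x *v v))"
          using elim(10) x(1) by blast
        show "0 \<le> norm x" "norm x \<le> 1" "0 \<le> norm v" "K \<ge> 0"
          using r1[OF x(1)] K by auto
        have "8 * K * norm x \<le> 8 * K * \<rho>"
          using x(1) K by (intro mult_left_mono) auto
        then show "8 * K * norm x \<le> 1"
          using elim(5) by linarith
        show "K * norm x ^ e \<le> A * (\<Sum>l\<in>UNIV. weighted_grad c a k l x * partial l U x)
           - ((\<Sum>l\<in>UNIV. x $ l * partial l U x) - real (Suc (Suc a)) * U x)"
          using elim(14) x by blast
        show "energy g U (x, v) = v \<bullet> (g x *v v) / 2 + U x"
          by (simp add: energy_def)
      qed (use e neg in auto)
    qed (assumption | rule assms(6) A(1) M(1) gM wM w(2) elim(4)[rule_format] elim(1)[rule_format]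
        elim(2)[rule_format] elim(3)[rule_format] elim(7)[rule_format] elim(8)[rule_format]
        elim(9)[rule_format] elim(10)[rule_format])+
  qed
  \<comment> \<open>The claim does not depend on the radius, and \<open>at_right 0\<close> is a
    nontrivial filter.\<close>
  then show ?thesis
    by simp
qed

end
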